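(* Let $d=2$. Consider the problem of minimizing $\tilde J(y,a):=\frac12\|y-y_d\|_{L^2(\Omega)}^2+\int_\Omega g(a(x))\,dx$ over $a\in\mathcal A$ with $a(x)\in\mathcal M\cap\operatorname{span}(I_2)$ for a.a. $x$ (identify $a$ with a scalar function $a\ge\alpha$), where $y\in H^1_0(\Omega)$ solves $\int_\Omega a\nabla y\cdot\nabla v=\int_\Omega fv$ for all $v\in H^1_0(\Omega)$. Let $a$ be a local solution with respect to the $L^1(\Omega)$-norm, with state $y$ and adjoint $p$. Then for almost all $x_0\in\Omega$ and all $b\ge\alpha$, \[ -(b-a(x_0))\nabla y(x_0)\cdot\nabla p(x_0)+g(b)-g(a(x_0))+\frac12\frac{(b-a(x_0))^2}{b}\Big(\nabla y(x_0)\cdot\nabla p(x_0)-\|\nabla y(x_0)\|_2\|\nabla p(x_0)\|_2\Big)\ge0. \]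
   Context: $\Omega\subset\mathbb R^2$ bounded domain, $\alpha>0$, $y_d,f\in L^2(\Omega)$; $\mathcal M:=\{A\in\mathbb R^{2\times2}:\xi^TA\xi\ge\alpha|\xi|^2\ \forall\xi\}$, $\mathcal A:=\{a\in L^\infty(\Omega;\mathbb R^{2\times2}):a(x)\in\mathcal M\text{ a.e.}\}$. $g$ is lower semicontinuous with values in $\mathbb R\cup\{+\infty\}$. The adjoint $p\in H^1_0(\Omega)$ solves $\int_\Omega a\nabla v\cdot\nabla p=\int_\Omega(y-y_d)v$ for all $v\in H^1_0(\Omega)$. "Local solution w.r.t. the $L^1$-norm": there is $\varepsilon>0$ such that $\tilde J(y,a)\le\tilde J(\hat y,\hat a)$ for all feasible $\hat a$ with $\|\hat a-a\|_{L^1(\Omega)}<\varepsilon$. *)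

theory Defs
  imports "HOL-Analysis.Analysis"
begin

definition lsc :: "(real \<Rightarrow> ereal) \<Rightarrow> bool" where
  "lsc g \<longleftrightarrow> (\<forall>c. open {t. c < g t})"

text \<open>Smooth (C-infinity) functions with compact support contained in \<open>\<Omega>\<close>.
  \<open>F \<alpha>\<close> is the iterated partial derivative along the multi-index (list of directions) \<open>\<alpha>\<close>.\<close>
definition Cc_inf :: "(real^2) set \<Rightarrow> (real^2 \<Rightarrow> real) \<Rightarrow> bool" where
  "Cc_inf \<Omega> \<phi> \<longleftrightarrow>
     (\<exists>F :: 2 list \<Rightarrow> real^2 \<Rightarrow> real. F [] = \<phi> \<and>
        (\<forall>\<alpha> x. (F \<alpha> has_derivative (\<lambda>h. \<Sum>i\<in>UNIV. h $ i * F (i # \<alpha>) x)) (at x))) \<and>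
     compact (closure {x. \<phi> x \<noteq> 0}) \<and> closure {x. \<phi> x \<noteq> 0} \<subseteq> \<Omega>"

definition grad :: "(real^2 \<Rightarrow> real) \<Rightarrow> real^2 \<Rightarrow> real^2" where
  "grad \<phi> x = (\<chi> i. frechet_derivative \<phi> (at x) (axis i 1))"

text \<open>\<open>H10 \<Omega> u G\<close>: \<open>u \<in> H^1_0(\<Omega>)\<close> (closure of \<open>C_c^\<infinity>(\<Omega>)\<close> in the \<open>H^1\<close> norm)
  with weak gradient \<open>G\<close>.\<close>
definition H10 :: "(real^2) set \<Rightarrow> (real^2 \<Rightarrow> real) \<Rightarrow> (real^2 \<Rightarrow> real^2) \<Rightarrow> bool" where
  "H10 \<Omega> u G \<longleftrightarrow>
     u \<in> borel_measurable (lebesgue_on \<Omega>) \<and> G \<in> borel_measurable (lebesgue_on \<Omega>) \<and>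
     (\<exists>\<phi> :: nat \<Rightarrow> real^2 \<Rightarrow> real. (\<forall>n. Cc_inf \<Omega> (\<phi> n)) \<and>
        (\<lambda>n. \<integral>\<^sup>+ x\<in>\<Omega>. ennreal ((u x - \<phi> n x)\<^sup>2) \<partial>lebesgue) \<longlonglongrightarrow> 0 \<and>
        (\<lambda>n. \<integral>\<^sup>+ x\<in>\<Omega>. ennreal ((norm (G x - grad (\<phi> n) x))\<^sup>2) \<partial>lebesgue) \<longlonglongrightarrow> 0)"

definition L2 :: "(real^2) set \<Rightarrow> (real^2 \<Rightarrow> real) \<Rightarrow> bool" where
  "L2 \<Omega> f \<longleftrightarrow> f \<in> borel_measurable (lebesgue_on \<Omega>) \<and> integrable (lebesgue_on \<Omega>) (\<lambda>x. (f x)\<^sup>2)"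

definition admissible :: "real \<Rightarrow> (real^2) set \<Rightarrow> (real^2 \<Rightarrow> real) \<Rightarrow> bool" where
  "admissible \<alpha> \<Omega> a \<longleftrightarrow> a \<in> borel_measurable (lebesgue_on \<Omega>) \<and>
     (\<exists>C. AE x in lebesgue_on \<Omega>. \<alpha> \<le> a x \<and> a x \<le> C)"

definition is_state :: "(real^2) set \<Rightarrow> (real^2 \<Rightarrow> real) \<Rightarrow> (real^2 \<Rightarrow> real)
    \<Rightarrow> (real^2 \<Rightarrow> real) \<Rightarrow> (real^2 \<Rightarrow> real^2) \<Rightarrow> bool" where
  "is_state \<Omega> a f y Gy \<longleftrightarrow> H10 \<Omega> y Gy \<and>
     (\<forall>v Gv. H10 \<Omega> v Gv \<longrightarrow>
        (\<integral>x. a x * (Gy x \<bullet> Gv x) \<partial>lebesgue_on \<Omega>) = (\<integral>x. f x * v x \<partial>lebesgue_on \<Omega>))"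

definition is_adjoint :: "(real^2) set \<Rightarrow> (real^2 \<Rightarrow> real) \<Rightarrow> (real^2 \<Rightarrow> real) \<Rightarrow> (real^2 \<Rightarrow> real)
    \<Rightarrow> (real^2 \<Rightarrow> real) \<Rightarrow> (real^2 \<Rightarrow> real^2) \<Rightarrow> bool" where
  "is_adjoint \<Omega> a y yd p Gp \<longleftrightarrow> H10 \<Omega> p Gp \<and>
     (\<forall>v Gv. H10 \<Omega> v Gv \<longrightarrow>
        (\<integral>x. a x * (Gv x \<bullet> Gp x) \<partial>lebesgue_on \<Omega>) = (\<integral>x. (y x - yd x) * v x \<partial>lebesgue_on \<Omega>))"

definition gpos :: "(real^2) set \<Rightarrow> (real \<Rightarrow> ereal) \<Rightarrow> (real^2 \<Rightarrow> real) \<Rightarrow> ennreal" where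
  "gpos \<Omega> g a = (\<integral>\<^sup>+ x\<in>\<Omega>. e2ennreal (g (a x)) \<partial>lebesgue)"

definition gneg :: "(real^2) set \<Rightarrow> (real \<Rightarrow> ereal) \<Rightarrow> (real^2 \<Rightarrow> real) \<Rightarrow> ennreal" where
  "gneg \<Omega> g a = (\<integral>\<^sup>+ x\<in>\<Omega>. e2ennreal (- g (a x)) \<partial>lebesgue)"

text \<open>\<open>\<integral>_\<Omega> g(a(x)) dx \<in> \<real> \<union> {+\<infinity>}\<close>, meaningful when the negative part is finite.\<close>
definition gint :: "(real^2) set \<Rightarrow> (real \<Rightarrow> ereal) \<Rightarrow> (real^2 \<Rightarrow> real) \<Rightarrow> ereal" where
  "gint \<Omega> g a = enn2ereal (gpos \<Omega> g a) - enn2ereal (gneg \<Omega> g a)"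

definition Jt :: "(real^2) set \<Rightarrow> (real^2 \<Rightarrow> real) \<Rightarrow> (real \<Rightarrow> ereal)
    \<Rightarrow> (real^2 \<Rightarrow> real) \<Rightarrow> (real^2 \<Rightarrow> real) \<Rightarrow> ereal" where
  "Jt \<Omega> yd g y a = ereal ((\<integral>x. (y x - yd x)\<^sup>2 \<partial>lebesgue_on \<Omega>) / 2) + gint \<Omega> g a"

text \<open>Feasible coefficient: admissible and \<open>\<integral> g(a)\<close> well-defined in \<open>\<real> \<union> {+\<infinity>}\<close>.\<close>
definition feasible :: "real \<Rightarrow> (real^2) set \<Rightarrow> (real \<Rightarrow> ereal) \<Rightarrow> (real^2 \<Rightarrow> real) \<Rightarrow> bool" where
  "feasible \<alpha> \<Omega> g a \<longleftrightarrow> admissible \<alpha> \<Omega> a \<and> gneg \<Omega> g a < \<infinity>"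

definition L1dist :: "(real^2) set \<Rightarrow> (real^2 \<Rightarrow> real) \<Rightarrow> (real^2 \<Rightarrow> real) \<Rightarrow> ennreal" where
  "L1dist \<Omega> a b = (\<integral>\<^sup>+ x\<in>\<Omega>. ennreal \<bar>a x - b x\<bar> \<partial>lebesgue)"

end

theory Submission
  imports Defs "HOL-Computational_Algebra.Polynomial"
begin

text \<open>Replace \<open>a\<close> by \<open>b\<close> on a thin strip \<open>E\<close> of unit normal \<open>n\<close> inside a small square at a common Lebesgue
  point \<open>x0\<close> of \<open>a\<close>, \<open>\<nabla>y\<close>, \<open>\<nabla>p\<close> and \<open>g \<circ> a\<close>. Across a thin strip the tangential part of the gradient and
  the normal part of the flux are continuous, so on \<open>E\<close> the perturbed gradient is close to
  \<open>u - ((b - a x0) / b) (n \<bullet> u) n\<close> with \<open>u = \<nabla>y(x0)\<close>. The objective then changes by \<open>|E|\<close> times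
  \<open>-(b - a x0) u \<bullet> q + ((b - a x0)\<^sup>2 / b) (n \<bullet> u) (n \<bullet> q) + g b - g (a x0)\<close>, \<open>q = \<nabla>p(x0)\<close>, up to \<open>o(|E|)\<close>.
  Finally \<open>(n \<bullet> u) (n \<bullet> q)\<close> attains the value \<open>(u \<bullet> q - |u| |q|) / 2\<close> when \<open>n\<close> is parallel to the difference of
  the normalized vectors \<open>u\<close> and \<open>q\<close>. For fixed ratio of strip width to square size, the error terms
  vanish as the square shrinks to \<open>x0\<close>; the ratio is sent to zero afterwards.\<close>

section \<open>Square-integrable functions\<close>

text \<open>The effect to be detected has size |E|, while the gradients are only in L^2, so every
  error is measured by its energy and must be at most \<open>\<mu>\<^sup>2\<close> times |E|;
  Young's inequality with weight \<mu> then bounds its product with a field of energy O(|E|) by a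
  multiple of \<mu> |E|. Thinness makes this possible: a corrector of height about \<rho> R that is
  cut off over a length of order R has energy of order \<rho> R^2 in the strip but only \<rho>^2 R^2
  in the decay region. Such a corrector balances only the normal part of the flux jump (b - a x0) u.
  The tangential part is a multiple of \<open>rot n\<close> on E and is removed by the L^2
  orthogonality of rotated gradients to gradients of \<open>H10\<close> functions; integration by
  parts is developed for this orthogonality and for the Poincare inequality. Local optimality
  compares only coefficients that come with a state, so existence of states is part of the argument.
  The Lebesgue points are fixed before b, hence one null set serves all b.\<close>

definition square_integrable :: "'a measure \<Rightarrow> ('a \<Rightarrow> 'b::euclidean_space) \<Rightarrow> bool" where
  "square_integrable M f \<longleftrightarrow> f \<in> borel_measurable M \<and> integrable M (\<lambda>x. (norm (f x))\<^sup>2)"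

text \<open>The square is kept because the errors are compared with areas, and because the triangle
  and Young inequalities for squares avoid roots.\<close>

definition sqnorm :: "'a measure \<Rightarrow> ('a \<Rightarrow> 'b::euclidean_space) \<Rightarrow> real" where
  "sqnorm M f = (\<integral>x. (norm (f x))\<^sup>2 \<partial>M)"

lemma square_integrableD:
  assumes "square_integrable M f"
  shows "f \<in> borel_measurable M" "integrable M (\<lambda>x. (norm (f x))\<^sup>2)"
  using assms by (auto simp: square_integrable_def)

lemma sqnorm_nonneg [simp]: "sqnorm M f \<ge> 0"
  by (simp add: sqnorm_def)

lemma sqnorm_minus_commute: "sqnorm M (\<lambda>x. f x - g x) = sqnorm M (\<lambda>x. g x - f x)"
  by (simp add: sqnorm_def norm_minus_commute)

lemma norm_add_sq_le: "(norm (x + y))\<^sup>2 \<le> 2 * (norm x)\<^sup>2 + 2 * (norm (y::'a::real_normed_vector))\<^sup>2"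
proof -
  have "(norm (x + y))\<^sup>2 \<le> (norm x + norm y)\<^sup>2"
    by (simp add: norm_triangle_ineq power_mono)
  also have "\<dots> \<le> 2 * (norm x)\<^sup>2 + 2 * (norm y)\<^sup>2"
    using sum_squares_bound[of "norm x" "norm y"] by (simp add: power2_sum)
  finally show ?thesis .
qed

lemma square_integrable_bound:
  assumes "f \<in> borel_measurable M" "integrable M h" "AE x in M. (norm (f x))\<^sup>2 \<le> h x"
  shows "square_integrable M f"
  unfolding square_integrable_def
proof (intro conjI Bochner_Integration.integrable_bound[OF assms(2)])
  show "AE x in M. norm ((norm (f x))\<^sup>2) \<le> norm (h x)"
    using assms(3) by eventually_elim auto
qed (use assms(1) in measurable)

lemma square_integrable_add:
  assumes "square_integrable M f" "square_integrable M g"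
  shows "square_integrable M (\<lambda>x. f x + g x)"
proof (rule square_integrable_bound)
  show "integrable M (\<lambda>x. 2 * (norm (f x))\<^sup>2 + 2 * (norm (g x))\<^sup>2)"
    using assms by (auto simp: square_integrable_def)
qed (use assms in \<open>auto simp: square_integrable_def norm_add_sq_le\<close>)

lemma sqnorm_add_le:
  assumes "square_integrable M f" "square_integrable M g"
  shows "sqnorm M (\<lambda>x. f x + g x) \<le> 2 * sqnorm M f + 2 * sqnorm M g"
proof -
  have "sqnorm M (\<lambda>x. f x + g x) \<le> (\<integral>x. 2 * (norm (f x))\<^sup>2 + 2 * (norm (g x))\<^sup>2 \<partial>M)"
    unfolding sqnorm_def
    using assms square_integrable_add[OF assms]
    by (intro integral_mono norm_add_sq_le) (auto simp: square_integrable_def)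
  then show ?thesis
    using assms by (simp add: sqnorm_def square_integrable_def)
qed

lemma square_integrable_bounded_scaleR:
  assumes "square_integrable M f" "k \<in> borel_measurable M" "AE x in M. \<bar>k x\<bar> \<le> C"
  shows "square_integrable M (\<lambda>x. k x *\<^sub>R f x)"
proof (rule square_integrable_bound)
  show "integrable M (\<lambda>x. C\<^sup>2 * (norm (f x))\<^sup>2)"
    using assms by (auto simp: square_integrable_def)
  show "AE x in M. (norm (k x *\<^sub>R f x))\<^sup>2 \<le> C\<^sup>2 * (norm (f x))\<^sup>2"
    using assms(3)
  proof eventually_elim
    fix x assume "\<bar>k x\<bar> \<le> C"
    then have "\<bar>k x\<bar>\<^sup>2 \<le> C\<^sup>2" by (intro power_mono) auto
    then show "(norm (k x *\<^sub>R f x))\<^sup>2 \<le> C\<^sup>2 * (norm (f x))\<^sup>2"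
      by (simp add: power_mult_distrib mult_right_mono)
  qed
qed (use assms in \<open>auto simp: square_integrable_def\<close>)

lemma square_integrable_scaleR:
  "square_integrable M f \<Longrightarrow> square_integrable M (\<lambda>x. c *\<^sub>R f x)"
  by (rule square_integrable_bounded_scaleR[where C="\<bar>c\<bar>"]) auto

lemma square_integrable_mult:
  fixes f :: "'a \<Rightarrow> real"
  shows "square_integrable M f \<Longrightarrow> square_integrable M (\<lambda>x. c * f x)"
  using square_integrable_scaleR[of M f c] by simp

lemma sqnorm_scaleR: "sqnorm M (\<lambda>x. c *\<^sub>R f x) = c\<^sup>2 * sqnorm M f"
  by (simp add: sqnorm_def power_mult_distrib)

lemma sqnorm_mult: "sqnorm M (\<lambda>x. c * f x :: real) = c\<^sup>2 * sqnorm M f"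
  using sqnorm_scaleR[of M c f] by simp

lemma square_integrable_diff:
  assumes "square_integrable M f" "square_integrable M g"
  shows "square_integrable M (\<lambda>x. f x - g x)"
  using square_integrable_add[OF assms(1) square_integrable_scaleR[OF assms(2), of "-1"]] by simp

lemma sqnorm_diff_le:
  assumes "square_integrable M f" "square_integrable M g"
  shows "sqnorm M (\<lambda>x. f x - g x) \<le> 2 * sqnorm M f + 2 * sqnorm M g"
  using sqnorm_add_le[OF assms(1) square_integrable_scaleR[OF assms(2), of "-1"]]
  by (simp add: sqnorm_def)

lemma square_integrable_const:
  assumes "finite_measure M" shows "square_integrable M (\<lambda>x. c)"
  using assms by (simp add: square_integrable_def finite_measure.integrable_const)

lemma square_integrable_indicator:
  assumes "square_integrable M f" "A \<in> sets M"
  shows "square_integrable M (\<lambda>x. indicat_real A x *\<^sub>R f x)"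
  using assms by (intro square_integrable_bounded_scaleR[where C=1]) (auto simp: indicator_def)

lemma integrable_inner:
  assumes "square_integrable M f" "square_integrable M g"
  shows "integrable M (\<lambda>x. f x \<bullet> g x)"
proof -
  have "integrable M (\<lambda>x. (norm (f x))\<^sup>2 + (norm (g x))\<^sup>2)"
    using assms by (auto simp: square_integrable_def)
  then show ?thesis
  proof (rule Bochner_Integration.integrable_bound)
    show "AE x in M. norm (f x \<bullet> g x) \<le> norm ((norm (f x))\<^sup>2 + (norm (g x))\<^sup>2)"
    proof (rule AE_I2)
      fix x
      have "\<bar>f x \<bullet> g x\<bar> \<le> norm (f x) * norm (g x)" by (rule Cauchy_Schwarz_ineq2)
      also have "\<dots> \<le> (norm (f x))\<^sup>2 + (norm (g x))\<^sup>2"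
        using sum_squares_bound[of "norm (f x)" "norm (g x)"]
          mult_nonneg_nonneg[OF norm_ge_zero norm_ge_zero, of "f x" "g x"] by linarith
      finally show "norm (f x \<bullet> g x) \<le> norm ((norm (f x))\<^sup>2 + (norm (g x))\<^sup>2)" by simp
    qed
  qed (use assms in \<open>auto simp: square_integrable_def\<close>)
qed

lemma integrable_mult_square:
  fixes f g :: "'a \<Rightarrow> real"
  assumes "square_integrable M f" "square_integrable M g"
  shows "integrable M (\<lambda>x. f x * g x)"
  using integrable_inner[OF assms] by simp

text \<open>Young's inequality, integrated from 0 <= (|f| - t |g|)^2 / t. The free weight matters: a
  multiple of the ellipticity constant lets a term be absorbed by the coercive energy, and a small
  weight balances a small factor against one that is merely bounded.\<close>

lemma integral_inner_le_sqnorm: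
  assumes "square_integrable M f" "square_integrable M g" "t > 0"
  shows "2 * \<bar>\<integral>x. f x \<bullet> g x \<partial>M\<bar> \<le> sqnorm M f / t + t * sqnorm M g"
proof -
  have "\<bar>\<integral>x. 2 * (f x \<bullet> g x) \<partial>M\<bar> \<le> (\<integral>x. (norm (f x))\<^sup>2 / t + t * (norm (g x))\<^sup>2 \<partial>M)"
  proof (rule order_trans[OF integral_abs_bound], rule integral_mono)
    fix x
    have "\<bar>f x \<bullet> g x\<bar> \<le> norm (f x) * norm (g x)" by (rule Cauchy_Schwarz_ineq2)
    also have "2 * \<dots> \<le> (norm (f x))\<^sup>2 / t + t * (norm (g x))\<^sup>2"
    proof -
      have "0 \<le> (norm (f x) - t * norm (g x))\<^sup>2 / t" using \<open>t > 0\<close> by simp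
      also have "\<dots> = (norm (f x))\<^sup>2 / t + t * (norm (g x))\<^sup>2 - 2 * (norm (f x) * norm (g x))"
        using \<open>t > 0\<close> by (simp add: field_simps power2_eq_square)
      finally show ?thesis by simp
    qed
    finally show "\<bar>2 * (f x \<bullet> g x)\<bar> \<le> (norm (f x))\<^sup>2 / t + t * (norm (g x))\<^sup>2" by simp
  qed (use assms integrable_inner[OF assms(1,2)] in \<open>auto simp: square_integrable_def\<close>)
  also have "\<dots> = sqnorm M f / t + t * sqnorm M g"
    using assms by (simp add: sqnorm_def square_integrable_def)
  finally show ?thesis by (simp add: abs_mult)
qed

text \<open>Young's inequality with the optimal weight, the quotient of the two norms. Since either
  norm may vanish, both are first increased by \<open>e > 0\<close>, and \<open>e\<close> is sent to
  0 at the end.\<close>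

lemma integral_inner_Cauchy_Schwarz:
  assumes "square_integrable M f" "square_integrable M g"
  shows "\<bar>\<integral>x. f x \<bullet> g x \<partial>M\<bar> \<le> sqrt (sqnorm M f) * sqrt (sqnorm M g)"
proof -
  let ?I = "\<bar>\<integral>x. f x \<bullet> g x \<partial>M\<bar>" and ?a = "sqrt (sqnorm M f)" and ?b = "sqrt (sqnorm M g)"
  have le: "2 * ?I \<le> ?a\<^sup>2 / t + t * ?b\<^sup>2" if "t > 0" for t
    using integral_inner_le_sqnorm[OF assms that] by simp
  have nn: "?a \<ge> 0" "?b \<ge> 0" by auto
  have bound: "?I \<le> (?a + e) * (?b + e)" if "e > 0" for e
  proof -
    let ?A = "?a + e" and ?B = "?b + e"
    have pos: "?A > 0" "?B > 0" using nn that by linarith+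
    have "2 * ?I \<le> ?a\<^sup>2 / (?A/?B) + (?A/?B) * ?b\<^sup>2" using pos by (intro le) auto
    also have "\<dots> \<le> ?A\<^sup>2 / (?A/?B) + (?A/?B) * ?B\<^sup>2"
      using pos nn that by (intro add_mono divide_right_mono mult_left_mono power_mono) auto
    also have "\<dots> = 2 * (?A * ?B)" using pos by (simp add: power2_eq_square)
    finally show ?thesis by simp
  qed
  have "((\<lambda>e. (?a + e) * (?b + e)) \<longlongrightarrow> (?a + 0) * (?b + 0)) (at_right 0)"
    by (intro tendsto_intros)
  then have "?I \<le> (?a + 0) * (?b + 0)"
    by (rule tendsto_lowerbound) (auto simp: eventually_at_right_less bound intro: eventually_mono[OF eventually_at_right_less])
  then show ?thesis by simp
qed

text \<open>Expands f g - F G into three products, each with a factor tending to 0, and applies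
  Cauchy-Schwarz to each. This is the device that carries identities from smooth test functions to
  all of \<open>H10\<close>.\<close>

lemma tendsto_integral_inner:
  assumes f: "\<And>n. square_integrable M (f n)" "square_integrable M F"
    and g: "\<And>n. square_integrable M (g n)" "square_integrable M G"
    and lf: "(\<lambda>n. sqnorm M (\<lambda>x. f n x - F x)) \<longlonglongrightarrow> 0"
    and lg: "(\<lambda>n. sqnorm M (\<lambda>x. g n x - G x)) \<longlonglongrightarrow> 0"
  shows "(\<lambda>n. \<integral>x. f n x \<bullet> g n x \<partial>M) \<longlonglongrightarrow> (\<integral>x. F x \<bullet> G x \<partial>M)"
proof -
  have split: "(\<integral>x. f n x \<bullet> g n x \<partial>M) - (\<integral>x. F x \<bullet> G x \<partial>M) =
     (\<integral>x. (f n x - F x) \<bullet> (g n x - G x) \<partial>M) + (\<integral>x. (f n x - F x) \<bullet> G x \<partial>M) + (\<integral>x. F x \<bullet> (g n x - G x) \<partial>M)" for n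
  proof -
    have "(\<integral>x. f n x \<bullet> g n x \<partial>M) - (\<integral>x. F x \<bullet> G x \<partial>M) = (\<integral>x. f n x \<bullet> g n x - F x \<bullet> G x \<partial>M)"
      using f g by (simp add: integrable_inner)
    also have "\<dots> = (\<integral>x. ((f n x - F x) \<bullet> (g n x - G x) + (f n x - F x) \<bullet> G x) + F x \<bullet> (g n x - G x) \<partial>M)"
      by (simp add: algebra_simps)
    finally show ?thesis
      using f g by (simp only: integrable_inner square_integrable_diff Bochner_Integration.integral_add Bochner_Integration.integrable_add)
  qed
  let ?s = "\<lambda>n. sqrt (sqnorm M (\<lambda>x. f n x - F x))" and ?t = "\<lambda>n. sqrt (sqnorm M (\<lambda>x. g n x - G x))"
  have "(\<lambda>n. (\<integral>x. f n x \<bullet> g n x \<partial>M) - (\<integral>x. F x \<bullet> G x \<partial>M)) \<longlonglongrightarrow> 0"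
  proof (rule Lim_null_comparison)
    show "\<forall>\<^sub>F n in sequentially. norm ((\<integral>x. f n x \<bullet> g n x \<partial>M) - (\<integral>x. F x \<bullet> G x \<partial>M))
        \<le> ?s n * ?t n + ?s n * sqrt (sqnorm M G) + sqrt (sqnorm M F) * ?t n"
    proof (rule always_eventually, rule allI)
      fix n
      have "\<bar>\<integral>x. (f n x - F x) \<bullet> (g n x - G x) \<partial>M\<bar> \<le> ?s n * ?t n"
           "\<bar>\<integral>x. (f n x - F x) \<bullet> G x \<partial>M\<bar> \<le> ?s n * sqrt (sqnorm M G)"
           "\<bar>\<integral>x. F x \<bullet> (g n x - G x) \<partial>M\<bar> \<le> sqrt (sqnorm M F) * ?t n"
        using f g by (auto intro!: integral_inner_Cauchy_Schwarz square_integrable_diff)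
      then show "norm ((\<integral>x. f n x \<bullet> g n x \<partial>M) - (\<integral>x. F x \<bullet> G x \<partial>M))
        \<le> ?s n * ?t n + ?s n * sqrt (sqnorm M G) + sqrt (sqnorm M F) * ?t n"
        unfolding split by simp
    qed
    have "?s \<longlonglongrightarrow> sqrt 0" "?t \<longlonglongrightarrow> sqrt 0" by (intro tendsto_intros lf lg)+
    then have "(\<lambda>n. ?s n * ?t n + ?s n * sqrt (sqnorm M G) + sqrt (sqnorm M F) * ?t n)
         \<longlonglongrightarrow> sqrt 0 * sqrt 0 + sqrt 0 * sqrt (sqnorm M G) + sqrt (sqnorm M F) * sqrt 0"
      by (intro tendsto_add tendsto_mult tendsto_const)
    then show "(\<lambda>n. ?s n * ?t n + ?s n * sqrt (sqnorm M G) + sqrt (sqnorm M F) * ?t n) \<longlonglongrightarrow> 0" by simp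
  qed
  then show ?thesis by (simp add: LIM_zero_iff)
qed

text \<open>Riesz-Fischer. A rapidly converging subsequence has summable L^1 increments, because the
  measure is finite, and therefore converges almost everywhere; Fatou's lemma along that subsequence
  bounds the distance of the full sequence to the limit.\<close>

lemma square_integrable_complete:
  fixes f :: "nat \<Rightarrow> 'a \<Rightarrow> 'b::euclidean_space"
  assumes fin: "finite_measure M"
    and f: "\<And>n. square_integrable M (f n)"
    and Cauchy: "\<And>e. e > 0 \<Longrightarrow> \<exists>N. \<forall>m\<ge>N. \<forall>n\<ge>N. sqnorm M (\<lambda>x. f m x - f n x) < e"
  obtains F where "square_integrable M F" "(\<lambda>n. sqnorm M (\<lambda>x. f n x - F x)) \<longlonglongrightarrow> 0"
proof -
  interpret finite_measure M by (rule fin)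
  have meas [measurable]: "f n \<in> borel_measurable M" for n using f by (simp add: square_integrable_def)
  have "\<exists>N. \<forall>m\<ge>N. \<forall>n\<ge>N. sqnorm M (\<lambda>x. f m x - f n x) < (1/4) ^ k" for k :: nat
    by (rule Cauchy) simp
  then obtain N where N: "\<And>k m n. m \<ge> N k \<Longrightarrow> n \<ge> N k \<Longrightarrow> sqnorm M (\<lambda>x. f m x - f n x) < (1/4) ^ k"
    by metis
  \<comment> \<open>\<open>Suc m\<close> forces strict growth and \<open>N (Suc k)\<close> puts
    consecutive members within squared distance (1/4)^k.\<close>
  define r where "r = rec_nat (N 0) (\<lambda>k m. max (Suc m) (N (Suc k)))"
  have rN: "r k \<ge> N k" for k by (cases k) (auto simp: r_def)
  have rS: "r (Suc k) > r k" for k by (auto simp: r_def)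
  have mono: "strict_mono r" using rS by (rule strict_monoI_Suc)
  let ?d = "\<lambda>k x. f (r (Suc k)) x - f (r k) x"
  have d_int: "(\<integral>\<^sup>+x. ennreal (norm (?d k x)) \<partial>M) \<le> ennreal ((1/2)^k * (1 + measure M (space M)))" for k
  proof -
    have sq: "square_integrable M (?d k)" by (intro square_integrable_diff f)
    have "sqnorm M (?d k) < (1/4)^k"
      using rN[of k] rS[of k] by (intro N) auto
    have int: "integrable M (\<lambda>x. 2^k * (norm (?d k x))\<^sup>2 + (1/2)^k)"
      using sq by (auto simp: square_integrable_def)
    have "(\<integral>\<^sup>+x. ennreal (norm (?d k x)) \<partial>M) \<le> (\<integral>\<^sup>+x. ennreal (2^k * (norm (?d k x))\<^sup>2 + (1/2)^k) \<partial>M)"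
    proof (intro nn_integral_mono ennreal_leI)
      fix x
      \<comment> \<open>The weight 2^k turns the squared bound 4^-k into an L^1 bound of order 2^-k,
        which is still summable.\<close>
      have "0 \<le> (2^k * norm (?d k x) - 1)\<^sup>2 / 2^k" by simp
      also have "\<dots> = 2^k * (norm (?d k x))\<^sup>2 + (1/2)^k - 2 * norm (?d k x)"
        by (simp add: power2_eq_square field_simps)
      finally show "norm (?d k x) \<le> 2^k * (norm (?d k x))\<^sup>2 + (1/2)^k"
        using norm_ge_zero[of "?d k x"] by linarith
    qed
    also have "\<dots> = ennreal (\<integral>x. 2^k * (norm (?d k x))\<^sup>2 + (1/2)^k \<partial>M)"
      using int by (intro nn_integral_eq_integral) auto
    also have "(\<integral>x. 2^k * (norm (?d k x))\<^sup>2 + (1/2)^k \<partial>M) = 2^k * sqnorm M (?d k) + (1/2)^k * measure M (space M)"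
      using sq by (simp add: square_integrable_def sqnorm_def)
    also have "\<dots> \<le> 2^k * (1/4)^k + (1/2)^k * measure M (space M)"
      using \<open>sqnorm M (?d k) < (1/4)^k\<close> by simp
    also have "(2::real)^k * (1/4)^k = (1/2)^k"
      by (simp flip: power_mult_distrib)
    finally show ?thesis by (simp add: algebra_simps ennreal_leI)
  qed
  have "(\<integral>\<^sup>+x. (\<Sum>k. ennreal (norm (?d k x))) \<partial>M) = (\<Sum>k. \<integral>\<^sup>+x. ennreal (norm (?d k x)) \<partial>M)"
    by (rule nn_integral_suminf) measurable
  also have "\<dots> \<le> (\<Sum>k. ennreal ((1/2)^k * (1 + measure M (space M))))"
    by (intro suminf_le d_int) auto
  also have "\<dots> < \<infinity>"
    by (subst suminf_ennreal2) (auto intro!: summable_mult2)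
  finally have "AE x in M. (\<Sum>k. ennreal (norm (?d k x))) \<noteq> \<infinity>"
    by (intro nn_integral_noteq_infinite) auto
  then have conv: "AE x in M. convergent (\<lambda>k. f (r k) x)"
  proof eventually_elim
    fix x assume "(\<Sum>k. ennreal (norm (?d k x))) \<noteq> \<infinity>"
    then have "summable (\<lambda>k. norm (?d k x))"
      by (intro summable_suminf_not_top) auto
    then have "summable (\<lambda>k. ?d k x)" by (rule summable_norm_cancel)
    then have "convergent (\<lambda>n. \<Sum>k<n. ?d k x)" by (simp add: summable_iff_convergent)
    then have "convergent (\<lambda>n. f (r n) x - f (r 0) x)"
      using sum_lessThan_telescope[of "\<lambda>k. f (r k) x"] by simp
    then have "convergent (\<lambda>n. (f (r n) x - f (r 0) x) + f (r 0) x)"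
      by (intro convergent_add convergent_const)
    then show "convergent (\<lambda>k. f (r k) x)" by simp
  qed
  define F where "F x = lim (\<lambda>k. f (r k) x)" for x
  have F_meas [measurable]: "F \<in> borel_measurable M"
    unfolding F_def by measurable
  have lim: "AE x in M. (\<lambda>k. f (r k) x) \<longlonglongrightarrow> F x"
    using conv unfolding F_def by (simp add: convergent_LIMSEQ_iff)
  \<comment> \<open>Stated with nonnegative integrals because square integrability of
    \<open>f n - F\<close> is not known yet; it is read off from this bound in
    \<open>diff_sq\<close>.\<close>
  have fatou: "(\<integral>\<^sup>+x. ennreal ((norm (f n x - F x))\<^sup>2) \<partial>M) \<le> ennreal e"
    if e: "e > 0" and K: "\<And>m n. m \<ge> K \<Longrightarrow> n \<ge> K \<Longrightarrow> sqnorm M (\<lambda>x. f m x - f n x) < e" and n: "n \<ge> K" for e K n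
  proof -
    have "(\<integral>\<^sup>+x. ennreal ((norm (f n x - F x))\<^sup>2) \<partial>M)
       = (\<integral>\<^sup>+x. liminf (\<lambda>k. ennreal ((norm (f n x - f (r k) x))\<^sup>2)) \<partial>M)"
    proof (rule nn_integral_cong_AE, use lim in eventually_elim)
      fix x assume "(\<lambda>k. f (r k) x) \<longlonglongrightarrow> F x"
      then have "(\<lambda>k. ennreal ((norm (f n x - f (r k) x))\<^sup>2)) \<longlonglongrightarrow> ennreal ((norm (f n x - F x))\<^sup>2)"
        by (intro tendsto_intros tendsto_ennrealI)
      then show "ennreal ((norm (f n x - F x))\<^sup>2) = liminf (\<lambda>k. ennreal ((norm (f n x - f (r k) x))\<^sup>2))"
        by (intro lim_imp_Liminf[symmetric]) simp_all
    qed
    also have "\<dots> \<le> liminf (\<lambda>k. \<integral>\<^sup>+x. ennreal ((norm (f n x - f (r k) x))\<^sup>2) \<partial>M)"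
      by (rule nn_integral_liminf) measurable
    also have "\<dots> \<le> ennreal e"
    proof (rule Liminf_le[OF trivial_limit_sequentially eventually_sequentiallyI[of K]])
      fix k assume "k \<ge> K"
      then have "r k \<ge> K" using seq_suble[OF mono, of k] by simp
      have "(\<integral>\<^sup>+x. ennreal ((norm (f n x - f (r k) x))\<^sup>2) \<partial>M) = ennreal (sqnorm M (\<lambda>x. f n x - f (r k) x))"
        unfolding sqnorm_def using square_integrable_diff[OF f[of n] f[of "r k"]]
        by (intro nn_integral_eq_integral) (auto simp: square_integrable_def)
      also have "\<dots> \<le> ennreal e"
        using K[OF n \<open>r k \<ge> K\<close>] by (intro ennreal_leI) simp
      finally show "(\<integral>\<^sup>+x. ennreal ((norm (f n x - f (r k) x))\<^sup>2) \<partial>M) \<le> ennreal e" .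
    qed
    finally show ?thesis .
  qed
  have diff_sq: "square_integrable M (\<lambda>x. f n x - F x) \<and> sqnorm M (\<lambda>x. f n x - F x) \<le> e"
    if e: "e > 0" and K: "\<And>m n. m \<ge> K \<Longrightarrow> n \<ge> K \<Longrightarrow> sqnorm M (\<lambda>x. f m x - f n x) < e" and n: "n \<ge> K" for e K n
  proof -
    have le: "(\<integral>\<^sup>+x. ennreal ((norm (f n x - F x))\<^sup>2) \<partial>M) \<le> ennreal e" using fatou[OF that] .
    have sq: "square_integrable M (\<lambda>x. f n x - F x)"
      unfolding square_integrable_def using le
      by (auto intro!: integrableI_bounded simp: le_less_trans[OF _ ennreal_less_top])
    moreover have "sqnorm M (\<lambda>x. f n x - F x) \<le> e"
      using nn_integral_eq_integral[of M "\<lambda>x. (norm (f n x - F x))\<^sup>2"] sq le \<open>e > 0\<close>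
      by (simp add: sqnorm_def square_integrable_def)
    ultimately show ?thesis by blast
  qed
  show thesis
  proof
    obtain K where "\<forall>m\<ge>K. \<forall>n\<ge>K. sqnorm M (\<lambda>x. f m x - f n x) < 1" using Cauchy[of 1] by auto
    then have "square_integrable M (\<lambda>x. f K x - F x)" using diff_sq[of 1 K K] by auto
    from square_integrable_diff[OF f[of K] this] show "square_integrable M F" by simp
    show "(\<lambda>n. sqnorm M (\<lambda>x. f n x - F x)) \<longlonglongrightarrow> 0"
    proof (rule LIMSEQ_I)
      fix e :: real assume "e > 0"
      then obtain K where K: "\<forall>m\<ge>K. \<forall>n\<ge>K. sqnorm M (\<lambda>x. f m x - f n x) < e/2" using Cauchy[of "e/2"] by auto
      show "\<exists>no. \<forall>n\<ge>no. norm (sqnorm M (\<lambda>x. f n x - F x) - 0) < e"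
      proof (intro exI allI impI)
        fix n assume "n \<ge> K"
        then have "sqnorm M (\<lambda>x. f n x - F x) \<le> e/2" using diff_sq[of "e/2" K n] K \<open>e > 0\<close> by auto
        then show "norm (sqnorm M (\<lambda>x. f n x - F x) - 0) < e" using \<open>e > 0\<close> by simp
      qed
    qed
  qed
qed

section \<open>Integration by parts without Fubini\<close>

text \<open>A class that tracks first derivatives only and is closed under products with C^1
  functions and, on the whole plane, under translations. The gradient is an argument so that no
  derivative operator has to be evaluated, and one compact set controls function and gradient
  together.\<close>

definition compactly_C1 :: "(real^2) set \<Rightarrow> (real^2 \<Rightarrow> real) \<Rightarrow> (real^2 \<Rightarrow> real^2) \<Rightarrow> bool" where
  "compactly_C1 \<Omega> \<phi> G \<longleftrightarrow> (\<forall>x. (\<phi> has_derivative (\<lambda>h. h \<bullet> G x)) (at x)) \<and> continuous_on UNIV G \<and>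
     (\<exists>K. compact K \<and> K \<subseteq> \<Omega> \<and> (\<forall>x. x \<notin> K \<longrightarrow> \<phi> x = 0 \<and> G x = 0))"

lemma compactly_C1D:
  assumes "compactly_C1 \<Omega> \<phi> G"
  shows "(\<phi> has_derivative (\<lambda>h. h \<bullet> G x)) (at x)" "continuous_on UNIV \<phi>" "continuous_on UNIV G"
proof -
  show *: "(\<phi> has_derivative (\<lambda>h. h \<bullet> G x)) (at x)" for x using assms by (simp add: compactly_C1_def)
  show "continuous_on UNIV \<phi>"
    by (rule continuous_at_imp_continuous_on) (auto intro: has_derivative_continuous[OF *])
  show "continuous_on UNIV G" using assms by (simp add: compactly_C1_def)
qed

lemma grad_eqI:
  assumes "(\<phi> has_derivative (\<lambda>h. h \<bullet> G)) (at x)"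
  shows "grad \<phi> x = G"
  using frechet_derivative_at[OF assms, symmetric]
  by (simp add: grad_def vec_eq_iff inner_axis')

lemma inner_real2: "(v::real^2) \<bullet> w = v$1 * w$1 + v$2 * w$2"
  by (simp add: inner_vec_def sum_2)

lemma Cc_inf_compactly_C1:
  assumes "Cc_inf \<Omega> \<phi>"
  shows "compactly_C1 \<Omega> \<phi> (grad \<phi>)"
proof -
  obtain F :: "2 list \<Rightarrow> real^2 \<Rightarrow> real" where F: "F [] = \<phi>"
    "\<And>\<alpha> x. (F \<alpha> has_derivative (\<lambda>h. \<Sum>i\<in>UNIV. h $ i * F (i # \<alpha>) x)) (at x)"
    and K: "compact (closure {x. \<phi> x \<noteq> 0})" "closure {x. \<phi> x \<noteq> 0} \<subseteq> \<Omega>"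
    using assms unfolding Cc_inf_def by blast
  define G where "G x = (\<chi> i. F [i] x)" for x
  have der: "(\<phi> has_derivative (\<lambda>h. h \<bullet> G x)) (at x)" for x
    using F(2)[of "[]" x] by (simp add: F(1) G_def inner_vec_def)
  then have grad: "grad \<phi> = G" by (intro ext grad_eqI)
  have "isCont (F [i]) x" for i x
    by (rule has_derivative_continuous[OF F(2)])
  then have "continuous_on UNIV G"
    unfolding G_def by (intro continuous_on_vec_lambda continuous_at_imp_continuous_on) auto
  moreover have "\<phi> x = 0 \<and> G x = 0" if x: "x \<notin> closure {x. \<phi> x \<noteq> 0}" for x
  proof
    let ?U = "- closure {x. \<phi> x \<noteq> 0}"
    have zero: "\<phi> z = 0" if "z \<in> ?U" for z using that closure_subset[of "{x. \<phi> x \<noteq> 0}"] by blast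
    have xU: "x \<in> ?U" using x by blast
    then show "\<phi> x = 0" by (rule zero)
    \<comment> \<open>Off the closed support the function vanishes on a whole neighbourhood, so its
      gradient is that of the zero function.\<close>
    have "((\<lambda>_. 0) has_derivative (\<lambda>h. 0)) (at x)" by (rule has_derivative_const)
    then have "(\<phi> has_derivative (\<lambda>h. h \<bullet> 0)) (at x)"
      unfolding inner_zero_right
      by (rule has_derivative_transform_within_open[of "\<lambda>_. 0" "\<lambda>h. 0" x UNIV ?U \<phi>])
         (rule open_Compl closed_closure xU zero[symmetric] | assumption)+
    then have "grad \<phi> x = 0" by (rule grad_eqI)
    then show "G x = 0" by (simp add: grad)
  qed
  ultimately show ?thesis using der K unfolding compactly_C1_def grad
    by (intro conjI allI exI[of _ "closure {x. \<phi> x \<noteq> 0}"] impI) blast+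
qed

lemma compactly_C1_mult:
  assumes "compactly_C1 \<Omega> \<phi> G" and k: "\<And>x. (k has_derivative (\<lambda>h. h \<bullet> H x)) (at x)" "continuous_on UNIV H"
  shows "compactly_C1 \<Omega> (\<lambda>x. \<phi> x * k x) (\<lambda>x. k x *\<^sub>R G x + \<phi> x *\<^sub>R H x)"
proof -
  have kc: "continuous_on UNIV k"
    by (rule continuous_at_imp_continuous_on) (auto intro: has_derivative_continuous[OF k(1)])
  obtain K where K: "compact K" "K \<subseteq> \<Omega>" "\<And>x. x \<notin> K \<Longrightarrow> \<phi> x = 0 \<and> G x = 0"
    using assms(1) unfolding compactly_C1_def by blast
  show ?thesis unfolding compactly_C1_def
  proof (intro conjI allI)
    fix x show "((\<lambda>x. \<phi> x * k x) has_derivative (\<lambda>h. h \<bullet> (k x *\<^sub>R G x + \<phi> x *\<^sub>R H x))) (at x)"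
      by (rule has_derivative_eq_rhs[OF has_derivative_mult[OF compactly_C1D(1)[OF assms(1)] k(1)]])
         (auto simp: inner_add_right mult.commute)
    show "continuous_on UNIV (\<lambda>x. k x *\<^sub>R G x + \<phi> x *\<^sub>R H x)"
      by (intro continuous_intros kc k(2) compactly_C1D(2,3)[OF assms(1)])
    show "\<exists>K. compact K \<and> K \<subseteq> \<Omega> \<and> (\<forall>x. x \<notin> K \<longrightarrow> \<phi> x * k x = 0 \<and> k x *\<^sub>R G x + \<phi> x *\<^sub>R H x = 0)"
      using K by (intro exI[of _ K]) auto
  qed
qed

lemma compact_support_bounded:
  fixes f :: "real^2 \<Rightarrow> 'b::real_normed_vector"
  assumes "continuous_on UNIV f" "compact K" "\<And>x. x \<notin> K \<Longrightarrow> f x = 0"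
  obtains B where "B > 0" "\<And>x. norm (f x) \<le> B"
proof -
  have "compact (f ` K)" using assms by (intro compact_continuous_image continuous_on_subset[OF assms(1)]) auto
  then obtain B where B: "B > 0" "\<forall>y\<in>f ` K. norm y \<le> B" using compact_imp_bounded bounded_pos by metis
  have "norm (f x) \<le> B" for x using B assms(3)[of x] by (cases "x \<in> K") auto
  with B(1) show thesis by (rule that)
qed

lemma integrable_compact_support:
  fixes f :: "real^2 \<Rightarrow> 'b::euclidean_space"
  assumes "continuous_on UNIV f" "compact K" "\<And>x. x \<notin> K \<Longrightarrow> f x = 0"
  shows "integrable lborel f"
proof -
  have "integrable lborel (\<lambda>x. indicator K x *\<^sub>R f x)"
    using assms by (intro borel_integrable_compact continuous_on_subset[OF assms(1)]) auto
  moreover have "(\<lambda>x. indicator K x *\<^sub>R f x) = f" using assms(3) by (auto simp: indicator_def fun_eq_iff)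
  ultimately show ?thesis by simp
qed

lemma lebesgue_on_compact_support:
  fixes f :: "real^2 \<Rightarrow> 'b::euclidean_space"
  assumes "open \<Omega>" "continuous_on UNIV f" "compact K" "K \<subseteq> \<Omega>" "\<And>x. x \<notin> K \<Longrightarrow> f x = 0"
  shows "f \<in> borel_measurable (lebesgue_on \<Omega>)" "integrable (lebesgue_on \<Omega>) f"
    "(\<integral>x. f x \<partial>lebesgue_on \<Omega>) = (\<integral>x. f x \<partial>lborel)"
proof -
  have sets: "\<Omega> \<inter> space lebesgue \<in> sets lebesgue" using assms(1) by auto
  have eq: "(\<lambda>x. indicator \<Omega> x *\<^sub>R f x) = f" using assms(4,5) by (auto simp: indicator_def fun_eq_iff)
  have meas: "f \<in> borel_measurable lborel" using assms(2) by (simp add: borel_measurable_continuous_onI)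
  have int: "integrable lebesgue f"
    using integrable_completion[OF meas] integrable_compact_support[OF assms(2,3,5)] by simp
  show "integrable (lebesgue_on \<Omega>) f"
    using int by (simp add: integrable_restrict_space[OF sets] eq)
  then show "f \<in> borel_measurable (lebesgue_on \<Omega>)" by auto
  show "(\<integral>x. f x \<partial>lebesgue_on \<Omega>) = (\<integral>x. f x \<partial>lborel)"
    by (simp add: integral_restrict_space[OF sets] eq integral_completion[OF meas])
qed

lemma lborel_integral_translate:
  fixes k :: "'a::euclidean_space \<Rightarrow> real"
  assumes "k \<in> borel_measurable borel"
  shows "(\<integral>x. k (c + x) \<partial>lborel) = (\<integral>x. k x \<partial>lborel)"
  using integral_distr[of "(+) c" lborel borel k] assms by (simp add: lborel_distr_plus)

text \<open>Dominated convergence: a bounded gradient makes \<phi> Lipschitz with some constant B,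
  so the quotients are at most B |e|, and all of them live in one ball. The factor \<open>k\<close>
  need only be continuous since it is integrated over that ball.\<close>

lemma difference_quotient_integral:
  assumes \<phi>: "compactly_C1 UNIV \<phi> G" and k: "continuous_on UNIV k"
  shows "(\<lambda>n. \<integral>x. real (Suc n) * (\<phi> ((1 / real (Suc n)) *\<^sub>R e + x) - \<phi> x) * k x \<partial>lborel)
    \<longlonglongrightarrow> (\<integral>x. (e \<bullet> G x) * k x \<partial>lborel)"
proof -
  obtain K where K: "compact K" "\<And>x. x \<notin> K \<Longrightarrow> \<phi> x = 0 \<and> G x = 0"
    using \<phi> unfolding compactly_C1_def by blast
  obtain B where B: "B > 0" "\<And>x. norm (G x) \<le> B"
    using compact_support_bounded[OF compactly_C1D(3)[OF \<phi>] K(1)] K(2) by metis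
  have lip: "norm (\<phi> x - \<phi> z) \<le> B * norm (x - z)" for x z
  proof (rule differentiable_bound[where S=UNIV and f'="\<lambda>x h. h \<bullet> G x"])
    show "onorm (\<lambda>h. h \<bullet> G x) \<le> B" for x
    proof (rule onorm_bound)
      fix h show "norm (h \<bullet> G x) \<le> B * norm h"
        using Cauchy_Schwarz_ineq2[of h "G x"] mult_left_mono[OF B(2)[of x], of "norm h"]
        by (simp add: mult.commute)
    qed (use B in simp)
  qed (use compactly_C1D(1)[OF \<phi>] in auto)
  obtain R where R: "R > 0" "\<And>x. x \<in> K \<Longrightarrow> norm x \<le> R"
    using compact_imp_bounded[OF K(1)] bounded_pos by metis
  \<comment> \<open>All shifts have length at most |e|, so outside this ball both the function and
    every shifted copy vanish.\<close>
  define C where "C = cball (0::real^2) (R + norm e)"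
  have out: "\<phi> ((1 / real (Suc n)) *\<^sub>R e + x) - \<phi> x = 0" if "x \<notin> C" for n x
  proof -
    have x: "norm x > R + norm e" using that by (simp add: C_def)
    then have "x \<notin> K" using R(2)[of x] norm_ge_zero[of e] by auto
    moreover have "(1 / real (Suc n)) *\<^sub>R e + x \<notin> K"
    proof
      assume "(1 / real (Suc n)) *\<^sub>R e + x \<in> K"
      then have "norm ((1 / real (Suc n)) *\<^sub>R e + x) \<le> R" by (rule R(2))
      moreover have "norm x \<le> norm ((1 / real (Suc n)) *\<^sub>R e + x) + norm ((1 / real (Suc n)) *\<^sub>R e)"
        using norm_triangle_ineq4[of "(1 / real (Suc n)) *\<^sub>R e + x" "(1 / real (Suc n)) *\<^sub>R e"] by simp
      moreover have "norm ((1 / real (Suc n)) *\<^sub>R e) \<le> norm e"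
        by (simp add: field_simps)
      ultimately show False using x by linarith
    qed
    ultimately show ?thesis using K(2) by simp
  qed
  have "continuous_on C k" using k continuous_on_subset by blast
  then have kint: "integrable lborel (\<lambda>x. indicator C x *\<^sub>R \<bar>k x\<bar>)"
    by (intro borel_integrable_compact continuous_intros) (auto simp: C_def)
  show ?thesis
  proof (rule integral_dominated_convergence[where w="\<lambda>x. (B * norm e) * (indicator C x *\<^sub>R \<bar>k x\<bar>)"])
    show "integrable lborel (\<lambda>x. (B * norm e) * (indicator C x *\<^sub>R \<bar>k x\<bar>))"
      using kint by (rule integrable_mult_right)
    show "AE x in lborel. (\<lambda>n. real (Suc n) * (\<phi> ((1 / real (Suc n)) *\<^sub>R e + x) - \<phi> x) * k x) \<longlonglongrightarrow> (e \<bullet> G x) * k x"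
    proof (rule AE_I2, rule tendsto_mult_right)
      fix x
      have "((\<lambda>t. \<phi> (t *\<^sub>R e + x)) has_derivative (\<lambda>t. (t *\<^sub>R e) \<bullet> G x)) (at 0)"
        by (rule has_derivative_compose[where g=\<phi> and f="\<lambda>t. t *\<^sub>R e + x" and f'="\<lambda>t. t *\<^sub>R e", simplified])
           (auto intro!: derivative_eq_intros compactly_C1D(1)[OF \<phi>])
      then have "((\<lambda>t. \<phi> (t *\<^sub>R e + x)) has_real_derivative (e \<bullet> G x)) (at 0)"
        by (simp add: has_field_derivative_def mult.commute[of _ "e \<bullet> G x"])
      then have lim: "((\<lambda>h. (\<phi> (h *\<^sub>R e + x) - \<phi> x) / h) \<longlongrightarrow> e \<bullet> G x) (at 0)"
        by (simp add: has_field_derivative_iff)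
      have "filterlim (\<lambda>n. 1 / real (Suc n)) (at 0) sequentially"
        by (rule filterlim_atI) (use LIMSEQ_Suc[OF lim_1_over_n] in auto)
      from filterlim_compose[OF lim this]
      show "(\<lambda>n. real (Suc n) * (\<phi> ((1 / real (Suc n)) *\<^sub>R e + x) - \<phi> x)) \<longlonglongrightarrow> e \<bullet> G x"
        by (simp add: mult.commute)
    qed
    show "AE x in lborel. norm (real (Suc n) * (\<phi> ((1 / real (Suc n)) *\<^sub>R e + x) - \<phi> x) * k x)
        \<le> (B * norm e) * (indicator C x *\<^sub>R \<bar>k x\<bar>)" for n
    proof (rule AE_I2)
      fix x
      show "norm (real (Suc n) * (\<phi> ((1 / real (Suc n)) *\<^sub>R e + x) - \<phi> x) * k x)
        \<le> (B * norm e) * (indicator C x *\<^sub>R \<bar>k x\<bar>)"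
      proof (cases "x \<in> C")
        case True
        have "real (Suc n) * \<bar>\<phi> ((1 / real (Suc n)) *\<^sub>R e + x) - \<phi> x\<bar> \<le> real (Suc n) * (B * norm ((1 / real (Suc n)) *\<^sub>R e))"
          using lip[of "(1 / real (Suc n)) *\<^sub>R e + x" x] by (intro mult_left_mono) auto
        also have "\<dots> = B * norm e" by simp
        finally have "real (Suc n) * \<bar>\<phi> ((1 / real (Suc n)) *\<^sub>R e + x) - \<phi> x\<bar> * \<bar>k x\<bar> \<le> B * norm e * \<bar>k x\<bar>"
          by (rule mult_right_mono) simp
        then show ?thesis using True by (simp add: abs_mult)
      qed (use out[of x n] in simp)
    qed
    note cont = compactly_C1D(2,3)[OF \<phi>] k
    show "(\<lambda>x. (e \<bullet> G x) * k x) \<in> borel_measurable lborel"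
      by (auto intro!: borel_measurable_continuous_onI continuous_intros cont)
    show "(\<lambda>x. real (Suc n) * (\<phi> ((1 / real (Suc n)) *\<^sub>R e + x) - \<phi> x) * k x) \<in> borel_measurable lborel" for n
      by (auto intro!: borel_measurable_continuous_onI continuous_intros cont continuous_on_compose2[OF cont(1)])
  qed
qed

text \<open>Translation invariance of Lebesgue measure gives every difference quotient integral 0;
  the limit is the claim. All integration by parts below rests on this fact and the product
  rule.\<close>

lemma integral_partial_derivative_zero:
  assumes "compactly_C1 UNIV \<phi> G"
  shows "(\<integral>x. e \<bullet> G x \<partial>lborel) = 0"
proof -
  obtain K where K: "compact K" "\<And>x. x \<notin> K \<Longrightarrow> \<phi> x = 0"
    using assms unfolding compactly_C1_def by blast
  have int: "integrable lborel \<phi>"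
    by (rule integrable_compact_support[OF compactly_C1D(2)[OF assms] K])
  have meas: "\<phi> \<in> borel_measurable borel"
    using compactly_C1D(2)[OF assms] by (auto intro: borel_measurable_continuous_onI)
  have "(\<integral>x. real (Suc n) * (\<phi> ((1 / real (Suc n)) *\<^sub>R e + x) - \<phi> x) * 1 \<partial>lborel) = 0" for n
  proof -
    have "integrable (distr lborel borel ((+) ((1 / real (Suc n)) *\<^sub>R e))) \<phi>"
      using int by (simp add: lborel_distr_plus)
    then have "integrable lborel (\<lambda>x. \<phi> ((1 / real (Suc n)) *\<^sub>R e + x))"
      using meas by (subst (asm) integrable_distr_eq) auto
    then show ?thesis
      using int lborel_integral_translate[OF meas, of "(1 / real (Suc n)) *\<^sub>R e"] by simp
  qed
  then show ?thesis
    using difference_quotient_integral[OF assms, of "\<lambda>_. 1" e] LIMSEQ_unique[OF _ tendsto_const, of 0] by simp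
qed

lemma compactly_C1_translate:
  assumes "compactly_C1 UNIV \<phi> G"
  shows "compactly_C1 UNIV (\<lambda>x. \<phi> (c + x)) (\<lambda>x. G (c + x))"
proof -
  obtain K where K: "compact K" "\<And>x. x \<notin> K \<Longrightarrow> \<phi> x = 0 \<and> G x = 0"
    using assms unfolding compactly_C1_def by blast
  show ?thesis unfolding compactly_C1_def
  proof (intro conjI allI)
    fix x
    show "((\<lambda>x. \<phi> (c + x)) has_derivative (\<lambda>h. h \<bullet> G (c + x))) (at x)"
      by (rule has_derivative_compose[where g=\<phi> and f="\<lambda>x. c + x" and f'="\<lambda>h. h", simplified])
         (auto intro!: derivative_eq_intros compactly_C1D(1)[OF assms])
    show "continuous_on UNIV (\<lambda>x. G (c + x))"
      by (rule continuous_on_compose2[OF compactly_C1D(3)[OF assms]]) (auto intro: continuous_intros)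
    show "\<exists>K. compact K \<and> K \<subseteq> UNIV \<and> (\<forall>x. x \<notin> K \<longrightarrow> \<phi> (c + x) = 0 \<and> G (c + x) = 0)"
    proof (intro exI conjI allI impI)
      show "compact ((+) (-c) ` K)" using K(1) by (rule compact_translation)
      fix x assume "x \<notin> (+) (-c) ` K"
      then have "c + x \<notin> K" by (metis add.commute add_diff_cancel_left' image_eqI uminus_add_conv_diff)
      then show "\<phi> (c + x) = 0" "G (c + x) = 0" using K(2) by auto
    qed simp
  qed
qed

lemma integral_by_parts_C1:
  assumes \<phi>: "compactly_C1 UNIV \<phi> G" and v: "compactly_C1 UNIV v H"
  shows "(\<integral>x. \<phi> x * (e \<bullet> H x) \<partial>lborel) = - (\<integral>x. (e \<bullet> G x) * v x \<partial>lborel)"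
proof -
  obtain K where K: "compact K" "\<And>x. x \<notin> K \<Longrightarrow> \<phi> x = 0 \<and> G x = 0"
    using \<phi> unfolding compactly_C1_def by blast
  note c = compactly_C1D(2,3)[OF \<phi>] compactly_C1D(2,3)[OF v]
  have int: "integrable lborel (\<lambda>x. \<phi> x * (e \<bullet> H x))" "integrable lborel (\<lambda>x. (e \<bullet> G x) * v x)"
    by (rule integrable_compact_support[OF _ K(1)]; use K in \<open>auto intro!: continuous_intros c\<close>)+
  have "(\<integral>x. e \<bullet> (v x *\<^sub>R G x + \<phi> x *\<^sub>R H x) \<partial>lborel) = 0"
    by (rule integral_partial_derivative_zero[OF compactly_C1_mult[OF \<phi> compactly_C1D(1,3)[OF v]]])
  then have "(\<integral>x. (e \<bullet> G x) * v x + \<phi> x * (e \<bullet> H x) \<partial>lborel) = 0"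
    by (simp add: inner_add_right mult.commute)
  then show ?thesis using int by simp
qed

text \<open>For \<open>C\<^sup>2\<close> functions this is two integrations by parts; a difference quotient replaces the missing
  second derivative.\<close>
lemma integral_mixed_partials:
  assumes \<phi>: "compactly_C1 UNIV \<phi> G" and v: "compactly_C1 UNIV v H"
  shows "(\<integral>x. (e \<bullet> G x) * (e' \<bullet> H x) \<partial>lborel) = (\<integral>x. (e' \<bullet> G x) * (e \<bullet> H x) \<partial>lborel)"
proof -
  note cont = compactly_C1D(2,3)[OF \<phi>] compactly_C1D(2,3)[OF v]
  note [measurable] = cont[THEN borel_measurable_continuous_onI]
  obtain K where K: "compact K" "\<And>x. x \<notin> K \<Longrightarrow> \<phi> x = 0 \<and> G x = 0"
    using \<phi> unfolding compactly_C1_def by blast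
  obtain L where L: "compact L" "\<And>x. x \<notin> L \<Longrightarrow> v x = 0 \<and> H x = 0"
    using v unfolding compactly_C1_def by blast
  \<comment> \<open>Parts in direction \<open>e'\<close> takes the derivative off \<open>v\<close>
    and puts it on \<phi>; a translation then takes the finite difference off \<phi> and puts it on
    \<open>v\<close>.\<close>
  have step: "(\<integral>x. r * (\<phi> (c + x) - \<phi> x) * (e' \<bullet> H x) \<partial>lborel) = - (\<integral>x. r * (v (-c + x) - v x) * (e' \<bullet> G x) \<partial>lborel)" for r c
  proof -
    have i1: "integrable lborel (\<lambda>x. \<phi> (c + x) * (e' \<bullet> H x))" "integrable lborel (\<lambda>x. \<phi> x * (e' \<bullet> H x))"
      by (rule integrable_compact_support[OF _ L(1)];
          use L in \<open>auto intro!: continuous_intros cont continuous_on_compose2[OF cont(1)]\<close>)+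
    have i2: "integrable lborel (\<lambda>x. v (-c + x) * (e' \<bullet> G x))" "integrable lborel (\<lambda>x. v x * (e' \<bullet> G x))"
      by (rule integrable_compact_support[OF _ K(1)];
          use K in \<open>auto intro!: continuous_intros cont continuous_on_compose2[OF cont(3)]\<close>)+
    have "(\<integral>x. \<phi> (c + x) * (e' \<bullet> H x) \<partial>lborel) = - (\<integral>x. (e' \<bullet> G (c + x)) * v x \<partial>lborel)"
      by (rule integral_by_parts_C1[OF compactly_C1_translate[OF \<phi>] v])
    also have "(\<integral>x. (e' \<bullet> G (c + x)) * v x \<partial>lborel) = (\<integral>x. v (-c + x) * (e' \<bullet> G x) \<partial>lborel)"
      using lborel_integral_translate[of "\<lambda>x. (e' \<bullet> G x) * v (-c + x)" c] by (simp add: mult.commute)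
    finally have a: "(\<integral>x. \<phi> (c + x) * (e' \<bullet> H x) \<partial>lborel) = - (\<integral>x. v (-c + x) * (e' \<bullet> G x) \<partial>lborel)" .
    have b: "(\<integral>x. \<phi> x * (e' \<bullet> H x) \<partial>lborel) = - (\<integral>x. v x * (e' \<bullet> G x) \<partial>lborel)"
      using integral_by_parts_C1[OF \<phi> v, of e'] by (simp add: mult.commute)
    have "(\<integral>x. r * (\<phi> (c + x) - \<phi> x) * (e' \<bullet> H x) \<partial>lborel) = (\<integral>x. r * (\<phi> (c + x) * (e' \<bullet> H x) - \<phi> x * (e' \<bullet> H x)) \<partial>lborel)"
      by (simp add: algebra_simps)
    also have "\<dots> = r * (- (\<integral>x. v (-c + x) * (e' \<bullet> G x) \<partial>lborel) + (\<integral>x. v x * (e' \<bullet> G x) \<partial>lborel))"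
      using i1 a b by simp
    also have "\<dots> = - (\<integral>x. r * (v (-c + x) * (e' \<bullet> G x) - v x * (e' \<bullet> G x)) \<partial>lborel)"
      using i2 by (simp add: algebra_simps)
    also have "\<dots> = - (\<integral>x. r * (v (-c + x) - v x) * (e' \<bullet> G x) \<partial>lborel)"
      by (simp add: algebra_simps)
    finally show ?thesis .
  qed
  have "(\<lambda>n. \<integral>x. real (Suc n) * (\<phi> ((1 / real (Suc n)) *\<^sub>R e + x) - \<phi> x) * (e' \<bullet> H x) \<partial>lborel)
      \<longlonglongrightarrow> (\<integral>x. (e \<bullet> G x) * (e' \<bullet> H x) \<partial>lborel)"
    by (rule difference_quotient_integral[OF \<phi>]) (intro continuous_intros cont)
  \<comment> \<open>The translation has reversed the shift, so the quotient for \<open>v\<close> is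
    taken in direction \<open>-e\<close>; this sign cancels the one in \<open>step\<close>.\<close>
  moreover have "(\<lambda>n. \<integral>x. real (Suc n) * (v ((1 / real (Suc n)) *\<^sub>R (-e) + x) - v x) * (e' \<bullet> G x) \<partial>lborel)
      \<longlonglongrightarrow> (\<integral>x. ((-e) \<bullet> H x) * (e' \<bullet> G x) \<partial>lborel)"
    by (rule difference_quotient_integral[OF v]) (intro continuous_intros cont)
  from tendsto_minus[OF this] have "(\<lambda>n. - (\<integral>x. real (Suc n) * (v (-((1 / real (Suc n)) *\<^sub>R e) + x) - v x) * (e' \<bullet> G x) \<partial>lborel))
      \<longlonglongrightarrow> (\<integral>x. (e \<bullet> H x) * (e' \<bullet> G x) \<partial>lborel)"
    by simp
  ultimately have "(\<integral>x. (e \<bullet> G x) * (e' \<bullet> H x) \<partial>lborel) = (\<integral>x. (e \<bullet> H x) * (e' \<bullet> G x) \<partial>lborel)"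
    unfolding step by (rule LIMSEQ_unique)
  then show ?thesis by (simp add: mult.commute)
qed

section \<open>Rotated gradients in the plane\<close>

definition rot :: "real^2 \<Rightarrow> real^2" where
  "rot v = vector [- (v $ 2), v $ 1]"

lemma rot_inner: "rot v \<bullet> w = v$1 * w$2 - v$2 * w$1"
  by (simp add: rot_def inner_real2)

lemma rot_add: "rot (v + w) = rot v + rot w"
  and rot_scaleR: "rot (c *\<^sub>R v) = c *\<^sub>R rot v"
  and norm_rot: "norm (rot v) = norm v"
  by (simp_all add: rot_def vec_eq_iff forall_2 norm_eq_sqrt_inner inner_real2)

lemma rot_diff: "rot (v - w) = rot v - rot w"
  by (simp add: rot_def vec_eq_iff forall_2)

lemma bounded_linear_rot: "bounded_linear rot"
  by (rule bounded_linear_intro[where K=1]) (auto simp: rot_add rot_scaleR norm_rot)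

text \<open>\<open>rot (G x) \<bullet> H x\<close> is the determinant of the two gradients, a null
  Lagrangian: equality of mixed partials under the integral makes its two terms cancel. In other
  words, a gradient turned by a right angle is divergence-free.\<close>

lemma integral_rot_C1:
  assumes \<phi>: "compactly_C1 UNIV \<phi> G" and v: "compactly_C1 UNIV v H"
  shows "(\<integral>x. rot (G x) \<bullet> H x \<partial>lborel) = 0"
proof -
  obtain K where K: "compact K" "\<And>x. x \<notin> K \<Longrightarrow> \<phi> x = 0 \<and> G x = 0"
    using \<phi> unfolding compactly_C1_def by blast
  note c = compactly_C1D(2,3)[OF \<phi>] compactly_C1D(2,3)[OF v]
  have int: "integrable lborel (\<lambda>x. (d \<bullet> G x) * (d' \<bullet> H x))" for d d'
    by (rule integrable_compact_support[OF _ K(1)]) (use K in \<open>auto intro!: continuous_intros c\<close>)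
  have "(\<integral>x. rot (G x) \<bullet> H x \<partial>lborel) = (\<integral>x. (axis 1 1 \<bullet> G x) * (axis 2 1 \<bullet> H x) - (axis 2 1 \<bullet> G x) * (axis 1 1 \<bullet> H x) \<partial>lborel)"
    by (simp add: rot_inner inner_axis')
  also have "\<dots> = 0"
    using int integral_mixed_partials[OF \<phi> v, of "axis 1 1" "axis 2 1"] by simp
  finally show ?thesis .
qed

text \<open>The function \<phi>^2 x_1 has a first partial derivative of integral 0, which expresses
  the integral of \<phi>^2 through x_1 \<phi> and the first partial of \<phi>. As |x_1| <= B on the
  support, Young's inequality absorbs half of the left side, which leaves the constant 4
  B^2.\<close>

lemma Poincare_C1:
  assumes \<phi>: "compactly_C1 UNIV \<phi> G" and B: "\<And>x. \<phi> x \<noteq> 0 \<Longrightarrow> norm x \<le> B"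
  shows "(\<integral>x. (\<phi> x)\<^sup>2 \<partial>lborel) \<le> 4 * B\<^sup>2 * (\<integral>x. (norm (G x))\<^sup>2 \<partial>lborel)"
proof -
  obtain K where K: "compact K" "\<And>x. x \<notin> K \<Longrightarrow> \<phi> x = 0 \<and> G x = 0"
    using \<phi> unfolding compactly_C1_def by blast
  note c = compactly_C1D(2,3)[OF \<phi>]
  have i: "integrable lborel (\<lambda>x. (\<phi> x)\<^sup>2)" "integrable lborel (\<lambda>x. (norm (G x))\<^sup>2)"
     "integrable lborel (\<lambda>x. 2 * x$1 * \<phi> x * G x $ 1)"
    by (rule integrable_compact_support[OF _ K(1)]; use K in \<open>auto intro!: continuous_intros c\<close>)+
  have sq: "compactly_C1 UNIV (\<lambda>x. \<phi> x * \<phi> x) (\<lambda>x. \<phi> x *\<^sub>R G x + \<phi> x *\<^sub>R G x)"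
    by (rule compactly_C1_mult[OF \<phi> compactly_C1D(1,3)[OF \<phi>]])
  have "compactly_C1 UNIV (\<lambda>x. \<phi> x * \<phi> x * x$1) (\<lambda>x. (x$1) *\<^sub>R (\<phi> x *\<^sub>R G x + \<phi> x *\<^sub>R G x) + (\<phi> x * \<phi> x) *\<^sub>R axis 1 1)"
  proof (rule compactly_C1_mult[OF sq])
    fix x :: "real^2"
    have "bounded_linear (\<lambda>h::real^2. h $ 1)" by (rule bounded_linear_vec_nth)
    then have "((\<lambda>x::real^2. x $ 1) has_derivative (\<lambda>h. h $ 1)) (at x)"
      by (rule bounded_linear_imp_has_derivative)
    then show "((\<lambda>x::real^2. x $ 1) has_derivative (\<lambda>h. h \<bullet> axis 1 1)) (at x)"
      by (simp add: inner_axis)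
  qed simp
  from integral_partial_derivative_zero[OF this, of "axis 1 1"]
  have "(\<integral>x. 2 * x$1 * \<phi> x * G x $ 1 + (\<phi> x)\<^sup>2 \<partial>lborel) = 0"
    by (simp add: inner_add_right inner_axis' power2_eq_square mult_ac)
  then have "(\<integral>x. (\<phi> x)\<^sup>2 \<partial>lborel) = (\<integral>x. - (2 * x$1 * \<phi> x * G x $ 1) \<partial>lborel)" using i by simp
  also have "\<dots> \<le> (\<integral>x. (1/2) * (\<phi> x)\<^sup>2 + (2 * B\<^sup>2) * (norm (G x))\<^sup>2 \<partial>lborel)"
  proof (rule integral_mono)
    fix x
    show "- (2 * x$1 * \<phi> x * G x $ 1) \<le> (1/2) * (\<phi> x)\<^sup>2 + (2 * B\<^sup>2) * (norm (G x))\<^sup>2"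
    proof (cases "\<phi> x = 0")
      case False
      have xB: "\<bar>x$1\<bar> \<le> B" using B[OF False] component_le_norm_cart[of x 1] by simp
      have G1: "\<bar>G x $ 1\<bar> \<le> norm (G x)" by (rule component_le_norm_cart)
      have "B \<ge> 0" using xB by simp
      have "\<bar>x$1 * \<phi> x * G x $ 1\<bar> = (\<bar>x$1\<bar> * \<bar>\<phi> x\<bar>) * \<bar>G x $ 1\<bar>" by (simp add: abs_mult)
      also have "\<dots> \<le> (B * \<bar>\<phi> x\<bar>) * norm (G x)"
        by (rule mult_mono[OF mult_right_mono[OF xB] G1]) (use \<open>B \<ge> 0\<close> in auto)
      finally have "\<bar>x$1 * \<phi> x * G x $ 1\<bar> \<le> B * \<bar>\<phi> x\<bar> * norm (G x)" .
      moreover have "2 * (B * \<bar>\<phi> x\<bar> * norm (G x)) \<le> (1/2) * (\<phi> x)\<^sup>2 + (2 * B\<^sup>2) * (norm (G x))\<^sup>2"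
        using zero_le_power2[of "\<bar>\<phi> x\<bar> - 2 * B * norm (G x)"]
        by (simp add: power2_diff power_mult_distrib algebra_simps)
      moreover have "- (2 * x$1 * \<phi> x * G x $ 1) \<le> 2 * \<bar>x$1 * \<phi> x * G x $ 1\<bar>"
        using abs_ge_minus_self[of "x$1 * \<phi> x * G x $ 1"] by linarith
      ultimately show ?thesis by linarith
    qed simp
  qed (use i in auto)
  also have "\<dots> = (1/2) * (\<integral>x. (\<phi> x)\<^sup>2 \<partial>lborel) + (2 * B\<^sup>2) * (\<integral>x. (norm (G x))\<^sup>2 \<partial>lborel)"
    using i by simp
  finally show ?thesis by simp
qed

section \<open>The space \<open>H10\<close> and existence of states\<close>

lemma finite_measure_lebesgue_on:
  assumes "open \<Omega>" "bounded (\<Omega> :: 'a::euclidean_space set)" shows "finite_measure (lebesgue_on \<Omega>)"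
  using assms emeasure_bounded_finite[OF assms(2)]
  by (auto intro!: finite_measureI simp: emeasure_restrict_space space_restrict_space less_top[symmetric])

lemma square_integrable_Cc_inf:
  assumes "open \<Omega>" "Cc_inf \<Omega> \<phi>"
  shows "square_integrable (lebesgue_on \<Omega>) \<phi>" "square_integrable (lebesgue_on \<Omega>) (grad \<phi>)"
proof -
  note c1 = Cc_inf_compactly_C1[OF assms(2)]
  note c = compactly_C1D(2,3)[OF c1]
  obtain K where K: "compact K" "K \<subseteq> \<Omega>" "\<And>x. x \<notin> K \<Longrightarrow> \<phi> x = 0 \<and> grad \<phi> x = 0"
    using c1 unfolding compactly_C1_def by blast
  have "integrable (lebesgue_on \<Omega>) (\<lambda>x. (norm (\<phi> x))\<^sup>2)" "integrable (lebesgue_on \<Omega>) (\<lambda>x. (norm (grad \<phi> x))\<^sup>2)"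
    by (rule lebesgue_on_compact_support(2)[OF assms(1) _ K(1,2)]; use K(3) in \<open>auto intro!: continuous_intros c\<close>)+
  moreover have "\<phi> \<in> borel_measurable (lebesgue_on \<Omega>)" "grad \<phi> \<in> borel_measurable (lebesgue_on \<Omega>)"
    by (rule lebesgue_on_compact_support(1)[OF assms(1) _ K(1,2)]; use K(3) in \<open>auto intro!: continuous_intros c\<close>)+
  ultimately show "square_integrable (lebesgue_on \<Omega>) \<phi>" "square_integrable (lebesgue_on \<Omega>) (grad \<phi>)"
    by (simp_all add: square_integrable_def)
qed

text \<open>Links the definition of \<open>H10\<close>, whose integrals may a priori be infinite,
  with real squared norms. Square integrability of \<open>u\<close> is a consequence: some
  difference to a square-integrable \<phi>_n has finite norm.\<close>

lemma nn_integral_sqnorm_tendsto_0_iff: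
  fixes u :: "real^2 \<Rightarrow> 'b::euclidean_space"
  assumes \<Omega>: "open \<Omega>" and u: "u \<in> borel_measurable (lebesgue_on \<Omega>)"
    and \<phi>: "\<And>n. square_integrable (lebesgue_on \<Omega>) (\<phi> n)"
  shows "(\<lambda>n. \<integral>\<^sup>+ x\<in>\<Omega>. ennreal ((norm (u x - \<phi> n x))\<^sup>2) \<partial>lebesgue) \<longlonglongrightarrow> 0 \<longleftrightarrow>
     square_integrable (lebesgue_on \<Omega>) u \<and> (\<lambda>n. sqnorm (lebesgue_on \<Omega>) (\<lambda>x. \<phi> n x - u x)) \<longlonglongrightarrow> 0"
    (is "?I \<longlonglongrightarrow> 0 \<longleftrightarrow> ?R")
proof -
  let ?M = "lebesgue_on \<Omega>"
  have I: "?I n = (\<integral>\<^sup>+ x. ennreal ((norm (u x - \<phi> n x))\<^sup>2) \<partial>?M)" for n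
    using \<Omega> by (subst nn_integral_restrict_space) auto
  have eq: "?I n = ennreal (sqnorm ?M (\<lambda>x. \<phi> n x - u x))" if "square_integrable ?M u" for n
    unfolding I sqnorm_minus_commute[of ?M "\<phi> n" u] unfolding sqnorm_def
    using square_integrable_diff[OF that \<phi>[of n]]
    by (intro nn_integral_eq_integral) (auto simp: square_integrable_def)
  have sq: "square_integrable ?M u" if "?I \<longlonglongrightarrow> 0"
  proof -
    have "eventually (\<lambda>n. ?I n < 1) sequentially" using order_tendstoD(2)[OF that, of 1] by simp
    then obtain n where n: "?I n < 1" by (auto simp: eventually_sequentially)
    have "square_integrable ?M (\<lambda>x. u x - \<phi> n x)"
      unfolding square_integrable_def
    proof
      show m: "(\<lambda>x. u x - \<phi> n x) \<in> borel_measurable ?M"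
        using u square_integrableD(1)[OF \<phi>[of n]] by (rule borel_measurable_diff)
      show "integrable ?M (\<lambda>x. (norm (u x - \<phi> n x))\<^sup>2)"
      proof (rule integrableI_bounded)
        show "(\<lambda>x. (norm (u x - \<phi> n x))\<^sup>2) \<in> borel_measurable ?M" using m by measurable
        show "(\<integral>\<^sup>+ x. ennreal (norm ((norm (u x - \<phi> n x))\<^sup>2)) \<partial>?M) < \<infinity>"
          using n unfolding I by (simp add: less_trans[OF _ ennreal_one_less_top])
      qed
    qed
    from square_integrable_add[OF this \<phi>[of n]] show ?thesis by simp
  qed
  have "?I \<longlonglongrightarrow> 0 \<longleftrightarrow> (\<lambda>n. sqnorm ?M (\<lambda>x. \<phi> n x - u x)) \<longlonglongrightarrow> 0" if "square_integrable ?M u"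
    unfolding eq[OF that] using tendsto_ennreal_iff[of "\<lambda>n. sqnorm ?M (\<lambda>x. \<phi> n x - u x)" sequentially 0] by simp
  then show ?thesis using sq by blast
qed

lemma H10_iff:
  assumes \<Omega>: "open \<Omega>"
  shows "H10 \<Omega> u G \<longleftrightarrow> square_integrable (lebesgue_on \<Omega>) u \<and> square_integrable (lebesgue_on \<Omega>) G \<and>
    (\<exists>\<phi>. (\<forall>n. Cc_inf \<Omega> (\<phi> n)) \<and> (\<lambda>n. sqnorm (lebesgue_on \<Omega>) (\<lambda>x. \<phi> n x - u x)) \<longlonglongrightarrow> 0 \<and>
       (\<lambda>n. sqnorm (lebesgue_on \<Omega>) (\<lambda>x. grad (\<phi> n) x - G x)) \<longlonglongrightarrow> 0)" (is "?L \<longleftrightarrow> ?R")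
proof -
  let ?M = "lebesgue_on \<Omega>"
  have eq: "(\<lambda>n. \<integral>\<^sup>+ x\<in>\<Omega>. ennreal ((u x - \<phi> n x)\<^sup>2) \<partial>lebesgue) \<longlonglongrightarrow> 0 \<and>
        (\<lambda>n. \<integral>\<^sup>+ x\<in>\<Omega>. ennreal ((norm (G x - grad (\<phi> n) x))\<^sup>2) \<partial>lebesgue) \<longlonglongrightarrow> 0 \<longleftrightarrow>
      (square_integrable ?M u \<and> (\<lambda>n. sqnorm ?M (\<lambda>x. \<phi> n x - u x)) \<longlonglongrightarrow> 0) \<and>
      (square_integrable ?M G \<and> (\<lambda>n. sqnorm ?M (\<lambda>x. grad (\<phi> n) x - G x)) \<longlonglongrightarrow> 0)"
    if "u \<in> borel_measurable ?M" "G \<in> borel_measurable ?M" "\<forall>n. Cc_inf \<Omega> (\<phi> n)" for \<phi>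
    using nn_integral_sqnorm_tendsto_0_iff[OF \<Omega> that(1), of \<phi>]
      nn_integral_sqnorm_tendsto_0_iff[OF \<Omega> that(2), of "\<lambda>n. grad (\<phi> n)"]
      square_integrable_Cc_inf[OF \<Omega> that(3)[rule_format]] by simp
  show ?thesis
  proof
    assume ?L
    then obtain \<phi> where m: "u \<in> borel_measurable ?M" "G \<in> borel_measurable ?M" and \<phi>: "\<forall>n. Cc_inf \<Omega> (\<phi> n)"
      and lim: "(\<lambda>n. \<integral>\<^sup>+ x\<in>\<Omega>. ennreal ((u x - \<phi> n x)\<^sup>2) \<partial>lebesgue) \<longlonglongrightarrow> 0"
        "(\<lambda>n. \<integral>\<^sup>+ x\<in>\<Omega>. ennreal ((norm (G x - grad (\<phi> n) x))\<^sup>2) \<partial>lebesgue) \<longlonglongrightarrow> 0"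
      unfolding H10_def by blast
    then show ?R using eq[OF m \<phi>] by blast
  next
    assume ?R
    then obtain \<phi> where sq: "square_integrable ?M u" "square_integrable ?M G" and \<phi>: "\<forall>n. Cc_inf \<Omega> (\<phi> n)"
      and lim: "(\<lambda>n. sqnorm ?M (\<lambda>x. \<phi> n x - u x)) \<longlonglongrightarrow> 0" "(\<lambda>n. sqnorm ?M (\<lambda>x. grad (\<phi> n) x - G x)) \<longlonglongrightarrow> 0"
      by blast
    note m = square_integrableD(1)[OF sq(1)] square_integrableD(1)[OF sq(2)]
    from sq lim have "(square_integrable ?M u \<and> (\<lambda>n. sqnorm ?M (\<lambda>x. \<phi> n x - u x)) \<longlonglongrightarrow> 0) \<and>
      (square_integrable ?M G \<and> (\<lambda>n. sqnorm ?M (\<lambda>x. grad (\<phi> n) x - G x)) \<longlonglongrightarrow> 0)" by blast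
    from this[folded eq[OF m \<phi>]] \<phi> m show ?L
      unfolding H10_def by (intro conjI exI[of _ \<phi>]) simp_all
  qed
qed

lemma H10_approx:
  assumes "open \<Omega>" "H10 \<Omega> u G"
  obtains \<phi> where "\<And>n. Cc_inf \<Omega> (\<phi> n)" "(\<lambda>n. sqnorm (lebesgue_on \<Omega>) (\<lambda>x. \<phi> n x - u x)) \<longlonglongrightarrow> 0"
    "(\<lambda>n. sqnorm (lebesgue_on \<Omega>) (\<lambda>x. grad (\<phi> n) x - G x)) \<longlonglongrightarrow> 0"
  using assms(2) unfolding H10_iff[OF assms(1)] by blast

lemma H10_square_integrable:
  assumes "open \<Omega>" "H10 \<Omega> u G"
  shows "square_integrable (lebesgue_on \<Omega>) u" "square_integrable (lebesgue_on \<Omega>) G"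
  using assms(2) unfolding H10_iff[OF assms(1)] by blast+

lemma Cc_inf_H10:
  assumes "open \<Omega>" "Cc_inf \<Omega> \<phi>"
  shows "H10 \<Omega> \<phi> (grad \<phi>)"
  unfolding H10_iff[OF assms(1)]
  using square_integrable_Cc_inf[OF assms] assms(2)
  by (intro conjI exI[of _ "\<lambda>_. \<phi>"]) (simp_all add: sqnorm_def)

lemma Cc_inf_lincomb:
  assumes "Cc_inf \<Omega> \<phi>" "Cc_inf \<Omega> \<psi>"
  shows "Cc_inf \<Omega> (\<lambda>x. \<phi> x + c * \<psi> x)"
proof -
  obtain F :: "2 list \<Rightarrow> real^2 \<Rightarrow> real" where F: "F [] = \<phi>"
    "\<And>\<alpha> x. (F \<alpha> has_derivative (\<lambda>h. \<Sum>i\<in>UNIV. h $ i * F (i # \<alpha>) x)) (at x)"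
    and K: "compact (closure {x. \<phi> x \<noteq> 0})" "closure {x. \<phi> x \<noteq> 0} \<subseteq> \<Omega>"
    using assms(1) unfolding Cc_inf_def by blast
  obtain F' :: "2 list \<Rightarrow> real^2 \<Rightarrow> real" where F': "F' [] = \<psi>"
    "\<And>\<alpha> x. (F' \<alpha> has_derivative (\<lambda>h. \<Sum>i\<in>UNIV. h $ i * F' (i # \<alpha>) x)) (at x)"
    and K': "compact (closure {x. \<psi> x \<noteq> 0})" "closure {x. \<psi> x \<noteq> 0} \<subseteq> \<Omega>"
    using assms(2) unfolding Cc_inf_def by blast
  have sub: "closure {x. \<phi> x + c * \<psi> x \<noteq> 0} \<subseteq> closure {x. \<phi> x \<noteq> 0} \<union> closure {x. \<psi> x \<noteq> 0}"
    unfolding closure_Un[symmetric] by (rule closure_mono) auto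
  have comp: "compact (closure {x. \<phi> x + c * \<psi> x \<noteq> 0})"
    using compact_Int_closed[OF compact_Un[OF K(1) K'(1)] closed_closure, of "{x. \<phi> x + c * \<psi> x \<noteq> 0}"] sub
    by (simp add: Int_absorb1)
  show ?thesis unfolding Cc_inf_def
  proof (intro conjI exI[of _ "\<lambda>\<alpha> x. F \<alpha> x + c * F' \<alpha> x"] allI comp)
    show "closure {x. \<phi> x + c * \<psi> x \<noteq> 0} \<subseteq> \<Omega>" using sub K(2) K'(2) by blast
    fix \<alpha> x
    show "((\<lambda>x. F \<alpha> x + c * F' \<alpha> x) has_derivative
        (\<lambda>h. \<Sum>i\<in>UNIV. h $ i * (F (i # \<alpha>) x + c * F' (i # \<alpha>) x))) (at x)"
      by (rule has_derivative_eq_rhs[OF has_derivative_add[OF F(2) has_derivative_mult_right[OF F'(2)]]])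
         (simp add: algebra_simps sum.distrib sum_distrib_left)
  qed (simp add: F(1) F'(1))
qed

lemma grad_lincomb:
  assumes "Cc_inf \<Omega> \<phi>" "Cc_inf \<Omega> \<psi>"
  shows "grad (\<lambda>x. \<phi> x + c * \<psi> x) x = grad \<phi> x + c *\<^sub>R grad \<psi> x"
proof (rule grad_eqI)
  show "((\<lambda>x. \<phi> x + c * \<psi> x) has_derivative (\<lambda>h. h \<bullet> (grad \<phi> x + c *\<^sub>R grad \<psi> x))) (at x)"
    by (rule has_derivative_eq_rhs[OF has_derivative_add[OF compactly_C1D(1)[OF Cc_inf_compactly_C1[OF assms(1)]]
          has_derivative_mult_right[OF compactly_C1D(1)[OF Cc_inf_compactly_C1[OF assms(2)]]]]])
       (simp add: inner_add_right)
qed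

lemma Cc_inf_zero: "Cc_inf \<Omega> (\<lambda>x. 0)"
  unfolding Cc_inf_def by (intro conjI exI[of _ "\<lambda>_ _. 0"]) auto

lemma tendsto_sqnorm_lincomb:
  assumes f: "\<And>n. square_integrable M (f n)" "square_integrable M F"
    and g: "\<And>n. square_integrable M (g n)" "square_integrable M G"
    and lf: "(\<lambda>n. sqnorm M (\<lambda>x. f n x - F x)) \<longlonglongrightarrow> 0"
    and lg: "(\<lambda>n. sqnorm M (\<lambda>x. g n x - G x)) \<longlonglongrightarrow> 0"
  shows "(\<lambda>n. sqnorm M (\<lambda>x. (f n x + c *\<^sub>R g n x) - (F x + c *\<^sub>R G x))) \<longlonglongrightarrow> 0"
proof (rule Lim_null_comparison)
  show "\<forall>\<^sub>F n in sequentially. norm (sqnorm M (\<lambda>x. (f n x + c *\<^sub>R g n x) - (F x + c *\<^sub>R G x)))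
      \<le> 2 * sqnorm M (\<lambda>x. f n x - F x) + 2 * (c\<^sup>2 * sqnorm M (\<lambda>x. g n x - G x))"
  proof (rule always_eventually, rule allI)
    fix n
    have "sqnorm M (\<lambda>x. (f n x - F x) + c *\<^sub>R (g n x - G x)) \<le>
        2 * sqnorm M (\<lambda>x. f n x - F x) + 2 * (c\<^sup>2 * sqnorm M (\<lambda>x. g n x - G x))"
      using sqnorm_add_le[OF square_integrable_diff[OF f(1)[of n] f(2)]
          square_integrable_scaleR[OF square_integrable_diff[OF g(1)[of n] g(2)], of c]]
      by (simp only: sqnorm_scaleR)
    then show "norm (sqnorm M (\<lambda>x. (f n x + c *\<^sub>R g n x) - (F x + c *\<^sub>R G x)))
      \<le> 2 * sqnorm M (\<lambda>x. f n x - F x) + 2 * (c\<^sup>2 * sqnorm M (\<lambda>x. g n x - G x))"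
      by (simp add: algebra_simps)
  qed
  have "(\<lambda>n. 2 * sqnorm M (\<lambda>x. f n x - F x) + 2 * (c\<^sup>2 * sqnorm M (\<lambda>x. g n x - G x))) \<longlonglongrightarrow> 2 * 0 + 2 * (c\<^sup>2 * 0)"
    by (intro tendsto_intros lf lg)
  then show "(\<lambda>n. 2 * sqnorm M (\<lambda>x. f n x - F x) + 2 * (c\<^sup>2 * sqnorm M (\<lambda>x. g n x - G x))) \<longlonglongrightarrow> 0" by simp
qed

lemma H10_lincomb:
  assumes \<Omega>: "open \<Omega>" and u: "H10 \<Omega> u G" and v: "H10 \<Omega> v H"
  shows "H10 \<Omega> (\<lambda>x. u x + c * v x) (\<lambda>x. G x + c *\<^sub>R H x)"
proof -
  obtain \<phi> where \<phi>: "\<And>n. Cc_inf \<Omega> (\<phi> n)" "(\<lambda>n. sqnorm (lebesgue_on \<Omega>) (\<lambda>x. \<phi> n x - u x)) \<longlonglongrightarrow> 0"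
    "(\<lambda>n. sqnorm (lebesgue_on \<Omega>) (\<lambda>x. grad (\<phi> n) x - G x)) \<longlonglongrightarrow> 0" by (rule H10_approx[OF \<Omega> u]) blast
  obtain \<psi> where \<psi>: "\<And>n. Cc_inf \<Omega> (\<psi> n)" "(\<lambda>n. sqnorm (lebesgue_on \<Omega>) (\<lambda>x. \<psi> n x - v x)) \<longlonglongrightarrow> 0"
    "(\<lambda>n. sqnorm (lebesgue_on \<Omega>) (\<lambda>x. grad (\<psi> n) x - H x)) \<longlonglongrightarrow> 0" by (rule H10_approx[OF \<Omega> v]) blast
  note su = H10_square_integrable[OF \<Omega> u] and sv = H10_square_integrable[OF \<Omega> v]
  note s\<phi> = square_integrable_Cc_inf[OF \<Omega> \<phi>(1)] and s\<psi> = square_integrable_Cc_inf[OF \<Omega> \<psi>(1)]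
  show ?thesis unfolding H10_iff[OF \<Omega>]
  proof (intro conjI exI[of _ "\<lambda>n x. \<phi> n x + c * \<psi> n x"] allI)
    show "square_integrable (lebesgue_on \<Omega>) (\<lambda>x. u x + c * v x)"
      using square_integrable_add[OF su(1) square_integrable_mult[OF sv(1)]] .
    show "square_integrable (lebesgue_on \<Omega>) (\<lambda>x. G x + c *\<^sub>R H x)"
      using square_integrable_add[OF su(2) square_integrable_scaleR[OF sv(2)]] .
    show "Cc_inf \<Omega> (\<lambda>x. \<phi> n x + c * \<psi> n x)" for n by (intro Cc_inf_lincomb \<phi> \<psi>)
    show "(\<lambda>n. sqnorm (lebesgue_on \<Omega>) (\<lambda>x. \<phi> n x + c * \<psi> n x - (u x + c * v x))) \<longlonglongrightarrow> 0"
      using tendsto_sqnorm_lincomb[OF s\<phi>(1) su(1) s\<psi>(1) sv(1) \<phi>(2) \<psi>(2), of c] by simp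
    show "(\<lambda>n. sqnorm (lebesgue_on \<Omega>) (\<lambda>x. grad (\<lambda>x. \<phi> n x + c * \<psi> n x) x - (G x + c *\<^sub>R H x))) \<longlonglongrightarrow> 0"
      using tendsto_sqnorm_lincomb[OF s\<phi>(2) su(2) s\<psi>(2) sv(2) \<phi>(3) \<psi>(3), of c]
      by (simp add: grad_lincomb[OF \<phi>(1) \<psi>(1)])
  qed
qed

lemma sqnorm_inner: "sqnorm M f = (\<integral>x. f x \<bullet> f x \<partial>M)"
  by (simp add: sqnorm_def power2_norm_eq_inner)

lemma compactly_C1_mono: "compactly_C1 \<Omega> \<phi> G \<Longrightarrow> \<Omega> \<subseteq> \<Omega>' \<Longrightarrow> compactly_C1 \<Omega>' \<phi> G"
  unfolding compactly_C1_def by (meson order_trans)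

lemma Poincare_Cc_inf:
  assumes \<Omega>: "open \<Omega>" and B: "\<And>x. x \<in> \<Omega> \<Longrightarrow> norm x \<le> B" and \<phi>: "Cc_inf \<Omega> \<phi>"
  shows "sqnorm (lebesgue_on \<Omega>) \<phi> \<le> 4 * B\<^sup>2 * sqnorm (lebesgue_on \<Omega>) (grad \<phi>)"
proof -
  note c1 = Cc_inf_compactly_C1[OF \<phi>]
  note c = compactly_C1D(2,3)[OF c1]
  obtain K where K: "compact K" "K \<subseteq> \<Omega>" "\<And>x. x \<notin> K \<Longrightarrow> \<phi> x = 0 \<and> grad \<phi> x = 0"
    using c1 unfolding compactly_C1_def by blast
  have 1: "sqnorm (lebesgue_on \<Omega>) \<phi> = (\<integral>x. (\<phi> x)\<^sup>2 \<partial>lborel)"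
    "sqnorm (lebesgue_on \<Omega>) (grad \<phi>) = (\<integral>x. (norm (grad \<phi> x))\<^sup>2 \<partial>lborel)"
    unfolding sqnorm_def real_norm_def power2_abs
    by (rule lebesgue_on_compact_support(3)[OF \<Omega> _ K(1,2)]; use K(3) in \<open>auto intro!: continuous_intros c\<close>)+
  show ?thesis unfolding 1
    by (rule Poincare_C1[OF compactly_C1_mono[OF c1]]) (use K B in auto)
qed

lemma H10_Poincare:
  assumes \<Omega>: "open \<Omega>" and B: "\<And>x. x \<in> \<Omega> \<Longrightarrow> norm x \<le> B" and u: "H10 \<Omega> u G"
  shows "sqnorm (lebesgue_on \<Omega>) u \<le> 4 * B\<^sup>2 * sqnorm (lebesgue_on \<Omega>) G"
proof -
  obtain \<phi> where \<phi>: "\<And>n. Cc_inf \<Omega> (\<phi> n)" "(\<lambda>n. sqnorm (lebesgue_on \<Omega>) (\<lambda>x. \<phi> n x - u x)) \<longlonglongrightarrow> 0"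
    "(\<lambda>n. sqnorm (lebesgue_on \<Omega>) (\<lambda>x. grad (\<phi> n) x - G x)) \<longlonglongrightarrow> 0" by (rule H10_approx[OF \<Omega> u]) blast
  note su = H10_square_integrable[OF \<Omega> u] and s\<phi> = square_integrable_Cc_inf[OF \<Omega> \<phi>(1)]
  have "(\<lambda>n. sqnorm (lebesgue_on \<Omega>) (\<phi> n)) \<longlonglongrightarrow> sqnorm (lebesgue_on \<Omega>) u"
    "(\<lambda>n. sqnorm (lebesgue_on \<Omega>) (grad (\<phi> n))) \<longlonglongrightarrow> sqnorm (lebesgue_on \<Omega>) G"
    unfolding sqnorm_inner using su s\<phi> \<phi>(2,3) by (intro tendsto_integral_inner; simp)+
  then show ?thesis
    by (intro LIMSEQ_le[OF _ tendsto_mult_left]) (auto intro!: Poincare_Cc_inf[OF \<Omega> B \<phi>(1)])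
qed

lemma square_integrable_rot:
  assumes "square_integrable M G" shows "square_integrable M (\<lambda>x. rot (G x))"
  using assms unfolding square_integrable_def norm_rot
  by (auto intro: borel_measurable_continuous_on[OF linear_continuous_on[OF bounded_linear_rot]])

text \<open>The null-Lagrangian identity survives the closure because \<open>rot\<close> is a linear
  isometry. It makes constant multiples of \<open>rot (grad S)\<close> available as fluxes that no
  \<open>H10\<close> test function sees.\<close>

lemma H10_rot_orthogonal:
  assumes \<Omega>: "open \<Omega>" and u: "H10 \<Omega> u G" and v: "H10 \<Omega> v H"
  shows "(\<integral>x. rot (G x) \<bullet> H x \<partial>lebesgue_on \<Omega>) = 0"
proof -
  obtain \<phi> where \<phi>: "\<And>n. Cc_inf \<Omega> (\<phi> n)" 
    "(\<lambda>n. sqnorm (lebesgue_on \<Omega>) (\<lambda>x. grad (\<phi> n) x - G x)) \<longlonglongrightarrow> 0" by (rule H10_approx[OF \<Omega> u]) blast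
  obtain \<psi> where \<psi>: "\<And>n. Cc_inf \<Omega> (\<psi> n)"
    "(\<lambda>n. sqnorm (lebesgue_on \<Omega>) (\<lambda>x. grad (\<psi> n) x - H x)) \<longlonglongrightarrow> 0" by (rule H10_approx[OF \<Omega> v]) blast
  note su = H10_square_integrable[OF \<Omega> u] and sv = H10_square_integrable[OF \<Omega> v]
  note s\<phi> = square_integrable_Cc_inf[OF \<Omega> \<phi>(1)] and s\<psi> = square_integrable_Cc_inf[OF \<Omega> \<psi>(1)]
  have "(\<integral>x. rot (grad (\<phi> n) x) \<bullet> grad (\<psi> n) x \<partial>lebesgue_on \<Omega>) = 0" for n
  proof -
    note c1 = Cc_inf_compactly_C1[OF \<phi>(1)[of n]] and c2 = Cc_inf_compactly_C1[OF \<psi>(1)[of n]]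
    obtain K where K: "compact K" "K \<subseteq> \<Omega>" "\<And>x. x \<notin> K \<Longrightarrow> \<phi> n x = 0 \<and> grad (\<phi> n) x = 0"
      using c1 unfolding compactly_C1_def by blast
    have "(\<integral>x. rot (grad (\<phi> n) x) \<bullet> grad (\<psi> n) x \<partial>lebesgue_on \<Omega>) = (\<integral>x. rot (grad (\<phi> n) x) \<bullet> grad (\<psi> n) x \<partial>lborel)"
      by (rule lebesgue_on_compact_support(3)[OF \<Omega> _ K(1,2)])
         (use K(3) in \<open>auto intro!: continuous_intros compactly_C1D(3)[OF c1] compactly_C1D(3)[OF c2] simp: rot_inner\<close>)
    also have "\<dots> = 0" by (rule integral_rot_C1[OF compactly_C1_mono[OF c1] compactly_C1_mono[OF c2]]) auto
    finally show ?thesis .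
  qed
  moreover have "(\<lambda>n. \<integral>x. rot (grad (\<phi> n) x) \<bullet> grad (\<psi> n) x \<partial>lebesgue_on \<Omega>) \<longlonglongrightarrow> (\<integral>x. rot (G x) \<bullet> H x \<partial>lebesgue_on \<Omega>)"
    by (rule tendsto_integral_inner)
       (use su sv s\<phi> s\<psi> \<phi>(2) \<psi>(2) in \<open>auto intro!: square_integrable_rot simp: rot_diff[symmetric] sqnorm_def norm_rot\<close>)
  ultimately show ?thesis using LIMSEQ_unique[OF _ tendsto_const] by simp
qed

section \<open>The weighted Dirichlet energy and its minimization\<close>

lemma integrable_weighted_inner:
  assumes "square_integrable M G" "square_integrable M H" "a \<in> borel_measurable M" "AE x in M. \<bar>a x\<bar> \<le> C"
  shows "integrable M (\<lambda>x. a x * (G x \<bullet> H x))"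
  using integrable_inner[OF square_integrable_bounded_scaleR[OF assms(1,3,4)] assms(2)] by simp

lemma weighted_energy_expand:
  assumes G: "square_integrable M G" and H: "square_integrable M H"
    and a: "a \<in> borel_measurable M" "AE x in M. \<bar>a x\<bar> \<le> C"
  shows "(\<integral>x. a x * ((G x + c *\<^sub>R H x) \<bullet> (G x + c *\<^sub>R H x)) \<partial>M) =
     (\<integral>x. a x * (G x \<bullet> G x) \<partial>M) + 2 * c * (\<integral>x. a x * (G x \<bullet> H x) \<partial>M) + c\<^sup>2 * (\<integral>x. a x * (H x \<bullet> H x) \<partial>M)"
proof -
  note i = integrable_weighted_inner[OF G G a] integrable_weighted_inner[OF G H a] integrable_weighted_inner[OF H H a]
  have "(\<integral>x. a x * ((G x + c *\<^sub>R H x) \<bullet> (G x + c *\<^sub>R H x)) \<partial>M) =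
    (\<integral>x. a x * (G x \<bullet> G x) + 2 * c * (a x * (G x \<bullet> H x)) + c\<^sup>2 * (a x * (H x \<bullet> H x)) \<partial>M)"
    by (intro Bochner_Integration.integral_cong)
       (auto simp: inner_add_left inner_add_right inner_commute[of "H _" "G _"] algebra_simps power2_eq_square)
  also have "\<dots> = (\<integral>x. a x * (G x \<bullet> G x) \<partial>M) + 2 * c * (\<integral>x. a x * (G x \<bullet> H x) \<partial>M) + c\<^sup>2 * (\<integral>x. a x * (H x \<bullet> H x) \<partial>M)"
    using i by simp
  finally show ?thesis .
qed

lemma weighted_energy_coercive:
  assumes H: "square_integrable M H" and a: "a \<in> borel_measurable M" "AE x in M. \<alpha> \<le> a x \<and> a x \<le> C" "\<alpha> > 0"
  shows "\<alpha> * sqnorm M H \<le> (\<integral>x. a x * (H x \<bullet> H x) \<partial>M)"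
proof -
  have b: "AE x in M. \<bar>a x\<bar> \<le> C" using a(2) by eventually_elim (use a(3) in auto)
  have "(\<integral>x. \<alpha> * (norm (H x))\<^sup>2 \<partial>M) \<le> (\<integral>x. a x * (H x \<bullet> H x) \<partial>M)"
  proof (rule integral_mono_AE)
    show "AE x in M. \<alpha> * (norm (H x))\<^sup>2 \<le> a x * (H x \<bullet> H x)"
      using a(2) by eventually_elim (simp add: power2_norm_eq_inner mult_right_mono)
  qed (use H integrable_weighted_inner[OF H H a(1) b] in \<open>auto simp: square_integrable_def\<close>)
  then show ?thesis using H by (simp add: sqnorm_def square_integrable_def)
qed

lemma linear_coeff_zero:
  fixes D Q :: real
  assumes ge: "\<And>t. 0 \<le> t * D + t\<^sup>2 / 2 * Q" and Q: "Q \<ge> 0"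
  shows "D = 0"
proof -
  \<comment> \<open>Near the minimizer -D/Q of the quadratic; the added 1 keeps the quotient
    meaningful for Q = 0 and still gives a strictly negative value unless D = 0.\<close>
  define t where "t = - D / (Q + 1)"
  have D: "D = - t * (Q + 1)" using Q by (simp add: t_def)
  have "t * D + t\<^sup>2 / 2 * Q = - (t\<^sup>2 * (Q / 2 + 1))"
    unfolding D by (simp add: power2_eq_square algebra_simps)
  then have "t\<^sup>2 * (Q / 2 + 1) \<le> 0" using ge[of t] by linarith
  then have "t = 0" using Q by (simp add: mult_le_0_iff)
  then show ?thesis using D by simp
qed

text \<open>Direct method. The coefficient is scalar, so the bilinear form is symmetric and the
  state equation is the Euler equation of a quadratic energy. The energy is minimized over smooth
  functions only; a minimizing sequence converges in L^2 together with its gradients, and its limit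
  lies in \<open>H10\<close> by definition.\<close>

theorem state_exists:
  assumes \<Omega>: "open \<Omega>" "bounded \<Omega>" and f: "square_integrable (lebesgue_on \<Omega>) f"
    and \<alpha>: "\<alpha> > 0" and adm: "admissible \<alpha> \<Omega> a"
  obtains y Gy where "is_state \<Omega> a f y Gy"
proof -
  let ?M = "lebesgue_on \<Omega>"
  obtain B where B0: "B > 0" and B: "\<And>x. x \<in> \<Omega> \<Longrightarrow> norm x \<le> B" using \<Omega>(2) bounded_pos by metis
  define P where "P = 4 * B\<^sup>2"
  have P0: "P > 0" using B0 by (simp add: P_def)
  have fin: "finite_measure ?M" by (rule finite_measure_lebesgue_on[OF \<Omega>])
  obtain C where am: "a \<in> borel_measurable ?M" and aC: "AE x in ?M. \<alpha> \<le> a x \<and> a x \<le> C"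
    using adm unfolding admissible_def by blast
  have ab: "AE x in ?M. \<bar>a x\<bar> \<le> C" using aC by eventually_elim (use \<alpha> in auto)
  define A where "A G H = (\<integral>x. a x * (G x \<bullet> H x) \<partial>?M)" for G H :: "real^2 \<Rightarrow> real^2"
  define F where "F \<phi> = (\<integral>x. f x * \<phi> x \<partial>?M)" for \<phi>
  define E where "E \<phi> = A (grad \<phi>) (grad \<phi>) / 2 - F \<phi>" for \<phi>
  note sq = square_integrable_Cc_inf[OF \<Omega>(1)]
  have coer: "\<alpha> * sqnorm ?M H \<le> A H H" if "square_integrable ?M H" for H
    unfolding A_def by (rule weighted_energy_coercive[OF that am aC \<alpha>])
  have E_line: "E (\<lambda>x. \<phi> x + c * \<psi> x) = E \<phi> + c * (A (grad \<phi>) (grad \<psi>) - F \<psi>) + c\<^sup>2 / 2 * A (grad \<psi>) (grad \<psi>)"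
    if "Cc_inf \<Omega> \<phi>" "Cc_inf \<Omega> \<psi>" for \<phi> \<psi> c
  proof -
    have "A (grad (\<lambda>x. \<phi> x + c * \<psi> x)) (grad (\<lambda>x. \<phi> x + c * \<psi> x)) =
       A (grad \<phi>) (grad \<phi>) + 2 * c * A (grad \<phi>) (grad \<psi>) + c\<^sup>2 * A (grad \<psi>) (grad \<psi>)"
      unfolding A_def grad_lincomb[OF that] by (rule weighted_energy_expand[OF sq(2)[OF that(1)] sq(2)[OF that(2)] am ab])
    moreover have "F (\<lambda>x. \<phi> x + c * \<psi> x) = F \<phi> + c * F \<psi>"
      unfolding F_def using integrable_mult_square[OF f sq(1)[OF that(1)]] integrable_mult_square[OF f sq(1)[OF that(2)]]
      by (simp add: distrib_left mult.left_commute[of _ c])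
    ultimately show ?thesis by (simp add: E_def field_simps)
  qed
  \<comment> \<open>The weight \<alpha>/P is the one for which Young's inequality followed by
    Poincare and coercivity returns exactly the quadratic part of the energy, leaving a
    constant.\<close>
  have E_lower: "- (sqnorm ?M f * P / (2 * \<alpha>)) \<le> E \<phi>" if "Cc_inf \<Omega> \<phi>" for \<phi>
  proof -
    have "2 * \<bar>F \<phi>\<bar> \<le> sqnorm ?M f / (\<alpha> / P) + (\<alpha> / P) * sqnorm ?M \<phi>"
      using integral_inner_le_sqnorm[OF f sq(1)[OF that], of "\<alpha> / P"] \<alpha> P0 by (simp add: F_def)
    also have "(\<alpha> / P) * sqnorm ?M \<phi> \<le> (\<alpha> / P) * (P * sqnorm ?M (grad \<phi>))"
      unfolding P_def by (rule mult_left_mono[OF Poincare_Cc_inf[OF \<Omega>(1) B that]]) (use \<alpha> in simp_all)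
    also have "\<dots> \<le> A (grad \<phi>) (grad \<phi>)" using coer[OF sq(2)[OF that]] P0 by simp
    finally have "2 * \<bar>F \<phi>\<bar> \<le> sqnorm ?M f * P / \<alpha> + A (grad \<phi>) (grad \<phi>)" by simp
    then show ?thesis unfolding E_def by simp
  qed
  define m where "m = Inf (E ` Collect (Cc_inf \<Omega>))"
  have bdd: "bdd_below (E ` Collect (Cc_inf \<Omega>))"
    using E_lower by (intro bdd_belowI2) auto
  have m_le: "m \<le> E \<phi>" if "Cc_inf \<Omega> \<phi>" for \<phi>
    unfolding m_def using that bdd by (intro cInf_lower) auto
  have "\<exists>\<phi>. Cc_inf \<Omega> \<phi> \<and> E \<phi> < m + 1 / real (Suc n)" for n
  proof -
    have "E ` Collect (Cc_inf \<Omega>) \<noteq> {}" using Cc_inf_zero by auto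
    from cInf_lessD[OF this, of "m + 1 / real (Suc n)"] show ?thesis by (auto simp: m_def)
  qed
  then have "\<exists>\<phi>. \<forall>n. Cc_inf \<Omega> (\<phi> n) \<and> E (\<phi> n) < m + 1 / real (Suc n)" by (intro choice allI)
  then obtain \<phi> where \<phi>: "\<And>n. Cc_inf \<Omega> (\<phi> n)" and E\<phi>: "\<And>n. E (\<phi> n) < m + 1 / real (Suc n)" by blast
  \<comment> \<open>By the parallelogram law for the energy, the minimizing sequence is Cauchy.\<close>
  have grad_diff: "\<alpha> / 4 * sqnorm ?M (\<lambda>x. grad (\<phi> j) x - grad (\<phi> k) x) \<le> 1 / real (Suc j) + 1 / real (Suc k)" for j k
  proof -
    define d where "d x = \<phi> j x + (-1) * \<phi> k x" for x
    have d: "Cc_inf \<Omega> d" unfolding d_def by (rule Cc_inf_lincomb[OF \<phi> \<phi>])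
    have gd: "grad d = (\<lambda>x. grad (\<phi> j) x - grad (\<phi> k) x)"
      unfolding d_def by (rule ext) (simp only: grad_lincomb[OF \<phi> \<phi>], simp)
    have "(\<lambda>x. \<phi> k x + 1 * d x) = \<phi> j" by (auto simp: d_def)
    then have 1: "E (\<phi> j) = E (\<phi> k) + (A (grad (\<phi> k)) (grad d) - F d) + A (grad d) (grad d) / 2"
      using E_line[OF \<phi>[of k] d, of 1] by simp
    have "m \<le> E (\<lambda>x. \<phi> k x + (1/2) * d x)" by (rule m_le[OF Cc_inf_lincomb[OF \<phi> d]])
    also have "\<dots> = E (\<phi> k) + (1/2) * (A (grad (\<phi> k)) (grad d) - F d) + A (grad d) (grad d) / 8"
      using E_line[OF \<phi>[of k] d, of "1/2"] by (simp add: power2_eq_square)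
    finally have "m \<le> E (\<phi> k) + (1/2) * (A (grad (\<phi> k)) (grad d) - F d) + A (grad d) (grad d) / 8" .
    \<comment> \<open>Twice the midpoint inequality, minus the expansion at the endpoint, eliminates
      the linear term and leaves a quarter of the energy of the difference.\<close>
    then have "A (grad d) (grad d) / 4 \<le> E (\<phi> j) + E (\<phi> k) - 2 * m" using 1 by argo
    moreover have "\<alpha> * sqnorm ?M (grad d) \<le> A (grad d) (grad d)" by (rule coer[OF sq(2)[OF d]])
    ultimately show ?thesis using E\<phi>[of j] E\<phi>[of k] unfolding gd by simp
  qed
  have diff_le: "sqnorm ?M (\<lambda>x. \<phi> j x - \<phi> k x) \<le> P * sqnorm ?M (\<lambda>x. grad (\<phi> j) x - grad (\<phi> k) x)" for j k
    using Poincare_Cc_inf[OF \<Omega>(1) B Cc_inf_lincomb[OF \<phi>[of j] \<phi>[of k], of "-1"]]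
    unfolding P_def grad_lincomb[OF \<phi>[of j] \<phi>[of k]] by simp
  have small: "\<exists>N. \<forall>j\<ge>N. \<forall>k\<ge>N. sqnorm ?M (\<lambda>x. grad (\<phi> j) x - grad (\<phi> k) x) < e" if "e > 0" for e
  proof -
    have "\<alpha> * e / 8 > 0" using that \<alpha> by simp
    from reals_Archimedean[OF this] obtain N where "inverse (real (Suc N)) < \<alpha> * e / 8" by blast
    then have N: "1 / real (Suc N) < \<alpha> * e / 8" unfolding inverse_eq_divide .
    show ?thesis
    proof (intro exI allI impI)
      fix j k assume "N \<le> j" "N \<le> k"
      then have "1 / real (Suc j) \<le> 1 / real (Suc N)" "1 / real (Suc k) \<le> 1 / real (Suc N)"
        by (auto simp: field_simps)
      then have "\<alpha> / 4 * sqnorm ?M (\<lambda>x. grad (\<phi> j) x - grad (\<phi> k) x) < \<alpha> / 4 * e"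
        using grad_diff[of j k] N by simp
      then show "sqnorm ?M (\<lambda>x. grad (\<phi> j) x - grad (\<phi> k) x) < e" using \<alpha> by simp
    qed
  qed
  obtain Gy where Gy: "square_integrable ?M Gy" "(\<lambda>n. sqnorm ?M (\<lambda>x. grad (\<phi> n) x - Gy x)) \<longlonglongrightarrow> 0"
    by (rule square_integrable_complete[OF fin sq(2)[OF \<phi>] small]) blast
  have small': "\<exists>N. \<forall>j\<ge>N. \<forall>k\<ge>N. sqnorm ?M (\<lambda>x. \<phi> j x - \<phi> k x) < e" if "e > 0" for e
  proof -
    obtain N where N: "\<And>j k. j \<ge> N \<Longrightarrow> k \<ge> N \<Longrightarrow> sqnorm ?M (\<lambda>x. grad (\<phi> j) x - grad (\<phi> k) x) < e / P"
      using small[of "e / P"] \<open>e > 0\<close> P0 by auto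
    show ?thesis
    proof (intro exI allI impI)
      fix j k assume "N \<le> j" "N \<le> k"
      then have "P * sqnorm ?M (\<lambda>x. grad (\<phi> j) x - grad (\<phi> k) x) < e" using N[of j k] P0 by (simp add: field_simps)
      then show "sqnorm ?M (\<lambda>x. \<phi> j x - \<phi> k x) < e" using diff_le[of j k] by linarith
    qed
  qed
  obtain y where y: "square_integrable ?M y" "(\<lambda>n. sqnorm ?M (\<lambda>x. \<phi> n x - y x)) \<longlonglongrightarrow> 0"
    by (rule square_integrable_complete[OF fin sq(1)[OF \<phi>] small']) blast
  have H10y: "H10 \<Omega> y Gy" unfolding H10_iff[OF \<Omega>(1)] using y Gy \<phi> by blast
  have A_scale: "A G H = (\<integral>x. G x \<bullet> (a x *\<^sub>R H x) \<partial>?M)" for G H by (simp add: A_def)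
  have EL: "A Gy (grad \<psi>) = F \<psi>" if \<psi>: "Cc_inf \<Omega> \<psi>" for \<psi>
  proof -
    let ?D = "A Gy (grad \<psi>) - F \<psi>" and ?Q = "A (grad \<psi>) (grad \<psi>)"
    have Alim: "(\<lambda>n. A (grad (\<phi> n)) (grad \<psi>)) \<longlonglongrightarrow> A Gy (grad \<psi>)"
      unfolding A_scale
      by (rule tendsto_integral_inner[OF sq(2)[OF \<phi>] Gy(1) _ _ Gy(2)])
         (auto intro!: square_integrable_bounded_scaleR[OF sq(2)[OF \<psi>] am ab] simp: sqnorm_def)
    \<comment> \<open>The smooth \<phi>_n is varied, not the limit y, so that every competitor
      belongs to the class over which \<open>m\<close> is the infimum. Near-minimality costs
      1/(n+1), which disappears in the limit.\<close>
    have ge: "0 \<le> t * ?D + t\<^sup>2 / 2 * ?Q" for t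
    proof (rule tendsto_lowerbound[of _ _ sequentially])
      have "(\<lambda>n. 1 / real (Suc n) + t * (A (grad (\<phi> n)) (grad \<psi>) - F \<psi>) + t\<^sup>2 / 2 * ?Q)
         \<longlonglongrightarrow> 0 + t * ?D + t\<^sup>2 / 2 * ?Q"
        by (intro tendsto_intros Alim LIMSEQ_Suc[OF lim_1_over_n])
      then show "(\<lambda>n. 1 / real (Suc n) + t * (A (grad (\<phi> n)) (grad \<psi>) - F \<psi>) + t\<^sup>2 / 2 * ?Q)
         \<longlonglongrightarrow> t * ?D + t\<^sup>2 / 2 * ?Q" by simp
      show "\<forall>\<^sub>F n in sequentially. 0 \<le> 1 / real (Suc n) + t * (A (grad (\<phi> n)) (grad \<psi>) - F \<psi>) + t\<^sup>2 / 2 * ?Q"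
      proof (rule always_eventually, rule allI)
        fix n
        have "m \<le> E (\<lambda>x. \<phi> n x + t * \<psi> x)" by (rule m_le[OF Cc_inf_lincomb[OF \<phi> \<psi>]])
        then show "0 \<le> 1 / real (Suc n) + t * (A (grad (\<phi> n)) (grad \<psi>) - F \<psi>) + t\<^sup>2 / 2 * ?Q"
          using E_line[OF \<phi>[of n] \<psi>, of t] E\<phi>[of n] by linarith
      qed
    qed simp
    have Q0: "?Q \<ge> 0" using coer[OF sq(2)[OF \<psi>]] mult_nonneg_nonneg[OF less_imp_le[OF \<alpha>] sqnorm_nonneg[of ?M "grad \<psi>"]] by linarith
    have "?D = 0" by (rule linear_coeff_zero[OF ge Q0])
    then show ?thesis by simp
  qed
  have "is_state \<Omega> a f y Gy"
    unfolding is_state_def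
  proof (intro conjI H10y allI impI)
    fix v Gv assume v: "H10 \<Omega> v Gv"
    obtain \<psi> where \<psi>: "\<And>n. Cc_inf \<Omega> (\<psi> n)" "(\<lambda>n. sqnorm ?M (\<lambda>x. \<psi> n x - v x)) \<longlonglongrightarrow> 0"
      "(\<lambda>n. sqnorm ?M (\<lambda>x. grad (\<psi> n) x - Gv x)) \<longlonglongrightarrow> 0" by (rule H10_approx[OF \<Omega>(1) v]) blast
    note sv = H10_square_integrable[OF \<Omega>(1) v]
    have aGy: "square_integrable ?M (\<lambda>x. a x *\<^sub>R Gy x)" by (rule square_integrable_bounded_scaleR[OF Gy(1) am ab])
    have "(\<lambda>n. \<integral>x. (a x *\<^sub>R Gy x) \<bullet> grad (\<psi> n) x \<partial>?M) \<longlonglongrightarrow> (\<integral>x. (a x *\<^sub>R Gy x) \<bullet> Gv x \<partial>?M)"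
      by (rule tendsto_integral_inner[OF aGy aGy sq(2)[OF \<psi>(1)] sv(2) _ \<psi>(3)]) (simp add: sqnorm_def)
    moreover have "(\<lambda>n. \<integral>x. f x \<bullet> \<psi> n x \<partial>?M) \<longlonglongrightarrow> (\<integral>x. f x \<bullet> v x \<partial>?M)"
      by (rule tendsto_integral_inner[OF f f sq(1)[OF \<psi>(1)] sv(1) _ \<psi>(2)]) (simp add: sqnorm_def)
    moreover have "(\<integral>x. (a x *\<^sub>R Gy x) \<bullet> grad (\<psi> n) x \<partial>?M) = (\<integral>x. f x \<bullet> \<psi> n x \<partial>?M)" for n
      using EL[OF \<psi>(1)[of n]] by (simp add: A_def F_def)
    ultimately have "(\<integral>x. (a x *\<^sub>R Gy x) \<bullet> Gv x \<partial>?M) = (\<integral>x. f x \<bullet> v x \<partial>?M)"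
      using LIMSEQ_unique by simp
    then show "(\<integral>x. a x * (Gy x \<bullet> Gv x) \<partial>?M) = (\<integral>x. f x * v x \<partial>?M)" by simp
  qed
  then show thesis by (rule that)
qed

section \<open>A smooth strip profile\<close>

text \<open>Differentiating P(1/x) exp(-1/x) gives (P - P')(1/x) exp(-1/x) / x^2. In the variable
  1/x the last factor is the square represented by \<open>[:0, 0, 1:]\<close>.\<close>

primrec flat_poly :: "nat \<Rightarrow> real poly" where
  "flat_poly 0 = 1"
| "flat_poly (Suc k) = [:0, 0, 1:] * (flat_poly k - pderiv (flat_poly k))"

text \<open>The \<open>k\<close>-th derivative of the function that is \<open>exp (-1/x)\<close> for \<open>x > 0\<close> and \<open>0\<close> elsewhere.\<close>
definition flat :: "nat \<Rightarrow> real \<Rightarrow> real" where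
  "flat k x = (if x \<le> 0 then 0 else poly (flat_poly k) (1/x) * exp (-(1/x)))"

lemma poly_times_exp_minus_tendsto_0: "((\<lambda>y::real. poly p y * exp (-y)) \<longlongrightarrow> 0) at_top"
proof -
  have "((\<lambda>y. \<Sum>i\<le>degree p. coeff p i * (y ^ i / exp y)) \<longlongrightarrow> (\<Sum>i\<le>degree p. coeff p i * 0)) at_top"
    by (intro tendsto_sum tendsto_mult tendsto_const tendsto_power_div_exp_0)
  moreover have "(\<lambda>y. \<Sum>i\<le>degree p. coeff p i * (y ^ i / exp y)) = (\<lambda>y. poly p y * exp (-y))"
    by (auto simp: poly_altdef sum_distrib_right exp_minus divide_inverse mult.assoc)
  ultimately show ?thesis by simp
qed

lemma flat_has_derivative: "(flat k has_real_derivative flat (Suc k) x) (at x)"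
proof -
  consider "x < 0" | "x > 0" | "x = 0" by linarith
  then show ?thesis
  proof cases
    case 1
    have "((\<lambda>_. 0) has_real_derivative 0) (at x)" by simp
    then have "(flat k has_real_derivative 0) (at x)"
      by (rule has_field_derivative_transform_within_open[where S="{..<0}"]) (use 1 in \<open>auto simp: flat_def\<close>)
    then show ?thesis using 1 by (simp add: flat_def)
  next
    case 2
    let ?p = "flat_poly k"
    have inv: "((\<lambda>x. 1 / x) has_real_derivative - (1 / x\<^sup>2)) (at x)"
      using 2 by (auto intro!: derivative_eq_intros simp: power2_eq_square)
    have "((\<lambda>x. poly ?p (1/x) * exp (-(1/x))) has_real_derivative
        poly ?p (1/x) * (exp (-(1/x)) * (1 / x\<^sup>2)) + (poly (pderiv ?p) (1/x) * - (1 / x\<^sup>2)) * exp (-(1/x))) (at x)"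
      by (rule DERIV_mult'[OF DERIV_chain2[OF poly_DERIV inv] DERIV_chain2[OF DERIV_exp DERIV_minus[OF inv, simplified]]])
    also have "poly ?p (1/x) * (exp (-(1/x)) * (1 / x\<^sup>2)) + (poly (pderiv ?p) (1/x) * - (1 / x\<^sup>2)) * exp (-(1/x)) = flat (Suc k) x"
      using 2 by (simp add: flat_def power2_eq_square field_simps)
    finally show ?thesis
      by (rule has_field_derivative_transform_within_open[where S="{0<..}"]) (use 2 in \<open>auto simp: flat_def\<close>)
  next
    case 3
    have "((\<lambda>h. flat k h / h) \<longlongrightarrow> 0) (at 0)"
    proof (rule filterlim_split_at)
      show "((\<lambda>h. flat k h / h) \<longlongrightarrow> 0) (at_left 0)"
        by (rule tendsto_eventually) (auto simp: eventually_at_left_field flat_def intro!: exI[of _ "-1"])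
      \<comment> \<open>Division by h is multiplication by 1/h, which \<open>pCons 0\<close>
        performs on the polynomial; the exponential beats every polynomial in 1/h.\<close>
      have "((\<lambda>h. poly (pCons 0 (flat_poly k)) (inverse h) * exp (- inverse h)) \<longlongrightarrow> 0) (at_right (0::real))"
        by (rule filterlim_compose[OF poly_times_exp_minus_tendsto_0 filterlim_inverse_at_top_right])
      then show "((\<lambda>h. flat k h / h) \<longlongrightarrow> 0) (at_right 0)"
        by (rule Lim_transform_eventually)
           (auto simp: eventually_at_right_field flat_def field_simps intro!: exI[of _ 1])
    qed
    then show ?thesis using 3 by (simp add: has_field_derivative_iff flat_def)
  qed
qed

text \<open>A syntactic class closed under partial differentiation, so that smoothness of all orders
  follows from one induction. Rule \<open>comp\<close> admits every order k because the chain rule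
  turns order k into order k + 1.\<close>

inductive flat_generated :: "(real^2 \<Rightarrow> real) \<Rightarrow> bool" where
  affine: "flat_generated (\<lambda>x. v \<bullet> x + c)"
| add: "flat_generated f \<Longrightarrow> flat_generated g \<Longrightarrow> flat_generated (\<lambda>x. f x + g x)"
| mult: "flat_generated f \<Longrightarrow> flat_generated g \<Longrightarrow> flat_generated (\<lambda>x. f x * g x)"
| comp: "flat_generated f \<Longrightarrow> flat_generated (\<lambda>x. flat k (f x))"

lemma flat_generated_const: "flat_generated (\<lambda>x. c)"
  using flat_generated.affine[of 0 c] by simp

lemma flat_generated_partials:
  assumes "flat_generated f"
  shows "\<exists>g :: 2 \<Rightarrow> real^2 \<Rightarrow> real. (\<forall>i. flat_generated (g i)) \<and>
    (\<forall>x. (f has_derivative (\<lambda>h. \<Sum>i\<in>UNIV. h $ i * g i x)) (at x))"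
  using assms
proof induction
  case (affine v c)
  show ?case
  proof (intro exI[of _ "\<lambda>i _. v $ i"] conjI allI flat_generated_const)
    fix x
    have "((\<lambda>x. v \<bullet> x + c) has_derivative (\<lambda>h. v \<bullet> h)) (at x)"
      by (auto intro!: derivative_eq_intros)
    then show "((\<lambda>x. v \<bullet> x + c) has_derivative (\<lambda>h. \<Sum>i\<in>UNIV. h $ i * v $ i)) (at x)"
      by (simp add: inner_vec_def mult.commute)
  qed
next
  case (add f1 f2)
  then obtain g1 g2 :: "2 \<Rightarrow> real^2 \<Rightarrow> real" where g: "\<And>i. flat_generated (g1 i)" "\<And>i. flat_generated (g2 i)"
    and d: "\<And>x. (f1 has_derivative (\<lambda>h. \<Sum>i\<in>UNIV. h $ i * g1 i x)) (at x)"
     "\<And>x. (f2 has_derivative (\<lambda>h. \<Sum>i\<in>UNIV. h $ i * g2 i x)) (at x)" by blast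
  show ?case
  proof (intro exI[of _ "\<lambda>i x. g1 i x + g2 i x"] conjI allI flat_generated.add g)
    fix x
    show "((\<lambda>x. f1 x + f2 x) has_derivative (\<lambda>h. \<Sum>i\<in>UNIV. h $ i * (g1 i x + g2 i x))) (at x)"
      by (rule has_derivative_eq_rhs[OF has_derivative_add[OF d]]) (simp add: sum_2 algebra_simps)
  qed
next
  case (mult f1 f2)
  then obtain g1 g2 :: "2 \<Rightarrow> real^2 \<Rightarrow> real" where g: "\<And>i. flat_generated (g1 i)" "\<And>i. flat_generated (g2 i)"
    and d: "\<And>x. (f1 has_derivative (\<lambda>h. \<Sum>i\<in>UNIV. h $ i * g1 i x)) (at x)"
     "\<And>x. (f2 has_derivative (\<lambda>h. \<Sum>i\<in>UNIV. h $ i * g2 i x)) (at x)" by blast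
  show ?case
  proof (intro exI[of _ "\<lambda>i x. f1 x * g2 i x + g1 i x * f2 x"] conjI allI flat_generated.add flat_generated.mult g mult.hyps)
    fix x
    show "((\<lambda>x. f1 x * f2 x) has_derivative (\<lambda>h. \<Sum>i\<in>UNIV. h $ i * (f1 x * g2 i x + g1 i x * f2 x))) (at x)"
      by (rule has_derivative_eq_rhs[OF has_derivative_mult[OF d]]) (simp add: sum_2 algebra_simps)
  qed
next
  case (comp f k)
  then obtain g :: "2 \<Rightarrow> real^2 \<Rightarrow> real" where g: "\<And>i. flat_generated (g i)"
    and d: "\<And>x. (f has_derivative (\<lambda>h. \<Sum>i\<in>UNIV. h $ i * g i x)) (at x)" by blast
  show ?case
  proof (intro exI[of _ "\<lambda>i x. flat (Suc k) (f x) * g i x"] conjI allI flat_generated.mult flat_generated.comp g comp.hyps)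
    fix x
    have "((\<lambda>x. flat k (f x)) has_derivative (\<lambda>h. flat (Suc k) (f x) * (\<Sum>i\<in>UNIV. h $ i * g i x))) (at x)"
      using has_derivative_compose[OF d[of x] flat_has_derivative[of k "f x", unfolded has_field_derivative_def]] by simp
    then show "((\<lambda>x. flat k (f x)) has_derivative (\<lambda>h. \<Sum>i\<in>UNIV. h $ i * (flat (Suc k) (f x) * g i x))) (at x)"
      by (rule has_derivative_eq_rhs) (simp add: sum_2 algebra_simps)
  qed
qed

lemma flat_generated_Cc_inf:
  assumes f: "flat_generated f" and K: "compact K" "K \<subseteq> \<Omega>" "\<And>x. x \<notin> K \<Longrightarrow> f x = 0"
  shows "Cc_inf \<Omega> f"
proof -
  define P where "P f g \<longleftrightarrow> (\<forall>i. flat_generated (g i)) \<and> (\<forall>x. (f has_derivative (\<lambda>h. \<Sum>i\<in>UNIV. h $ i * g i x)) (at x))"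
    for f :: "real^2 \<Rightarrow> real" and g :: "2 \<Rightarrow> real^2 \<Rightarrow> real"
  have P: "P f (SOME g. P f g)" if "flat_generated f" for f
    using someI_ex[of "P f"] flat_generated_partials[OF that] by (simp add: P_def)
  \<comment> \<open>Partial derivatives are chosen recursively along the multi-index; every chosen
    function stays in the class, so the choice can always be continued.\<close>
  define F :: "2 list \<Rightarrow> real^2 \<Rightarrow> real" where "F = rec_list f (\<lambda>i _ h. (SOME g. P h g) i)"
  have F: "F [] = f" "\<And>i \<alpha>. F (i # \<alpha>) = (SOME g. P (F \<alpha>) g) i" by (simp_all add: F_def)
  have gen: "flat_generated (F \<alpha>)" for \<alpha>
  proof (induction \<alpha>)
    case (Cons i \<alpha>)
    then show ?case using P[OF Cons] unfolding F P_def by blast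
  qed (simp add: F f)
  have "(F \<alpha> has_derivative (\<lambda>h. \<Sum>i\<in>UNIV. h $ i * F (i # \<alpha>) x)) (at x)" for \<alpha> x
    using P[OF gen[of \<alpha>]] unfolding F P_def by blast
  moreover have cl: "closure {x. f x \<noteq> 0} \<subseteq> K"
    using K(3) by (intro closure_minimal compact_imp_closed K(1)) blast
  moreover have "compact (closure {x. f x \<noteq> 0})"
    using compact_Int_closed[OF K(1) closed_closure, of "{x. f x \<noteq> 0}"] cl by (simp add: Int_absorb1)
  ultimately show ?thesis unfolding Cc_inf_def using F(1) K(2) by blast
qed

text \<open>Composing \<open>flat\<close> with itself yields a smooth cutoff (1 for \<open>x \<le> 0\<close>, 0 for \<open>x \<ge> 1\<close>) that
  involves neither a quotient nor an antiderivative.\<close>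
definition cutoff :: "real \<Rightarrow> real" where
  "cutoff x = exp 1 * flat 0 (1 - exp 1 * flat 0 x)"

definition cutoff' :: "real \<Rightarrow> real" where
  "cutoff' x = - (exp 1 * exp 1 * flat 1 (1 - exp 1 * flat 0 x) * flat 1 x)"

lemma cutoff_deriv: "(cutoff has_real_derivative cutoff' x) (at x)"
  unfolding cutoff_def
  by (rule derivative_eq_intros DERIV_chain2[OF flat_has_derivative] flat_has_derivative refl)+
     (simp add: cutoff'_def)

lemma flat_generated_cutoff: "flat_generated f \<Longrightarrow> flat_generated (\<lambda>x. cutoff (f x))"
proof -
  assume f: "flat_generated f"
  have "flat_generated (\<lambda>x. exp 1 * flat 0 (1 + (- exp 1) * flat 0 (f x)))"
    by (intro flat_generated.intros flat_generated_const f)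
  then show ?thesis by (simp add: cutoff_def)
qed

lemma flat0_mono: "x \<le> y \<Longrightarrow> flat 0 x \<le> flat 0 y"
  by (auto simp: flat_def frac_le)

lemma cutoff_left: "x \<le> 0 \<Longrightarrow> cutoff x = 1" "x \<le> 0 \<Longrightarrow> cutoff' x = 0"
  by (auto simp: cutoff_def cutoff'_def flat_def exp_add[symmetric])

lemma cutoff_right:
  assumes "x \<ge> 1" shows "cutoff x = 0" "cutoff' x = 0"
proof -
  \<comment> \<open>The factor e normalizes exp(-1/x) at x = 1. From there on the argument of the
    outer \<open>flat\<close> is nonpositive, so the composition vanishes.\<close>
  have "exp 1 * flat 0 1 = (1::real)" by (simp add: flat_def exp_add[symmetric])
  then have "exp 1 * flat 0 x \<ge> 1" using mult_left_mono[OF flat0_mono[OF assms], of "exp 1"] by simp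
  then show "cutoff x = 0" "cutoff' x = 0" by (auto simp: cutoff_def cutoff'_def flat_def)
qed

lemma cutoff_range: "0 \<le> cutoff x" "cutoff x \<le> 1"
proof -
  have flat0: "flat 0 x \<ge> 0" for x by (simp add: flat_def)
  show "0 \<le> cutoff x" using flat0 by (simp add: cutoff_def)
  have "flat 0 (1 - exp 1 * flat 0 x) \<le> flat 0 1" by (intro flat0_mono) (use flat0 in simp)
  then have "cutoff x \<le> exp 1 * flat 0 1" unfolding cutoff_def by simp
  then show "cutoff x \<le> 1" by (simp add: flat_def exp_add[symmetric])
qed

lemma cutoff'_bounded: obtains K where "K \<ge> 1" "\<And>x. \<bar>cutoff' x\<bar> \<le> K"
proof -
  have flat_cont: "continuous_on UNIV (flat k)" for k
    by (intro continuous_at_imp_continuous_on ballI DERIV_isCont[OF flat_has_derivative])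
  have "continuous_on {0..1} cutoff'"
    unfolding cutoff'_def
    by (intro continuous_intros continuous_on_compose2[OF flat_cont]) auto
  then have "compact (cutoff' ` {0..1})" by (rule compact_continuous_image) simp
  then obtain B where B: "\<forall>y\<in>cutoff' ` {0..1}. norm y \<le> B"
    using compact_imp_bounded bounded_iff by metis
  show thesis
  proof
    fix x
    show "\<bar>cutoff' x\<bar> \<le> max B 1"
      using B cutoff_left(2)[of x] cutoff_right(2)[of x] by (cases "x \<in> {0..1}") (auto simp: le_max_iff_disj)
  qed simp
qed

text \<open>The derivative of s times \<open>cutoff s\<close>, which is a smooth version of min s 0:
  it equals s for s <= 0 and 0 for s >= 1.\<close>

definition clamp_deriv :: "real \<Rightarrow> real" where "clamp_deriv s = cutoff s + s * cutoff' s"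

text \<open>\<open>ramp \<kappa>\<close> is a smooth substitute for \<open>min (\<sigma> - 1) 0 - min (\<sigma> + 1) 0\<close>.\<close>
definition ramp :: "real \<Rightarrow> real \<Rightarrow> real" where
  "ramp \<kappa> \<sigma> = (\<sigma> - 1) * cutoff ((\<sigma> - 1) / \<kappa>) - (\<sigma> + 1) * cutoff ((\<sigma> + 1) / \<kappa>)"

definition ramp' :: "real \<Rightarrow> real \<Rightarrow> real" where
  "ramp' \<kappa> \<sigma> = clamp_deriv ((\<sigma> - 1) / \<kappa>) - clamp_deriv ((\<sigma> + 1) / \<kappa>)"

text \<open>A plateau function with two uses: with the large smoothing width 1/8 it makes the
  profile decay slowly across the strip, with a small width it ends the strip lengthwise. The
  half-length 1/8 plus a width of at most 1/8 keeps the support within [-1/4, 1/4].\<close>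

definition plate :: "real \<Rightarrow> real \<Rightarrow> real" where
  "plate \<kappa> t = cutoff ((t - 1/8) / \<kappa>) * cutoff ((- t - 1/8) / \<kappa>)"

definition plate' :: "real \<Rightarrow> real \<Rightarrow> real" where
  "plate' \<kappa> t = cutoff' ((t - 1/8) / \<kappa>) / \<kappa> * cutoff ((- t - 1/8) / \<kappa>)
     - cutoff ((t - 1/8) / \<kappa>) * cutoff' ((- t - 1/8) / \<kappa>) / \<kappa>"

lemma clamp_deriv_left: "s \<le> 0 \<Longrightarrow> clamp_deriv s = 1"
  and clamp_deriv_right: "s \<ge> 1 \<Longrightarrow> clamp_deriv s = 0"
  by (simp_all add: clamp_deriv_def cutoff_left cutoff_right)

lemma clamp_deriv_bound:
  assumes "\<And>x. \<bar>cutoff' x\<bar> \<le> K" "K \<ge> 1"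
  shows "\<bar>clamp_deriv s\<bar> \<le> 1 + K"
proof (cases "0 \<le> s \<and> s \<le> 1")
  case True
  have "\<bar>s * cutoff' s\<bar> \<le> 1 * K" unfolding abs_mult using True assms(1) by (intro mult_mono) auto
  then show ?thesis using cutoff_range[of s] unfolding clamp_deriv_def by linarith
next
  case False
  then show ?thesis using clamp_deriv_left[of s] clamp_deriv_right[of s] assms(2) by (cases "s \<le> 0") auto
qed

lemma ramp_deriv: "\<kappa> > 0 \<Longrightarrow> (ramp \<kappa> has_real_derivative ramp' \<kappa> \<sigma>) (at \<sigma>)"
  unfolding ramp_def
  by (rule derivative_eq_intros DERIV_chain2[OF cutoff_deriv] refl | simp)+
     (simp add: ramp'_def clamp_deriv_def field_simps)

text \<open>\<open>cutoff\<close> falls on [0, 1], so each kink is smoothed to its right only, with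
  layers [-1, \<kappa> - 1] and [1, 1 + \<kappa>]. This asymmetry reappears in the rectangles on
  which the strip gradient is nonzero or exact.\<close>

lemma ramp'_values:
  assumes "\<kappa> > 0"
  shows "\<sigma> \<le> -1 \<Longrightarrow> ramp' \<kappa> \<sigma> = 0" "\<sigma> \<ge> 1 + \<kappa> \<Longrightarrow> ramp' \<kappa> \<sigma> = 0"
    "\<kappa> - 1 \<le> \<sigma> \<Longrightarrow> \<sigma> \<le> 1 \<Longrightarrow> ramp' \<kappa> \<sigma> = 1"
  using assms by (simp_all add: ramp'_def clamp_deriv_left clamp_deriv_right divide_le_0_iff le_divide_eq)

lemma ramp_bound:
  assumes "0 < \<kappa>" "\<kappa> \<le> 1"
  shows "\<bar>ramp \<kappa> \<sigma>\<bar> \<le> 4"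
proof -
  consider "\<sigma> \<le> -1" | "\<sigma> \<ge> 2" | "-1 \<le> \<sigma>" "\<sigma> \<le> 2" by linarith
  then show ?thesis
  proof cases
    case 1
    then show ?thesis using assms by (simp add: ramp_def cutoff_left divide_le_0_iff)
  next
    case 2
    then show ?thesis using assms by (simp add: ramp_def cutoff_right le_divide_eq)
  next
    case 3
    have b: "\<bar>c * cutoff r\<bar> \<le> \<bar>c\<bar>" for c r
      unfolding abs_mult using cutoff_range[of r] by (simp add: mult_left_le)
    show ?thesis
    proof (cases "\<sigma> \<ge> 1")
      case True
      then have "cutoff ((\<sigma> + 1) / \<kappa>) = 0" using assms by (intro cutoff_right) (simp add: le_divide_eq)
      then show ?thesis using b[of "\<sigma> - 1" "(\<sigma> - 1) / \<kappa>"] 3 True unfolding ramp_def by simp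
    next
      case False
      then show ?thesis using b[of "\<sigma> - 1" "(\<sigma> - 1) / \<kappa>"] b[of "\<sigma> + 1" "(\<sigma> + 1) / \<kappa>"] 3 unfolding ramp_def by linarith
    qed
  qed
qed

lemma plate_deriv: "\<kappa> > 0 \<Longrightarrow> (plate \<kappa> has_real_derivative plate' \<kappa> t) (at t)"
  unfolding plate_def
  by (rule derivative_eq_intros DERIV_chain2[OF cutoff_deriv] refl | simp)+
     (simp add: plate'_def field_simps)

lemma plate_range: "0 \<le> plate \<kappa> t" "plate \<kappa> t \<le> 1"
  unfolding plate_def using cutoff_range by (auto intro: mult_le_one)

lemma plate_values:
  assumes "\<kappa> > 0"
  shows "\<bar>t\<bar> \<le> 1/8 \<Longrightarrow> plate \<kappa> t = 1" "\<bar>t\<bar> \<ge> 1/8 + \<kappa> \<Longrightarrow> plate \<kappa> t = 0"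
  using assms by (auto simp: plate_def cutoff_left cutoff_right divide_le_0_iff le_divide_eq abs_if split: if_splits)

lemma plate'_values: "\<kappa> > 0 \<Longrightarrow> \<bar>t\<bar> \<ge> 1/8 + \<kappa> \<Longrightarrow> plate' \<kappa> t = 0"
  by (auto simp: plate'_def cutoff_right le_divide_eq abs_if split: if_splits)

lemma flat_generated_cmult: "flat_generated f \<Longrightarrow> flat_generated (\<lambda>x. c * f x)"
  by (intro flat_generated.mult flat_generated_const)

lemma flat_generated_ramp:
  assumes "flat_generated f" shows "flat_generated (\<lambda>x. ramp \<kappa> (f x))"
proof -
  have "flat_generated (\<lambda>x. (f x + - 1) * cutoff (inverse \<kappa> * (f x + - 1)) + (- 1) * ((f x + 1) * cutoff (inverse \<kappa> * (f x + 1))))"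
    by (intro flat_generated.add flat_generated.mult flat_generated_const flat_generated_cutoff assms)
  then show ?thesis by (simp add: ramp_def divide_inverse mult.commute)
qed

lemma flat_generated_plate:
  assumes "flat_generated f" shows "flat_generated (\<lambda>x. plate \<kappa> (f x))"
proof -
  have "flat_generated (\<lambda>x. cutoff (inverse \<kappa> * (f x + - (1/8))) * cutoff (inverse \<kappa> * ((-1) * f x + - (1/8))))"
    by (intro flat_generated.add flat_generated.mult flat_generated_const flat_generated_cutoff assms)
  moreover have "plate \<kappa> t = cutoff (inverse \<kappa> * (t + - (1/8))) * cutoff (inverse \<kappa> * ((-1) * t + - (1/8)))" for t
    by (simp add: plate_def divide_inverse_commute[of _ \<kappa>])
  ultimately show ?thesis by simp
qed

lemma One_nth: "(One::real^'n) $ i = 1"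
  using inner_sum_left_Basis[of "axis i 1 :: real^'n" "\<lambda>_. 1"] by (simp add: inner_axis axis_in_Basis_iff del: sum_component inner_sum_left_Basis)

lemma sqnorm_le_integral:
  assumes "open \<Omega>" "integrable lebesgue h" "\<And>x. (norm (f x))\<^sup>2 \<le> h x"
  shows "sqnorm (lebesgue_on \<Omega>) f \<le> (\<integral>x. h x \<partial>lebesgue)"
proof -
  have h0: "0 \<le> h x" for x using assms(3)[of x] zero_le_power2 order_trans by blast
  have "sqnorm (lebesgue_on \<Omega>) f = (\<integral>x. indicat_real \<Omega> x *\<^sub>R (norm (f x))\<^sup>2 \<partial>lebesgue)"
    unfolding sqnorm_def using assms(1) by (intro integral_restrict_space) auto
  also have "\<dots> \<le> (\<integral>x. h x \<partial>lebesgue)"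
    by (rule integral_mono'[OF assms(2)]) (use assms(3) h0 in \<open>auto simp: indicator_def\<close>)
  finally show ?thesis .
qed

lemma plate'_bound:
  assumes "\<And>x. \<bar>cutoff' x\<bar> \<le> K" "\<kappa> > 0"
  shows "\<bar>plate' \<kappa> t\<bar> \<le> 2 * K / \<kappa>"
proof -
  have b: "\<bar>cutoff' r * cutoff s\<bar> \<le> K" for r s
    unfolding abs_mult using cutoff_range[of s] assms(1)[of r]
      mult_mono[of "\<bar>cutoff' r\<bar>" K "\<bar>cutoff s\<bar>" 1] by simp
  have "plate' \<kappa> t = (cutoff' ((t - 1/8) / \<kappa>) * cutoff ((- t - 1/8) / \<kappa>) - cutoff' ((- t - 1/8) / \<kappa>) * cutoff ((t - 1/8) / \<kappa>)) / \<kappa>"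
    using assms by (simp add: plate'_def field_simps)
  also have "\<bar>\<dots>\<bar> \<le> (2 * K) / \<kappa>"
    using b[of "(t - 1/8) / \<kappa>" "(- t - 1/8) / \<kappa>"] b[of "(- t - 1/8) / \<kappa>" "(t - 1/8) / \<kappa>"] assms(2)
    by (simp add: abs_divide divide_right_mono)
  finally show ?thesis .
qed

section \<open>Rotated coordinates and areas\<close>

lemma rot_basis:
  assumes "norm n = 1"
  shows "n \<bullet> n = 1" "rot n \<bullet> rot n = 1" "n \<bullet> rot n = 0" "rot n \<bullet> n = 0"
    "(v \<bullet> n) *\<^sub>R n + (v \<bullet> rot n) *\<^sub>R rot n = v"
proof -
  show n: "n \<bullet> n = 1" using assms by (simp add: norm_eq_1)
  then show "rot n \<bullet> rot n = 1" by (simp add: rot_def inner_real2)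
  show "n \<bullet> rot n = 0" "rot n \<bullet> n = 0" by (simp_all add: rot_def inner_real2)
  have "n$1 * n$1 + n$2 * n$2 = 1" using n by (simp add: inner_real2)
  then have "n$1 * n$1 = 1 - n$2 * n$2" by simp
  then show "(v \<bullet> n) *\<^sub>R n + (v \<bullet> rot n) *\<^sub>R rot n = v"
    by (simp add: vec_eq_iff forall_2 rot_def inner_real2) algebra
qed

text \<open>Up to a translation the map is an orthogonal matrix times R, with determinant
  \<open>R\<^sup>2 * (n \<bullet> n)\<close>.\<close>

lemma measure_rotated_image:
  assumes n: "norm n = 1" and R: "R > 0" and A: "bounded A" "A \<in> sets lebesgue"
  shows "(\<lambda>z::real^2. c + R *\<^sub>R (z$1 *\<^sub>R n + z$2 *\<^sub>R rot n)) ` A \<in> lmeasurable"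
    "measure lebesgue ((\<lambda>z::real^2. c + R *\<^sub>R (z$1 *\<^sub>R n + z$2 *\<^sub>R rot n)) ` A) = R\<^sup>2 * measure lebesgue A"
proof -
  let ?L = "\<lambda>z::real^2. R *\<^sub>R (z$1 *\<^sub>R n + z$2 *\<^sub>R rot n)"
  have lin: "linear ?L"
    by (rule linearI) (simp_all add: algebra_simps)
  have nn: "n$1 * n$1 + n$2 * n$2 = 1" using rot_basis(1)[OF n] by (simp add: inner_real2)
  have "det (matrix ?L) = R\<^sup>2 * (n$1 * n$1 + n$2 * n$2)"
    by (simp add: det_2 matrix_def rot_def axis_def power2_eq_square algebra_simps)
  then have det: "\<bar>det (matrix ?L)\<bar> = R\<^sup>2" using nn by simp
  have im: "(\<lambda>z. c + ?L z) ` A = (+) c ` ?L ` A" by (simp add: image_image)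
  have "A \<in> lmeasurable" using A by (rule bounded_set_imp_lmeasurable)
  then have "?L ` A \<in> lmeasurable" by (rule measurable_linear_image[OF lin])
  then show "(\<lambda>z. c + ?L z) ` A \<in> lmeasurable" unfolding im by (rule measurable_translation)
  have "measure lebesgue ((\<lambda>z. c + ?L z) ` A) = measure lebesgue (?L ` A)"
    unfolding im by (rule measure_translation)
  also have "\<dots> = R\<^sup>2 * measure lebesgue A"
    using measure_lebesgue_linear_transformation[OF A lin] det by simp
  finally show "measure lebesgue ((\<lambda>z. c + ?L z) ` A) = R\<^sup>2 * measure lebesgue A" .
qed

lemma measure_cbox_real2:
  fixes a b :: "real^2"
  assumes "a$1 \<le> b$1" "a$2 \<le> b$2"
  shows "measure lebesgue (cbox a b) = (b$1 - a$1) * (b$2 - a$2)"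
proof -
  have "cbox a b \<noteq> {}" using assms by (simp add: interval_ne_empty_cart forall_2)
  then show ?thesis using content_cbox_cart[of a b] by (simp add: UNIV_2)
qed


text \<open>Inside the strip the gradient is \<open>n\<close>; the profile decays outside over a length that is long compared with the
  width of the strip, which makes the energy outside negligible relative to the area of the strip.\<close>
lemma thin_strip_profile:
  fixes n :: "real^2"
  assumes n: "norm n = 1" and \<epsilon>: "\<epsilon> > 0"
  obtains \<theta> where "\<theta> > 0"
    "\<And>\<Omega> x0 R. open \<Omega> \<Longrightarrow> R > 0 \<Longrightarrow> cbox x0 (x0 + R *\<^sub>R One) \<subseteq> \<Omega> \<Longrightarrow>
      \<exists>S E. Cc_inf \<Omega> S \<and> E \<in> sets lebesgue \<and> E \<subseteq> cbox x0 (x0 + R *\<^sub>R One) \<and> measure lebesgue E = \<theta> * R\<^sup>2 \<and>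
        sqnorm (lebesgue_on \<Omega>) (\<lambda>x. grad S x - indicat_real E x *\<^sub>R n) \<le> \<epsilon> * measure lebesgue E \<and>
        sqnorm (lebesgue_on \<Omega>) S \<le> 16 * R ^ 4"
proof -
  obtain K where K1: "K \<ge> 1" and K: "\<And>x. \<bar>cutoff' x\<bar> \<le> K" by (rule cutoff'_bounded) blast
  \<comment> \<open>Relative width of the smoothing layers. Their area is at most 5 \<rho> \<kappa>
    R^2 and the gradient error there at most 3 + 2K; doubled by the squared triangle inequality this
    is to cost no more than (\<epsilon>/4) \<rho> R^2, whence 40. The bound 1/8 keeps the supports
    inside the square.\<close>
  define \<kappa> where "\<kappa> = min (1/8) (\<epsilon> / (40 * (3 + 2 * K)\<^sup>2))"
  have den: "40 * (3 + 2 * K)\<^sup>2 > 0" using K1 by simp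
  have \<kappa>: "0 < \<kappa>" "\<kappa> \<le> 1/8" using \<epsilon> den by (auto simp: \<kappa>_def)
  have \<kappa>\<epsilon>: "10 * (3 + 2 * K)\<^sup>2 * \<kappa> \<le> \<epsilon> / 4"
  proof -
    have "\<kappa> \<le> \<epsilon> / (40 * (3 + 2 * K)\<^sup>2)" by (simp add: \<kappa>_def)
    then have "\<kappa> * (40 * (3 + 2 * K)\<^sup>2) \<le> \<epsilon>" using den by (simp add: pos_le_divide_eq)
    then show ?thesis by (simp add: mult_ac)
  qed
  \<comment> \<open>\<rho> Q bounds the gradient of the decay part: two terms, each at most \<rho>
    times 4 (the ramp) times 2K/\<kappa> (a plate derivative).\<close>
  define Q where "Q = 16 * K / \<kappa>"
  have Q0: "Q > 0" using K1 \<kappa> by (simp add: Q_def)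
  \<comment> \<open>Half-width of the strip relative to the square, chosen after \<kappa> because Q
    depends on \<kappa>. The decay energy is quadratic in \<rho> and the strip area linear, so a
    small \<rho> suffices; 1/16 keeps the strip where the wide plate is 1.\<close>
  define \<rho> where "\<rho> = min (1/16) (\<epsilon> / (8 * Q\<^sup>2))"
  have \<rho>: "0 < \<rho>" "\<rho> \<le> 1/16" using \<epsilon> Q0 by (auto simp: \<rho>_def)
  have \<rho>\<epsilon>: "2 * \<rho> * Q\<^sup>2 \<le> \<epsilon> / 4"
  proof -
    have "\<rho> \<le> \<epsilon> / (8 * Q\<^sup>2)" by (simp add: \<rho>_def)
    then have "\<rho> * (8 * Q\<^sup>2) \<le> \<epsilon>" using Q0 by (simp add: pos_le_divide_eq)
    then show ?thesis by (simp add: mult_ac)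
  qed
  \<comment> \<open>Relative areas of two rectangles: \<theta> for the one outside which the main
    part of the gradient vanishes, \<theta>' below for the one on which it is exactly
    \<open>n\<close>.\<close>
  define \<theta> where "\<theta> = (\<rho> * (2 + \<kappa>)) * (1/4 + 2 * \<kappa>)"
  have \<theta>: "\<theta> \<ge> \<rho> / 2" unfolding \<theta>_def using \<rho> \<kappa> mult_mono[of "\<rho> * 2" "\<rho> * (2 + \<kappa>)" "1/4" "1/4 + 2 * \<kappa>"] by simp
  define \<theta>' where "\<theta>' = (\<rho> * (2 - \<kappa>)) * (1/4)"
  have \<theta>diff: "\<theta> - \<theta>' \<le> 5 * \<rho> * \<kappa>"
  proof -
    have "\<theta> - \<theta>' = \<rho> * (9/2 * \<kappa> + 2 * (\<kappa> * \<kappa>))" unfolding \<theta>_def \<theta>'_def by (simp add: algebra_simps)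
    also have "\<dots> \<le> \<rho> * (5 * \<kappa>)"
    proof (rule mult_left_mono)
      show "9/2 * \<kappa> + 2 * (\<kappa> * \<kappa>) \<le> 5 * \<kappa>"
        using mult_right_mono[OF \<kappa>(2) less_imp_le[OF \<kappa>(1)]] \<kappa>(1) by linarith
    qed (use \<rho> in simp)
    finally show ?thesis by simp
  qed
  show thesis
  proof (rule that)
    show "\<theta> > 0" using \<theta> \<rho> by linarith
    fix \<Omega> :: "(real^2) set" and x0 :: "real^2" and R :: real
    assume \<Omega>: "open \<Omega>" and R: "R > 0" and box: "cbox x0 (x0 + R *\<^sub>R One) \<subseteq> \<Omega>"
    let ?Q = "cbox x0 (x0 + R *\<^sub>R One)"
    \<comment> \<open>The strip is centred in the square, although the square has \<open>x0\<close>
      as a corner. Then \<open>s\<close> and \<open>t\<close> are coordinates along \<open>n\<close>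
      and \<open>rot n\<close> in units of R.\<close>
    define c where "c = x0 + (R/2) *\<^sub>R (One::real^2)"
    define s where "s x = (n /\<^sub>R R) \<bullet> x + - ((n /\<^sub>R R) \<bullet> c)" for x
    define t where "t x = (rot n /\<^sub>R R) \<bullet> x + - ((rot n /\<^sub>R R) \<bullet> c)" for x
    define \<Phi> where "\<Phi> z = c + R *\<^sub>R (z$1 *\<^sub>R n + z$2 *\<^sub>R rot n)" for z :: "real^2"
    note rb = rot_basis[OF n]
    have s\<Phi>: "s (\<Phi> z) = z$1" and t\<Phi>: "t (\<Phi> z) = z$2" for z
      using R by (simp_all add: s_def t_def \<Phi>_def inner_add_right rb field_simps)
    have st: "s x = (x - c) \<bullet> n / R" "t x = (x - c) \<bullet> rot n / R" for x
      by (simp_all add: s_def t_def inner_diff_left inner_commute divide_inverse algebra_simps)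
    have \<Phi>st: "\<Phi> (vector [s x, t x]) = x" for x
      using rb(5)[of "x - c"] R by (simp add: \<Phi>_def st scaleR_add_right)
    have preimage: "{x. a \<le> s x \<and> s x \<le> b \<and> a' \<le> t x \<and> t x \<le> b'} = \<Phi> ` cbox (vector [a, a']) (vector [b, b'])" for a b a' b'
    proof (intro set_eqI iffI)
      fix x assume "x \<in> {x. a \<le> s x \<and> s x \<le> b \<and> a' \<le> t x \<and> t x \<le> b'}"
      then have "vector [s x, t x] \<in> cbox (vector [a, a'] :: real^2) (vector [b, b'])"
        by (simp add: mem_box_cart forall_2)
      then show "x \<in> \<Phi> ` cbox (vector [a, a']) (vector [b, b'])" using \<Phi>st[of x] by (intro image_eqI[of x \<Phi>]) simp_all
    next
      fix x assume "x \<in> \<Phi> ` cbox (vector [a, a']) (vector [b, b'])"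
      then obtain z where "x = \<Phi> z" "z \<in> cbox (vector [a, a']) (vector [b, b'])" by (rule imageE)
      then show "x \<in> {x. a \<le> s x \<and> s x \<le> b \<and> a' \<le> t x \<and> t x \<le> b'}"
        by (simp add: s\<Phi> t\<Phi> mem_box_cart forall_2)
    qed
    have area: "{x. a \<le> s x \<and> s x \<le> b \<and> a' \<le> t x \<and> t x \<le> b'} \<in> lmeasurable"
      "measure lebesgue {x. a \<le> s x \<and> s x \<le> b \<and> a' \<le> t x \<and> t x \<le> b'} = R\<^sup>2 * ((b - a) * (b' - a'))"
      if "a \<le> b" "a' \<le> b'" for a b a' b'
      unfolding preimage \<Phi>_def
      using measure_rotated_image[OF n R bounded_cbox[of "vector [a, a']" "vector [b, b']"], of c]
        measure_cbox_real2[of "vector [a, a']" "vector [b, b']"] that by auto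
    define E where "E = {x. - \<rho> \<le> s x \<and> s x \<le> (1 + \<kappa>) * \<rho> \<and> - (1/8 + \<kappa>) \<le> t x \<and> t x \<le> 1/8 + \<kappa>}"
    define E' where "E' = {x. (\<kappa> - 1) * \<rho> \<le> s x \<and> s x \<le> \<rho> \<and> - (1/8) \<le> t x \<and> t x \<le> 1/8}"
    \<comment> \<open>Contains the support. Its points have |s| + |t| <= 1/2, hence lie within R/2
      of the centre, so D fits into the square whatever the direction \<open>n\<close>.\<close>
    define D where "D = {x. - (1/4) \<le> s x \<and> s x \<le> 1/4 \<and> - (1/4) \<le> t x \<and> t x \<le> 1/4}"
    have E_meas: "E \<in> lmeasurable" "measure lebesgue E = \<theta> * R\<^sup>2"
    proof -
      have *: "- \<rho> \<le> (1 + \<kappa>) * \<rho>" "- (1/8 + \<kappa>) \<le> 1/8 + \<kappa>" using \<rho> \<kappa> mult_pos_pos[of "1 + \<kappa>" \<rho>] by linarith+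
      show "E \<in> lmeasurable" "measure lebesgue E = \<theta> * R\<^sup>2"
        unfolding E_def area(2)[OF *] by (rule area(1)[OF *]) (simp add: \<theta>_def algebra_simps)
    qed
    have E'_meas: "E' \<in> lmeasurable" "measure lebesgue E' = \<theta>' * R\<^sup>2"
    proof -
      have *: "(\<kappa> - 1) * \<rho> \<le> \<rho>" "- (1/8) \<le> (1/8::real)" using \<rho> \<kappa> mult_right_mono[of "\<kappa> - 1" 1 \<rho>] by simp_all
      show "E' \<in> lmeasurable" "measure lebesgue E' = \<theta>' * R\<^sup>2"
        unfolding E'_def area(2)[OF *] by (rule area(1)[OF *]) (simp add: \<theta>'_def algebra_simps)
    qed
    have \<rho>\<kappa>: "(1 + \<kappa>) * \<rho> \<le> 1/8" using mult_mono[of "1 + \<kappa>" 2 \<rho> "1/16"] \<rho> \<kappa> by simp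
    have E'E: "E' \<subseteq> E"
    proof
      fix x assume x: "x \<in> E'"
      have "- \<rho> \<le> (\<kappa> - 1) * \<rho>" "\<rho> \<le> (1 + \<kappa>) * \<rho>" using \<rho> \<kappa> by (simp_all add: algebra_simps)
      then show "x \<in> E" using x \<kappa> unfolding E'_def E_def by auto
    qed
    have ED: "E \<subseteq> D" unfolding E_def D_def using \<rho> \<rho>\<kappa> \<kappa> by auto
    have DQ: "D \<subseteq> ?Q"
    proof
      fix x assume x: "x \<in> D"
      have "x - c = R *\<^sub>R (s x *\<^sub>R n + t x *\<^sub>R rot n)" using \<Phi>st[of x] by (simp add: \<Phi>_def algebra_simps)
      moreover have "norm (s x *\<^sub>R n + t x *\<^sub>R rot n) \<le> 1/4 + 1/4"
        by (rule norm_triangle_le) (use x n in \<open>auto simp: D_def norm_rot\<close>)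
      ultimately have "norm (x - c) \<le> R * (1/2)" using R by simp
      then have comp: "\<bar>(x - c) $ i\<bar> \<le> R / 2" for i
        using component_le_norm_cart[of "x - c" i] by (auto intro: order_trans)
      have ci: "c $ i = x0 $ i + R / 2" for i
        unfolding c_def by (simp add: One_nth del: sum_component)
      have "x0 $ i \<le> x $ i" "x $ i \<le> x0 $ i + R" for i
        using comp[of i] ci[of i] unfolding vector_minus_component by linarith+
      then show "x \<in> ?Q" by (simp add: mem_box_cart One_nth del: sum_component)
    qed
    \<comment> \<open>The amplitude R \<rho> compensates the scaling s/\<rho> with s in units of R,
      so that slope 1 of the ramp becomes gradient \<open>n\<close>.\<close>
    define S where "S x = (R * \<rho>) * (ramp \<kappa> (s x / \<rho>) * (plate (1/8) (s x) * plate \<kappa> (t x)))" for x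
    define G where "G x = (ramp' \<kappa> (s x / \<rho>) * plate (1/8) (s x) * plate \<kappa> (t x) + \<rho> * ramp \<kappa> (s x / \<rho>) * plate' (1/8) (s x) * plate \<kappa> (t x)) *\<^sub>R n
        + (\<rho> * ramp \<kappa> (s x / \<rho>) * plate (1/8) (s x) * plate' \<kappa> (t x)) *\<^sub>R rot n" for x
    have outside: "S x = 0 \<and> G x = 0" if "x \<notin> D" for x
    proof -
      have "\<bar>s x\<bar> \<ge> 1/8 + 1/8 \<or> \<bar>t x\<bar> \<ge> 1/8 + \<kappa>" using that \<kappa> unfolding D_def by auto
      then show ?thesis
      proof
        assume "\<bar>s x\<bar> \<ge> 1/8 + 1/8"
        then have "plate (1/8) (s x) = 0" "plate' (1/8) (s x) = 0" by (auto intro!: plate_values(2) plate'_values)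
        then show ?thesis by (simp add: S_def G_def)
      next
        assume "\<bar>t x\<bar> \<ge> 1/8 + \<kappa>"
        then have "plate \<kappa> (t x) = 0" "plate' \<kappa> (t x) = 0" using \<kappa> by (auto intro!: plate_values(2) plate'_values)
        then show ?thesis by (simp add: S_def G_def)
      qed
    qed
    have gst: "flat_generated s" "flat_generated t"
      unfolding s_def t_def by (rule flat_generated.affine)+
    have "flat_generated (\<lambda>x. inverse \<rho> * s x)" by (rule flat_generated_cmult[OF gst(1)])
    then have "flat_generated (\<lambda>x. ramp \<kappa> (s x / \<rho>))"
      using flat_generated_ramp[of "\<lambda>x. inverse \<rho> * s x" \<kappa>] by (simp add: divide_inverse mult.commute)
    then have gS: "flat_generated S"
      unfolding S_def by (intro flat_generated.mult flat_generated_const flat_generated_plate gst)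
    have der: "(S has_derivative (\<lambda>h. h \<bullet> G x)) (at x)" for x
    proof -
      have ds: "(s has_derivative (\<lambda>h. (h \<bullet> n) / R)) (at x)" and dt: "(t has_derivative (\<lambda>h. (h \<bullet> rot n) / R)) (at x)"
        unfolding s_def t_def
        by (auto intro!: derivative_eq_intros simp: inner_commute divide_inverse mult.commute)
      have ds': "((\<lambda>x. s x / \<rho>) has_derivative (\<lambda>h. (h \<bullet> n) / R / \<rho>)) (at x)"
        by (rule bounded_linear.has_derivative[OF bounded_linear_divide ds])
      have 1: "((\<lambda>x. ramp \<kappa> (s x / \<rho>)) has_derivative (\<lambda>h. ramp' \<kappa> (s x / \<rho>) * ((h \<bullet> n) / R / \<rho>))) (at x)"
        by (rule has_derivative_compose[OF ds' ramp_deriv[OF \<kappa>(1), unfolded has_field_derivative_def]])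
      have 2: "((\<lambda>x. plate (1/8) (s x)) has_derivative (\<lambda>h. plate' (1/8) (s x) * ((h \<bullet> n) / R))) (at x)"
        by (rule has_derivative_compose[OF ds plate_deriv[unfolded has_field_derivative_def]]) simp
      have 3: "((\<lambda>x. plate \<kappa> (t x)) has_derivative (\<lambda>h. plate' \<kappa> (t x) * ((h \<bullet> rot n) / R))) (at x)"
        by (rule has_derivative_compose[OF dt plate_deriv[OF \<kappa>(1), unfolded has_field_derivative_def]])
      show ?thesis unfolding S_def
      proof (rule has_derivative_eq_rhs[OF has_derivative_mult_right[OF has_derivative_mult[OF 1 has_derivative_mult[OF 2 3]]]], rule ext)
        fix h
        have "(R * \<rho>) * (T * (p * (q' * (b / R)) + (p' * (a / R)) * q) + (T' * (a / R / \<rho>)) * (p * q)) =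
           (T' * p * q + \<rho> * T * p' * q) * a + (\<rho> * T * p * q') * b" for T T' p p' q q' a b
          using R \<rho> by (simp add: algebra_simps)
        then show "R * \<rho> * (ramp \<kappa> (s x / \<rho>) * (plate (1/8) (s x) * (plate' \<kappa> (t x) * (h \<bullet> rot n / R)) +
            plate' (1/8) (s x) * (h \<bullet> n / R) * plate \<kappa> (t x)) +
            ramp' \<kappa> (s x / \<rho>) * (h \<bullet> n / R / \<rho>) * (plate (1/8) (s x) * plate \<kappa> (t x))) = h \<bullet> G x"
          by (simp only: G_def inner_add_right inner_scaleR_right)
      qed
    qed
    have grad: "grad S = G" by (intro ext grad_eqI der)
    have Cc: "Cc_inf \<Omega> S"
    proof (rule flat_generated_Cc_inf[OF gS, of "closure D"])
      have "bounded D" using DQ bounded_cbox bounded_subset by blast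
      then show "compact (closure D)" by (simp add: compact_closure)
      show "closure D \<subseteq> \<Omega>" using closure_minimal[OF DQ closed_cbox] box by blast
      show "S x = 0" if "x \<notin> closure D" for x
      proof -
        have "x \<notin> D" using that closure_subset[of D] by blast
        then show ?thesis using outside[of x] by simp
      qed
    qed
    \<comment> \<open>The error is split as u + v. In u the ramp is differentiated: this part is
      wrong only in the smoothing layers. In v a plate is differentiated: this part is spread over
      the support but carries the factor \<rho>.\<close>
    have err: "(norm (G x - indicat_real E x *\<^sub>R n))\<^sup>2 \<le> 2 * (3 + 2 * K)\<^sup>2 * indicat_real (E - E') x + 2 * (\<rho> * Q)\<^sup>2 * indicat_real ?Q x" for x
    proof -
      let ?T' = "ramp' \<kappa> (s x / \<rho>)" and ?T = "ramp \<kappa> (s x / \<rho>)" and ?p = "plate (1/8) (s x)" and ?q = "plate \<kappa> (t x)"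
        and ?p' = "plate' (1/8) (s x)" and ?q' = "plate' \<kappa> (t x)"
      define u where "u = (?T' * ?p * ?q - indicat_real E x) *\<^sub>R n"
      define v where "v = (\<rho> * ?T * ?p' * ?q) *\<^sub>R n + (\<rho> * ?T * ?p * ?q') *\<^sub>R rot n"
      have uv: "G x - indicat_real E x *\<^sub>R n = u + v" by (simp add: G_def u_def v_def algebra_simps)
      have u: "norm u \<le> (3 + 2 * K) * indicat_real (E - E') x"
      proof -
        consider "x \<in> E'" | "x \<in> E - E'" | "x \<notin> E" using E'E by blast
        then show ?thesis
        proof cases
          case 1
          then have "?T' = 1" using \<rho> by (intro ramp'_values(3) \<kappa>(1)) (auto simp: E'_def field_simps)
          moreover have "?p = 1"
          proof (rule plate_values(1))
            have "- \<rho> \<le> (\<kappa> - 1) * \<rho>" using \<rho> \<kappa> by (simp add: algebra_simps)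
            then have "- \<rho> \<le> s x" "s x \<le> \<rho>" using 1 by (auto simp: E'_def)
            then show "\<bar>s x\<bar> \<le> 1/8" using \<rho> by (auto simp: abs_le_iff)
          qed simp
          moreover have "?q = 1" using 1 by (intro plate_values(1) \<kappa>(1)) (auto simp: E'_def abs_le_iff)
          ultimately show ?thesis using 1 E'E by (auto simp: u_def)
        next
          case 2
          \<comment> \<open>Two smoothed kinks contribute at most 1 + K each; together with the
            indicator of the strip this makes 3 + 2K.\<close>
          have "\<bar>?T'\<bar> \<le> 2 * (1 + K)"
            using clamp_deriv_bound[OF K K1, of "(s x / \<rho> - 1) / \<kappa>"] clamp_deriv_bound[OF K K1, of "(s x / \<rho> + 1) / \<kappa>"]
              abs_triangle_ineq4[of "clamp_deriv ((s x / \<rho> - 1) / \<kappa>)" "clamp_deriv ((s x / \<rho> + 1) / \<kappa>)"]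
            unfolding ramp'_def by argo
          then have "\<bar>?T' * (?p * ?q)\<bar> \<le> 2 * (1 + K) * 1"
            unfolding abs_mult[of ?T'] using plate_range[of "1/8" "s x"] plate_range[of \<kappa> "t x"] K1
            by (intro mult_mono) (auto intro: mult_le_one)
          then show ?thesis using 2 n by (simp add: u_def mult.assoc)
        next
          case 3
          have zero: "?T' * ?p * ?q = 0"
          proof (cases "s x < - \<rho> \<or> s x > (1 + \<kappa>) * \<rho>")
            case True
            then have "?T' = 0"
            proof
              assume "s x < - \<rho>" then show ?thesis using \<rho> by (intro ramp'_values(1) \<kappa>(1)) (simp add: field_simps)
            next
              assume "s x > (1 + \<kappa>) * \<rho>" then show ?thesis using \<rho> by (intro ramp'_values(2) \<kappa>(1)) (simp add: field_simps)
            qed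
            then show ?thesis by simp
          next
            case False
            then have "\<bar>t x\<bar> \<ge> 1/8 + \<kappa>" using 3 unfolding E_def by auto
            then show ?thesis using plate_values(2)[OF \<kappa>(1)] by simp
          qed
          show ?thesis unfolding u_def zero using 3 E'E by simp
        qed
      qed
      have v: "norm v \<le> \<rho> * Q" if "x \<in> ?Q"
      proof -
        have T: "\<bar>?T\<bar> \<le> 4" using \<kappa> by (intro ramp_bound) auto
        have pq: "\<bar>?p\<bar> \<le> 1" "\<bar>?q\<bar> \<le> 1" using plate_range[of "1/8" "s x"] plate_range[of \<kappa> "t x"] by auto
        have p': "\<bar>?p'\<bar> \<le> 2 * K / \<kappa>"
        proof -
          have "\<bar>?p'\<bar> \<le> 2 * K / (1/8)" by (rule plate'_bound[OF K]) simp
          also have "\<dots> \<le> 2 * K / \<kappa>" using \<kappa> K1 by (intro divide_left_mono) auto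
          finally show ?thesis .
        qed
        have q': "\<bar>?q'\<bar> \<le> 2 * K / \<kappa>" by (rule plate'_bound[OF K \<kappa>(1)])
        have Kk: "2 * K / \<kappa> \<ge> 0" "8 * (\<rho> * K) / \<kappa> \<ge> 0" using K1 \<kappa> \<rho> by simp_all
        have a: "\<bar>\<rho> * ?T * ?p' * ?q\<bar> \<le> \<rho> * 4 * (2 * K / \<kappa>) * 1" 
          unfolding abs_mult using T p' pq \<rho> Kk by (intro mult_mono) auto
        have b: "\<bar>\<rho> * ?T * ?p * ?q'\<bar> \<le> \<rho> * 4 * 1 * (2 * K / \<kappa>)"
          unfolding abs_mult using T q' pq \<rho> Kk by (intro mult_mono) auto
        have "norm v \<le> \<bar>\<rho> * ?T * ?p' * ?q\<bar> + \<bar>\<rho> * ?T * ?p * ?q'\<bar>"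
          unfolding v_def by (rule norm_triangle_le) (use n in \<open>simp add: norm_rot\<close>)
        also have "\<dots> \<le> \<rho> * 4 * (2 * K / \<kappa>) * 1 + \<rho> * 4 * 1 * (2 * K / \<kappa>)" using a b by (rule add_mono)
        also have "\<dots> = \<rho> * Q" by (simp add: Q_def)
        finally show ?thesis .
      qed
      show ?thesis
      proof (cases "x \<in> ?Q")
        case True
        have "(norm u)\<^sup>2 \<le> ((3 + 2 * K) * indicat_real (E - E') x)\<^sup>2" using u by (rule power_mono) simp
        also have "\<dots> = (3 + 2 * K)\<^sup>2 * indicat_real (E - E') x" by (simp add: power_mult_distrib indicator_def)
        finally have "(norm u)\<^sup>2 \<le> (3 + 2 * K)\<^sup>2 * indicat_real (E - E') x" .
        moreover have "(norm v)\<^sup>2 \<le> (\<rho> * Q)\<^sup>2" using v[OF True] by (rule power_mono) simp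
        moreover have "(norm (u + v))\<^sup>2 \<le> 2 * (norm u)\<^sup>2 + 2 * (norm v)\<^sup>2" by (rule norm_add_sq_le)
        ultimately show ?thesis unfolding uv using True by simp
      next
        case False
        then have "x \<notin> D" using DQ by blast
        then show ?thesis using outside[of x] ED by (auto simp: indicator_def)
      qed
    qed
    have Q_meas: "?Q \<in> lmeasurable" "measure lebesgue ?Q = R\<^sup>2"
      using R measure_cbox_real2[of x0 "x0 + R *\<^sub>R One"] by (simp_all add: One_nth power2_eq_square del: sum_component)
    have "sqnorm (lebesgue_on \<Omega>) (\<lambda>x. grad S x - indicat_real E x *\<^sub>R n) \<le> \<epsilon> * measure lebesgue E"
    proof -
      have dm: "E - E' \<in> lmeasurable" "measure lebesgue (E - E') = (\<theta> - \<theta>') * R\<^sup>2"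
        using measurable_measure_Diff[OF E_meas(1) fmeasurableD[OF E'_meas(1)] E'E] E_meas E'_meas
        by (auto simp: algebra_simps)
      have "sqnorm (lebesgue_on \<Omega>) (\<lambda>x. grad S x - indicat_real E x *\<^sub>R n) \<le>
         (\<integral>x. 2 * (3 + 2 * K)\<^sup>2 * indicat_real (E - E') x + 2 * (\<rho> * Q)\<^sup>2 * indicat_real ?Q x \<partial>lebesgue)"
        unfolding grad by (rule sqnorm_le_integral[OF \<Omega> _ err]) (use dm(1) Q_meas(1) in \<open>simp add: lmeasurable_iff_integrable\<close>)
      also have "\<dots> = 2 * (3 + 2 * K)\<^sup>2 * ((\<theta> - \<theta>') * R\<^sup>2) + 2 * (\<rho> * Q)\<^sup>2 * R\<^sup>2"
        using dm Q_meas by (simp add: lmeasurable_iff_integrable)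
      also have "\<dots> \<le> 2 * (3 + 2 * K)\<^sup>2 * ((5 * \<rho> * \<kappa>) * R\<^sup>2) + 2 * (\<rho> * Q)\<^sup>2 * R\<^sup>2"
        using \<theta>diff by (intro add_right_mono mult_left_mono mult_right_mono) auto
      also have "\<dots> = (10 * (3 + 2 * K)\<^sup>2 * \<kappa> + 2 * \<rho> * Q\<^sup>2) * (\<rho> * R\<^sup>2)"
        by (simp add: power_mult_distrib power2_eq_square algebra_simps)
      also have "\<dots> \<le> (\<epsilon> / 4 + \<epsilon> / 4) * (\<rho> * R\<^sup>2)"
        using \<kappa>\<epsilon> \<rho>\<epsilon> \<rho> by (intro mult_right_mono add_mono) auto
      also have "\<dots> = \<epsilon> * (\<rho> / 2 * R\<^sup>2)" by simp
      also have "\<dots> \<le> \<epsilon> * (\<theta> * R\<^sup>2)" using \<theta> \<epsilon> by (intro mult_left_mono mult_right_mono) auto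
      finally show ?thesis using E_meas(2) by simp
    qed
    \<comment> \<open>Height at most 4R on a square of area R^2. The fourth power beats the strip
      area \<theta> R^2 when R shrinks with \<theta> fixed.\<close>
    moreover have "sqnorm (lebesgue_on \<Omega>) S \<le> 16 * R ^ 4"
    proof -
      have "(norm (S x))\<^sup>2 \<le> 16 * R\<^sup>2 * indicat_real ?Q x" for x
      proof (cases "x \<in> ?Q")
        case True
        have "\<bar>S x\<bar> \<le> (R * 1) * (4 * (1 * 1))"
          unfolding S_def abs_mult
          using R \<rho> \<kappa> ramp_bound[of \<kappa> "s x / \<rho>"] plate_range[of "1/8" "s x"] plate_range[of \<kappa> "t x"]
          by (intro mult_mono) auto
        then have "\<bar>S x\<bar>\<^sup>2 \<le> (R * 4)\<^sup>2" by (intro power_mono) auto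
        then show ?thesis using True by (simp add: power_mult_distrib)
      next
        case False
        then have "x \<notin> D" using DQ by blast
        then show ?thesis using False outside[of x] by (simp add: indicator_def)
      qed
      then have "sqnorm (lebesgue_on \<Omega>) S \<le> (\<integral>x. 16 * R\<^sup>2 * indicat_real ?Q x \<partial>lebesgue)"
        by (intro sqnorm_le_integral[OF \<Omega>]) (use Q_meas(1) in \<open>simp_all add: lmeasurable_iff_integrable\<close>)
      also have "\<dots> = 16 * R ^ 4" using Q_meas by (simp add: power2_eq_square power4_eq_xxxx)
      finally show ?thesis .
    qed
    ultimately show "\<exists>S E. Cc_inf \<Omega> S \<and> E \<in> sets lebesgue \<and> E \<subseteq> ?Q \<and> measure lebesgue E = \<theta> * R\<^sup>2 \<and>
        sqnorm (lebesgue_on \<Omega>) (\<lambda>x. grad S x - indicat_real E x *\<^sub>R n) \<le> \<epsilon> * measure lebesgue E \<and>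
        sqnorm (lebesgue_on \<Omega>) S \<le> 16 * R ^ 4"
      using Cc fmeasurableD[OF E_meas(1)] E_meas(2) subset_trans[OF ED DQ] by blast
  qed
qed

section \<open>Lebesgue points\<close>

text \<open>Lebesgue differentiation over squares that have x as a corner, applied to the extension
  by zero. The upper estimate is what is recorded, because it will be used for the nonnegative
  functions |f - c|^p.\<close>

lemma lebesgue_point_corner:
  fixes f :: "real^2 \<Rightarrow> real"
  assumes \<Omega>: "open \<Omega>" and f: "integrable (lebesgue_on \<Omega>) f"
  shows "AE x in lebesgue_on \<Omega>. \<forall>e>0. \<exists>d>0. \<forall>h. 0 < h \<and> h < d \<longrightarrow>
    (\<integral>y. indicat_real (cbox x (x + h *\<^sub>R One)) y * f y \<partial>lebesgue_on \<Omega>) \<le> (f x + e) * h\<^sup>2"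
proof -
  define f' where "f' x = indicat_real \<Omega> x *\<^sub>R f x" for x
  have sets: "\<Omega> \<inter> space lebesgue \<in> sets lebesgue" using \<Omega> by auto
  have f': "integrable lebesgue f'"
    using f unfolding f'_def integrable_restrict_space[OF sets] .
  then have "f' absolutely_integrable_on UNIV" by (simp add: set_integrable_def)
  then have abs: "f' absolutely_integrable_on cbox a b" for a b
    by (rule set_integrable_subset) auto
  then have intf: "f' integrable_on cbox a b" for a b by (rule set_lebesgue_integral_eq_integral(1))
  have int: "(\<integral>y. indicat_real (cbox a b) y * f y \<partial>lebesgue_on \<Omega>) = integral (cbox a b) f'" for a b
  proof -
    have "(\<integral>y. indicat_real (cbox a b) y * f y \<partial>lebesgue_on \<Omega>) = (\<integral>y. indicat_real (cbox a b) y *\<^sub>R f' y \<partial>lebesgue)"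
      unfolding integral_restrict_space[OF sets] f'_def by (intro Bochner_Integration.integral_cong) auto
    also have "\<dots> = integral (cbox a b) f'"
      using set_lebesgue_integral_eq_integral(2)[OF abs] unfolding set_lebesgue_integral_def .
    finally show ?thesis .
  qed
  show ?thesis
  proof (rule integrable_ccontinuous_explicit[of f', OF intf])
    fix N assume N: "negligible N" and lim: "\<And>x e. x \<notin> N \<Longrightarrow> 0 < e \<Longrightarrow>
      \<exists>d>0. \<forall>h. 0 < h \<and> h < d \<longrightarrow> norm (integral (cbox x (x + h *\<^sub>R One)) f' /\<^sub>R h ^ DIM(real^2) - f' x) < e"
    have "AE x in lebesgue. x \<notin> N" using N by (simp add: AE_not_in negligible_iff_null_sets)
    then have "AE x in lebesgue_on \<Omega>. x \<notin> N"
      using \<Omega> by (subst AE_restrict_space_iff) (auto elim: eventually_mono)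
    moreover have "AE x in lebesgue_on \<Omega>. x \<in> \<Omega>" by (rule AE_I2) (simp add: space_restrict_space)
    ultimately show ?thesis
    proof eventually_elim
      fix x assume x: "x \<notin> N" "x \<in> \<Omega>"
      show "\<forall>e>0. \<exists>d>0. \<forall>h. 0 < h \<and> h < d \<longrightarrow>
        (\<integral>y. indicat_real (cbox x (x + h *\<^sub>R One)) y * f y \<partial>lebesgue_on \<Omega>) \<le> (f x + e) * h\<^sup>2"
      proof (intro allI impI)
        fix e :: real assume "e > 0"
        from lim[OF x(1) this] obtain d where d: "d > 0" "\<forall>h. 0 < h \<and> h < d \<longrightarrow>
            norm (integral (cbox x (x + h *\<^sub>R One)) f' /\<^sub>R h ^ DIM(real^2) - f' x) < e"
          by (elim exE conjE) (rule that)
        show "\<exists>d>0. \<forall>h. 0 < h \<and> h < d \<longrightarrow>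
          (\<integral>y. indicat_real (cbox x (x + h *\<^sub>R One)) y * f y \<partial>lebesgue_on \<Omega>) \<le> (f x + e) * h\<^sup>2"
        proof (intro exI[of _ d] conjI d(1) allI impI)
          fix h assume "0 < h \<and> h < d"
          then have h: "0 < h" "h < d" by auto
          have "f' x = f x" using x(2) by (simp add: f'_def)
          then have "integral (cbox x (x + h *\<^sub>R One)) f' / h\<^sup>2 < f x + e"
            using d(2)[rule_format, OF conjI[OF h]] by (simp add: divide_inverse mult.commute)
          then show "(\<integral>y. indicat_real (cbox x (x + h *\<^sub>R One)) y * f y \<partial>lebesgue_on \<Omega>) \<le> (f x + e) * h\<^sup>2"
            unfolding int using h by (simp add: pos_divide_less_eq)
        qed
      qed
    qed
  qed
qed

lemma norm_add_power_le:
  fixes x y :: "'a::real_normed_vector"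
  shows "norm (x + y) ^ p \<le> 2 ^ p * (norm x ^ p + norm y ^ p)"
proof -
  let ?m = "max (norm x) (norm y)"
  have "norm (x + y) ^ p \<le> (2 * ?m) ^ p"
    using norm_triangle_ineq[of x y] by (intro power_mono) auto
  also have "\<dots> = 2 ^ p * ?m ^ p" by (rule power_mult_distrib)
  also have "\<dots> \<le> 2 ^ p * (norm x ^ p + norm y ^ p)"
    by (intro mult_left_mono) (auto simp: max_def)
  finally show ?thesis .
qed

lemma measure_small_cbox:
  assumes \<Omega>: "open \<Omega>" and h: "0 < h" and sub: "cbox x (x + h *\<^sub>R One) \<subseteq> (\<Omega> :: (real^2) set)"
  shows "cbox x (x + h *\<^sub>R One) \<in> sets (lebesgue_on \<Omega>)" "measure (lebesgue_on \<Omega>) (cbox x (x + h *\<^sub>R One)) = h\<^sup>2"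
    "integrable (lebesgue_on \<Omega>) (indicat_real (cbox x (x + h *\<^sub>R One)))"
    "(\<integral>y. indicat_real (cbox x (x + h *\<^sub>R One)) y \<partial>lebesgue_on \<Omega>) = h\<^sup>2"
proof -
  let ?Q = "cbox x (x + h *\<^sub>R One)"
  show sets: "?Q \<in> sets (lebesgue_on \<Omega>)" using \<Omega> sub by (auto simp: sets_restrict_space_iff)
  have m: "measure lebesgue ?Q = h\<^sup>2"
    using h measure_cbox_real2[of x "x + h *\<^sub>R One"] by (simp add: One_nth power2_eq_square del: sum_component)
  then show m': "measure (lebesgue_on \<Omega>) ?Q = h\<^sup>2" using \<Omega> sub by (simp add: measure_restrict_space)
  have "emeasure (lebesgue_on \<Omega>) ?Q < \<infinity>"
    using \<Omega> sub emeasure_lborel_cbox_finite[of x "x + h *\<^sub>R One"] by (simp add: emeasure_restrict_space)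
  then show "integrable (lebesgue_on \<Omega>) (indicat_real ?Q)" using sets by (intro integrable_real_indicator)
  show "(\<integral>y. indicat_real ?Q y \<partial>lebesgue_on \<Omega>) = h\<^sup>2"
    using m' sub by (simp add: space_restrict_space Int_absorb1 Int_absorb2)
qed

lemma small_cbox_subset:
  assumes "open \<Omega>" "x \<in> (\<Omega> :: (real^2) set)"
  obtains d where "d > 0" "\<And>h. 0 < h \<Longrightarrow> h < d \<Longrightarrow> cbox x (x + h *\<^sub>R One) \<subseteq> \<Omega>"
proof -
  obtain e where e: "e > 0" "cball x e \<subseteq> \<Omega>" using assms open_contains_cball by blast
  show thesis
  proof
    show "e / 2 > 0" using e by simp
    fix h assume h: "0 < h" "h < e / 2"
    show "cbox x (x + h *\<^sub>R One) \<subseteq> \<Omega>"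
    proof
      fix y assume "y \<in> cbox x (x + h *\<^sub>R One)"
      then have c: "x $ i \<le> y $ i \<and> y $ i \<le> x $ i + h" for i by (simp add: mem_box_cart One_nth del: sum_component)
      have comp: "\<bar>y $ i - x $ i\<bar> \<le> h" for i using c[of i] h(1) by linarith
      have "norm (y - x) \<le> h + h"
        using norm_le_l1_cart[of "y - x"] comp[of 1] comp[of 2] by (simp add: sum_2)
      then have "y \<in> cball x e" using h by (simp add: dist_norm norm_minus_commute)
      then show "y \<in> \<Omega>" using e by blast
    qed
  qed
qed

text \<open>Differentiation is applied to |f - c|^p for each c in a countable dense set, which gives
  one null set for all these c. At a remaining point f(x) is then replaced by a nearby c. The
  exponent 2 serves gradients and coefficient, the exponent 1 the merely integrable function
  g(a).\<close>

lemma strong_lebesgue_point: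
  fixes f :: "real^2 \<Rightarrow> 'b::euclidean_space"
  assumes \<Omega>: "open \<Omega>" and p: "p \<ge> 1" and f: "f \<in> borel_measurable (lebesgue_on \<Omega>)"
    and int: "\<And>c. integrable (lebesgue_on \<Omega>) (\<lambda>x. norm (f x - c) ^ p)"
  shows "AE x in lebesgue_on \<Omega>. \<forall>e>0. \<exists>d>0. \<forall>h. 0 < h \<and> h < d \<longrightarrow> cbox x (x + h *\<^sub>R One) \<subseteq> \<Omega> \<and>
    (\<integral>y. indicat_real (cbox x (x + h *\<^sub>R One)) y * norm (f y - f x) ^ p \<partial>lebesgue_on \<Omega>) \<le> e * h\<^sup>2"
proof -
  let ?M = "lebesgue_on \<Omega>"
  obtain D :: "'b set" where D: "countable D" "\<And>X. open X \<Longrightarrow> X \<noteq> {} \<Longrightarrow> \<exists>d\<in>D. d \<in> X"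
    by (rule countable_dense_setE) blast
  have "AE x in ?M. \<forall>c\<in>D. \<forall>e>0. \<exists>d>0. \<forall>h. 0 < h \<and> h < d \<longrightarrow>
      (\<integral>y. indicat_real (cbox x (x + h *\<^sub>R One)) y * norm (f y - c) ^ p \<partial>?M) \<le> (norm (f x - c) ^ p + e) * h\<^sup>2"
    unfolding AE_ball_countable[OF D(1)] by (intro ballI lebesgue_point_corner[OF \<Omega> int])
  moreover have "AE x in lebesgue_on \<Omega>. x \<in> \<Omega>" by (rule AE_I2) (simp add: space_restrict_space)
  ultimately show ?thesis
  proof eventually_elim
    fix x assume leb: "\<forall>c\<in>D. \<forall>e>0. \<exists>d>0. \<forall>h. 0 < h \<and> h < d \<longrightarrow>
      (\<integral>y. indicat_real (cbox x (x + h *\<^sub>R One)) y * norm (f y - c) ^ p \<partial>?M) \<le> (norm (f x - c) ^ p + e) * h\<^sup>2"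
      and x: "x \<in> \<Omega>"
    show "\<forall>e>0. \<exists>d>0. \<forall>h. 0 < h \<and> h < d \<longrightarrow> cbox x (x + h *\<^sub>R One) \<subseteq> \<Omega> \<and>
      (\<integral>y. indicat_real (cbox x (x + h *\<^sub>R One)) y * norm (f y - f x) ^ p \<partial>?M) \<le> e * h\<^sup>2"
    proof (intro allI impI)
      fix e :: real assume e: "e > 0"
      \<comment> \<open>Three errors of size s occur: |f(x) - c|^p at the point, the tolerance of
        differentiation for c, and |c - f(x)|^p over the square; 2^p comes from splitting the power.
        The cap 1 gives s^p <= s.\<close>
      define s where "s = min 1 (e / (2 ^ p * 3))"
      have s: "s > 0" "s \<le> 1" "2 ^ p * (3 * s) \<le> e"
      proof -
        have "s \<le> e / (2 ^ p * 3)" by (simp add: s_def)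
        then show "2 ^ p * (3 * s) \<le> e" by (simp add: field_simps)
      qed (use e in \<open>auto simp: s_def\<close>)
      obtain c where c: "c \<in> D" "c \<in> ball (f x) s" using D(2)[of "ball (f x) s"] s by auto
      have "norm (f x - c) < s" using c(2) by (simp add: dist_norm)
      then have "norm (f x - c) ^ p \<le> s ^ p" by (intro power_mono) auto
      also have "\<dots> \<le> s ^ 1" using s p by (intro power_decreasing) auto
      finally have cs: "norm (f x - c) ^ p \<le> s" by simp
      from leb[rule_format, OF c(1) s(1)] obtain d1 where d1: "d1 > 0" "\<forall>h. 0 < h \<and> h < d1 \<longrightarrow>
         (\<integral>y. indicat_real (cbox x (x + h *\<^sub>R One)) y * norm (f y - c) ^ p \<partial>?M) \<le> (norm (f x - c) ^ p + s) * h\<^sup>2"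
        by (elim exE conjE) (rule that)
      obtain d2 where d2: "d2 > 0" "\<And>h. 0 < h \<Longrightarrow> h < d2 \<Longrightarrow> cbox x (x + h *\<^sub>R One) \<subseteq> \<Omega>"
        by (rule small_cbox_subset[OF \<Omega> x]) blast
      show "\<exists>d>0. \<forall>h. 0 < h \<and> h < d \<longrightarrow> cbox x (x + h *\<^sub>R One) \<subseteq> \<Omega> \<and>
        (\<integral>y. indicat_real (cbox x (x + h *\<^sub>R One)) y * norm (f y - f x) ^ p \<partial>?M) \<le> e * h\<^sup>2"
      proof (intro exI[of _ "min d1 d2"] conjI allI impI)
        show "min d1 d2 > 0" using d1(1) d2(1) by simp
        fix h assume "0 < h \<and> h < min d1 d2"
        then have h: "0 < h" "h < d1" "h < d2" by auto
        let ?Q = "cbox x (x + h *\<^sub>R One)"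
        show sub: "?Q \<subseteq> \<Omega>" by (rule d2(2)[OF h(1,3)])
        note Q = measure_small_cbox[OF \<Omega> h(1) sub]
        have iQ: "integrable ?M (\<lambda>y. indicat_real ?Q y * norm (f y - c) ^ p)"
          using integrable_mult_indicator[OF Q(1) int[of c]] by simp
        have "(\<integral>y. indicat_real ?Q y * norm (f y - f x) ^ p \<partial>?M) \<le>
          (\<integral>y. 2 ^ p * (indicat_real ?Q y * norm (f y - c) ^ p + s * indicat_real ?Q y) \<partial>?M)"
        proof (rule integral_mono')
          show "integrable ?M (\<lambda>y. 2 ^ p * (indicat_real ?Q y * norm (f y - c) ^ p + s * indicat_real ?Q y))"
            using iQ Q(3) by simp
          fix y
          have "norm (f y - f x) ^ p \<le> 2 ^ p * (norm (f y - c) ^ p + norm (c - f x) ^ p)"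
            using norm_add_power_le[of "f y - c" "c - f x" p] by simp
          also have "\<dots> \<le> 2 ^ p * (norm (f y - c) ^ p + s)"
            using cs by (intro mult_left_mono) (auto simp: norm_minus_commute)
          finally show "indicat_real ?Q y * norm (f y - f x) ^ p \<le> 2 ^ p * (indicat_real ?Q y * norm (f y - c) ^ p + s * indicat_real ?Q y)"
            by (simp add: indicator_def)
          show "0 \<le> 2 ^ p * (indicat_real ?Q y * norm (f y - c) ^ p + s * indicat_real ?Q y)"
            using s by simp
        qed
        also have "\<dots> = 2 ^ p * ((\<integral>y. indicat_real ?Q y * norm (f y - c) ^ p \<partial>?M) + s * h\<^sup>2)"
          using iQ Q(3,4) by simp
        also have "\<dots> \<le> 2 ^ p * ((s + s) * h\<^sup>2 + s * h\<^sup>2)"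
        proof (intro mult_left_mono add_right_mono)
          have "(norm (f x - c) ^ p + s) * h\<^sup>2 \<le> (s + s) * h\<^sup>2" using cs by (intro mult_right_mono) auto
          then show "(\<integral>y. indicat_real ?Q y * norm (f y - c) ^ p \<partial>?M) \<le> (s + s) * h\<^sup>2"
            using d1(2)[rule_format, OF conjI[OF h(1,2)]] by linarith
        qed simp
        also have "\<dots> = (2 ^ p * (3 * s)) * h\<^sup>2" by (simp add: algebra_simps)
        also have "\<dots> \<le> e * h\<^sup>2" using s(3) by (rule mult_right_mono) simp
        finally show "(\<integral>y. indicat_real ?Q y * norm (f y - f x) ^ p \<partial>?M) \<le> e * h\<^sup>2" .
      qed
    qed
  qed
qed

section \<open>Expansion of the objective\<close>

lemma sqnorm_bounded_scaleR_le:
  assumes "square_integrable M f" "k \<in> borel_measurable M" "AE x in M. \<bar>k x\<bar> \<le> C"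
  shows "sqnorm M (\<lambda>x. k x *\<^sub>R f x) \<le> C\<^sup>2 * sqnorm M f"
proof -
  have "sqnorm M (\<lambda>x. k x *\<^sub>R f x) \<le> (\<integral>x. C\<^sup>2 * (norm (f x))\<^sup>2 \<partial>M)"
    unfolding sqnorm_def
  proof (rule integral_mono_AE)
    show "integrable M (\<lambda>x. (norm (k x *\<^sub>R f x))\<^sup>2)"
      using square_integrable_bounded_scaleR[OF assms] by (rule square_integrableD)
    show "AE x in M. (norm (k x *\<^sub>R f x))\<^sup>2 \<le> C\<^sup>2 * (norm (f x))\<^sup>2"
      using assms(3)
    proof eventually_elim
      fix x assume "\<bar>k x\<bar> \<le> C"
      then have "\<bar>k x\<bar>\<^sup>2 \<le> C\<^sup>2" by (intro power_mono) auto
      then show "(norm (k x *\<^sub>R f x))\<^sup>2 \<le> C\<^sup>2 * (norm (f x))\<^sup>2"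
        by (simp add: power_mult_distrib mult_right_mono)
    qed
  qed (use assms(1) in \<open>simp add: square_integrable_def\<close>)
  then show ?thesis using assms(1) by (simp add: sqnorm_def square_integrable_def)
qed

lemma sqnorm_indicator_const:
  assumes "E \<in> sets M"
  shows "sqnorm M (\<lambda>x. indicat_real E x *\<^sub>R v) = (norm v)\<^sup>2 * measure M E"
proof -
  have "sqnorm M (\<lambda>x. indicat_real E x *\<^sub>R v) = (\<integral>x. (norm v)\<^sup>2 * indicat_real E x \<partial>M)"
    unfolding sqnorm_def by (intro Bochner_Integration.integral_cong) (auto simp: indicator_def)
  also have "\<dots> = (norm v)\<^sup>2 * measure M E"
    using sets.sets_into_space[OF assms] by (simp add: Int_absorb2)
  finally show ?thesis .
qed

text \<open>The perturbed state differs from \<open>y\<close> by \<open>-c S\<close> up to an error \<open>z\<close> of lower order. The residual of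
  this ansatz contains the constant field \<open>rot n\<close> on \<open>E\<close>, which is not small by itself, but is close to
  the divergence-free field \<open>rot (grad S)\<close> and therefore invisible to gradients.\<close>
lemma strip_perturbation_energy:
  fixes u n :: "real^2"
  assumes \<Omega>: "open \<Omega>" "bounded \<Omega>" and \<alpha>: "\<alpha> > 0"
    and am: "a \<in> borel_measurable (lebesgue_on \<Omega>)" and aC: "AE x in lebesgue_on \<Omega>. \<alpha> \<le> a x \<and> a x \<le> C"
    and b: "\<alpha> \<le> b" "b \<le> C" and a0: "\<bar>a0\<bar> \<le> C" and n: "norm n = 1"
    and E: "E \<in> sets (lebesgue_on \<Omega>)" 
    and y: "is_state \<Omega> a f y Gy" and yh: "is_state \<Omega> (\<lambda>x. if x \<in> E then b else a x) f yh Gyh"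
    and S: "H10 \<Omega> S GS"
    and small_y: "sqnorm (lebesgue_on \<Omega>) (\<lambda>x. indicat_real E x *\<^sub>R (Gy x - u)) \<le> \<eta>"
    and small_a: "sqnorm (lebesgue_on \<Omega>) (\<lambda>x. indicat_real E x *\<^sub>R (a x - a0)) \<le> \<eta>"
    and small_S: "sqnorm (lebesgue_on \<Omega>) (\<lambda>x. GS x - indicat_real E x *\<^sub>R n) \<le> \<eta>"
  defines "c \<equiv> (b - a0) / b * (n \<bullet> u)"
  shows "H10 \<Omega> (\<lambda>x. yh x - y x + c * S x) (\<lambda>x. Gyh x - Gy x + c *\<^sub>R GS x)"
    "sqnorm (lebesgue_on \<Omega>) (\<lambda>x. Gyh x - Gy x + c *\<^sub>R GS x)
      \<le> 4 * ((norm u)\<^sup>2 + 4 * C\<^sup>2 + c\<^sup>2 * C\<^sup>2 + ((b - a0) * (rot n \<bullet> u))\<^sup>2) / \<alpha>\<^sup>2 * \<eta>"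
proof -
  let ?M = "lebesgue_on \<Omega>"
  let ?\<chi> = "indicat_real E"
  define ah where "ah x = (if x \<in> E then b else a x)" for x
  define \<kappa> where "\<kappa> = (b - a0) * (rot n \<bullet> u)"
  define e where "e x = GS x - ?\<chi> x *\<^sub>R n" for x
  define z where "z x = yh x - y x + c * S x" for x
  define Gz where "Gz x = Gyh x - Gy x + c *\<^sub>R GS x" for x
  have b0: "b > 0" using b \<alpha> by simp
  have fin: "finite_measure ?M" by (rule finite_measure_lebesgue_on[OF \<Omega>])
  have Hy: "H10 \<Omega> y Gy" and Hyh: "H10 \<Omega> yh Gyh" using y yh by (auto simp: is_state_def)
  have Hz: "H10 \<Omega> z Gz"
    using H10_lincomb[OF \<Omega>(1) H10_lincomb[OF \<Omega>(1) Hyh Hy, of "-1"] S, of c] by (simp add: z_def[abs_def] Gz_def[abs_def])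
  then show "H10 \<Omega> (\<lambda>x. yh x - y x + c * S x) (\<lambda>x. Gyh x - Gy x + c *\<^sub>R GS x)"
    unfolding z_def Gz_def .
  note sq = H10_square_integrable(2)[OF \<Omega>(1)]
  have sGy: "square_integrable ?M Gy" and sGyh: "square_integrable ?M Gyh" and sGS: "square_integrable ?M GS"
    and sGz: "square_integrable ?M Gz"
    using sq[OF Hy] sq[OF Hyh] sq[OF S] sq[OF Hz] .
  have ahm: "ah \<in> borel_measurable ?M"
    unfolding ah_def using E am by (intro measurable_If_set) auto
  have ahC: "AE x in ?M. \<alpha> \<le> ah x \<and> ah x \<le> C" using aC by eventually_elim (use b in \<open>auto simp: ah_def\<close>)
  have abs_a: "AE x in ?M. \<bar>a x\<bar> \<le> C" using aC by eventually_elim (use \<alpha> in auto)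
  have abs_ah: "AE x in ?M. \<bar>ah x\<bar> \<le> C" using ahC by eventually_elim (use \<alpha> in auto)
  have abs_d: "AE x in ?M. \<bar>b - a x\<bar> \<le> 2 * C" using aC by eventually_elim (use \<alpha> b in auto)
  have dm: "(\<lambda>x. b - a x) \<in> borel_measurable ?M" using am by measurable
  have se: "square_integrable ?M e"
    unfolding e_def using square_integrable_indicator[OF square_integrable_const[OF fin] E] sGS
    by (intro square_integrable_diff)
  have a_sq: "square_integrable ?M (\<lambda>x. a x - a0)"
    using square_integrable_bounded_scaleR[OF square_integrable_const[OF fin, of "1::real"] am abs_a] 
    by (intro square_integrable_diff square_integrable_const fin) simp
  \<comment> \<open>The four replacements in the residual: F1 puts \<open>a0\<close> for
    \<open>a\<close>, F2 puts \<open>u\<close> for \<open>Gy\<close>, F3 puts the exact strip field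
    for \<open>GS\<close> in the flux, and F4 does so in its rotated copy.\<close>
  define F1 where "F1 x = (?\<chi> x *\<^sub>R (a x - a0)) *\<^sub>R u" for x
  define F2 where "F2 x = (b - a x) *\<^sub>R (?\<chi> x *\<^sub>R (u - Gy x))" for x
  define F3 where "F3 x = c *\<^sub>R (ah x *\<^sub>R e x)" for x
  define F4 where "F4 x = \<kappa> *\<^sub>R rot (e x)" for x
  have s\<chi>a: "square_integrable ?M (\<lambda>x. ?\<chi> x *\<^sub>R (a x - a0))" by (rule square_integrable_indicator[OF a_sq E])
  have s\<chi>y: "square_integrable ?M (\<lambda>x. ?\<chi> x *\<^sub>R (u - Gy x))"
    by (intro square_integrable_indicator[OF _ E] square_integrable_diff square_integrable_const fin sGy)
  have s1: "square_integrable ?M F1"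
    unfolding square_integrable_def
  proof
    show "F1 \<in> borel_measurable ?M" unfolding F1_def using square_integrableD(1)[OF s\<chi>a] by (rule borel_measurable_scaleR) simp
    have "(\<lambda>x. (norm (F1 x))\<^sup>2) = (\<lambda>x. (norm u)\<^sup>2 * (norm (?\<chi> x *\<^sub>R (a x - a0)))\<^sup>2)"
      by (auto simp: F1_def power_mult_distrib)
    then show "integrable ?M (\<lambda>x. (norm (F1 x))\<^sup>2)" using square_integrableD(2)[OF s\<chi>a] by simp
  qed
  have n1: "sqnorm ?M F1 \<le> (norm u)\<^sup>2 * \<eta>"
  proof -
    have "sqnorm ?M F1 = (norm u)\<^sup>2 * sqnorm ?M (\<lambda>x. ?\<chi> x *\<^sub>R (a x - a0))"
      unfolding sqnorm_def F1_def by (simp add: power_mult_distrib mult.commute[of _ "(norm u)\<^sup>2"])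
    then show ?thesis using small_a by (simp add: mult_left_mono)
  qed
  have s2: "square_integrable ?M F2"
    unfolding F2_def by (rule square_integrable_bounded_scaleR[OF s\<chi>y dm abs_d])
  have n2: "sqnorm ?M F2 \<le> 4 * C\<^sup>2 * \<eta>"
  proof -
    have "sqnorm ?M F2 \<le> (2 * C)\<^sup>2 * sqnorm ?M (\<lambda>x. ?\<chi> x *\<^sub>R (u - Gy x))"
      unfolding F2_def by (rule sqnorm_bounded_scaleR_le[OF s\<chi>y dm abs_d])
    also have "sqnorm ?M (\<lambda>x. ?\<chi> x *\<^sub>R (u - Gy x)) = sqnorm ?M (\<lambda>x. ?\<chi> x *\<^sub>R (Gy x - u))"
      by (simp add: sqnorm_def norm_minus_commute)
    also have "(2 * C)\<^sup>2 * \<dots> \<le> (2 * C)\<^sup>2 * \<eta>" using small_y by (rule mult_left_mono) simp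
    finally show ?thesis by (simp add: power_mult_distrib)
  qed
  have sae: "square_integrable ?M (\<lambda>x. ah x *\<^sub>R e x)" by (rule square_integrable_bounded_scaleR[OF se ahm abs_ah])
  have s3: "square_integrable ?M F3" unfolding F3_def by (rule square_integrable_scaleR[OF sae])
  have n3: "sqnorm ?M F3 \<le> c\<^sup>2 * C\<^sup>2 * \<eta>"
  proof -
    have "sqnorm ?M (\<lambda>x. ah x *\<^sub>R e x) \<le> C\<^sup>2 * sqnorm ?M e" by (rule sqnorm_bounded_scaleR_le[OF se ahm abs_ah])
    also have "\<dots> \<le> C\<^sup>2 * \<eta>" using small_S unfolding e_def by (rule mult_left_mono) simp
    finally have "c\<^sup>2 * sqnorm ?M (\<lambda>x. ah x *\<^sub>R e x) \<le> c\<^sup>2 * (C\<^sup>2 * \<eta>)" by (rule mult_left_mono) simp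
    then show ?thesis unfolding F3_def sqnorm_scaleR by simp
  qed
  have s4: "square_integrable ?M F4"
    unfolding F4_def by (rule square_integrable_scaleR[OF square_integrable_rot[OF se]])
  have n4: "sqnorm ?M F4 \<le> \<kappa>\<^sup>2 * \<eta>"
  proof -
    have "sqnorm ?M (\<lambda>x. rot (e x)) \<le> \<eta>" using small_S by (simp add: sqnorm_def norm_rot e_def)
    then show ?thesis unfolding F4_def sqnorm_scaleR by (rule mult_left_mono) simp
  qed
  define F where "F x = (F1 x + F2 x) + (F3 x + F4 x)" for x
  have sF: "square_integrable ?M F"
    unfolding F_def by (intro square_integrable_add s1 s2 s3 s4)
  have nF: "sqnorm ?M F \<le> 4 * ((norm u)\<^sup>2 + 4 * C\<^sup>2 + c\<^sup>2 * C\<^sup>2 + \<kappa>\<^sup>2) * \<eta>"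
  proof -
    have "sqnorm ?M F \<le> 2 * sqnorm ?M (\<lambda>x. F1 x + F2 x) + 2 * sqnorm ?M (\<lambda>x. F3 x + F4 x)"
      unfolding F_def by (intro sqnorm_add_le square_integrable_add s1 s2 s3 s4)
    moreover have "sqnorm ?M (\<lambda>x. F1 x + F2 x) \<le> 2 * sqnorm ?M F1 + 2 * sqnorm ?M F2" by (rule sqnorm_add_le[OF s1 s2])
    moreover have "sqnorm ?M (\<lambda>x. F3 x + F4 x) \<le> 2 * sqnorm ?M F3 + 2 * sqnorm ?M F4" by (rule sqnorm_add_le[OF s3 s4])
    ultimately have "sqnorm ?M F \<le> 4 * (sqnorm ?M F1 + sqnorm ?M F2 + sqnorm ?M F3 + sqnorm ?M F4)" by argo
    also have "\<dots> \<le> 4 * ((norm u)\<^sup>2 * \<eta> + 4 * C\<^sup>2 * \<eta> + c\<^sup>2 * C\<^sup>2 * \<eta> + \<kappa>\<^sup>2 * \<eta>)"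
      using n1 n2 n3 n4 by (intro mult_left_mono add_mono) auto
    also have "\<dots> = 4 * ((norm u)\<^sup>2 + 4 * C\<^sup>2 + c\<^sup>2 * C\<^sup>2 + \<kappa>\<^sup>2) * \<eta>" by (simp add: algebra_simps)
    finally show ?thesis .
  qed
  \<comment> \<open>Normal and tangential part of the flux jump. The amplitude \<open>c\<close> is
    chosen so that the strip field c n, carried by the new coefficient b, balances the normal part;
    this is where the division by b originates.\<close>
  have decomp: "(b - a0) *\<^sub>R u = (b * c) *\<^sub>R n + \<kappa> *\<^sub>R rot n"
  proof -
    have "b * c = (b - a0) * (n \<bullet> u)" using b0 by (simp add: c_def)
    then have "(b * c) *\<^sub>R n + \<kappa> *\<^sub>R rot n = (b - a0) *\<^sub>R ((u \<bullet> n) *\<^sub>R n + (u \<bullet> rot n) *\<^sub>R rot n)"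
      by (simp add: \<kappa>_def scaleR_add_right inner_commute)
    then show ?thesis by (simp add: rot_basis(5)[OF n])
  qed
  \<comment> \<open>By \<open>decomp\<close> the constant fields of F1 + F2 and of F3 + F4 cancel on
    E; off E only the terms with \<open>GS\<close> remain. So F is the true residual plus a multiple
    of \<open>rot (GS x)\<close>.\<close>
  have F_eq: "F x = (a x *\<^sub>R Gy x - ah x *\<^sub>R Gy x) + c *\<^sub>R (ah x *\<^sub>R GS x) + \<kappa> *\<^sub>R rot (GS x)" for x
  proof (cases "x \<in> E")
    case True
    have F12: "F1 x + F2 x = (b - a0) *\<^sub>R u - (b - a x) *\<^sub>R Gy x"
      using True by (simp add: F1_def F2_def algebra_simps)
    have F34: "F3 x + F4 x = c *\<^sub>R (b *\<^sub>R GS x) + \<kappa> *\<^sub>R rot (GS x) - ((b * c) *\<^sub>R n + \<kappa> *\<^sub>R rot n)"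
      using True by (simp add: F3_def F4_def e_def ah_def rot_diff algebra_simps)
    show ?thesis using True unfolding F_def F12 F34 decomp by (simp add: ah_def algebra_simps)
  next
    case False
    then show ?thesis by (simp add: F_def F1_def F2_def F3_def F4_def e_def ah_def)
  qed
  \<comment> \<open>Both state equations are tested with z, which removes f, and the multiple of
    \<open>rot (GS x)\<close> is inserted for free since it is orthogonal to
    \<open>Gz\<close>.\<close>
  have energy: "(\<integral>x. ah x * (Gz x \<bullet> Gz x) \<partial>?M) = (\<integral>x. F x \<bullet> Gz x \<partial>?M)"
  proof -
    have i: "integrable ?M (\<lambda>x. ah x * (Gyh x \<bullet> Gz x))" "integrable ?M (\<lambda>x. ah x * (Gy x \<bullet> Gz x))"
      "integrable ?M (\<lambda>x. ah x * (GS x \<bullet> Gz x))" "integrable ?M (\<lambda>x. a x * (Gy x \<bullet> Gz x))"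
      "integrable ?M (\<lambda>x. rot (GS x) \<bullet> Gz x)"
      using integrable_weighted_inner[OF _ sGz ahm abs_ah] integrable_weighted_inner[OF _ sGz am abs_a]
        integrable_inner[OF square_integrable_rot[OF sGS] sGz] sGyh sGy sGS by auto
    have "(\<integral>x. ah x * (Gyh x \<bullet> Gz x) \<partial>?M) = (\<integral>x. f x * z x \<partial>?M)"
      using yh Hz unfolding is_state_def ah_def by blast
    also have "\<dots> = (\<integral>x. a x * (Gy x \<bullet> Gz x) \<partial>?M)" using y Hz unfolding is_state_def by auto
    finally have st: "(\<integral>x. ah x * (Gyh x \<bullet> Gz x) \<partial>?M) = (\<integral>x. a x * (Gy x \<bullet> Gz x) \<partial>?M)" .
    have "(\<integral>x. ah x * (Gz x \<bullet> Gz x) \<partial>?M) =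
        (\<integral>x. ah x * (Gyh x \<bullet> Gz x) - ah x * (Gy x \<bullet> Gz x) + c * (ah x * (GS x \<bullet> Gz x)) \<partial>?M)"
    proof (rule Bochner_Integration.integral_cong[OF refl])
      fix x
      have g: "Gz x \<bullet> Gz x = Gyh x \<bullet> Gz x - Gy x \<bullet> Gz x + c * (GS x \<bullet> Gz x)"
        by (subst (1) Gz_def) (simp add: inner_add_left inner_diff_left)
      show "ah x * (Gz x \<bullet> Gz x) = ah x * (Gyh x \<bullet> Gz x) - ah x * (Gy x \<bullet> Gz x) + c * (ah x * (GS x \<bullet> Gz x))"
        unfolding g by (simp add: algebra_simps)
    qed
    also have "\<dots> = (\<integral>x. ah x * (Gyh x \<bullet> Gz x) \<partial>?M) - (\<integral>x. ah x * (Gy x \<bullet> Gz x) \<partial>?M) + c * (\<integral>x. ah x * (GS x \<bullet> Gz x) \<partial>?M)"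
      using i by simp
    also have "\<dots> = (\<integral>x. a x * (Gy x \<bullet> Gz x) \<partial>?M) - (\<integral>x. ah x * (Gy x \<bullet> Gz x) \<partial>?M)
        + c * (\<integral>x. ah x * (GS x \<bullet> Gz x) \<partial>?M) + \<kappa> * (\<integral>x. rot (GS x) \<bullet> Gz x \<partial>?M)"
      using st H10_rot_orthogonal[OF \<Omega>(1) S Hz] by simp
    also have "\<dots> = (\<integral>x. a x * (Gy x \<bullet> Gz x) - ah x * (Gy x \<bullet> Gz x) + c * (ah x * (GS x \<bullet> Gz x)) + \<kappa> * (rot (GS x) \<bullet> Gz x) \<partial>?M)"
      using i by simp
    also have "\<dots> = (\<integral>x. F x \<bullet> Gz x \<partial>?M)"
      unfolding F_eq by (simp add: inner_add_left inner_diff_left mult.assoc)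
    finally show ?thesis .
  qed
  \<comment> \<open>Coercivity against Young's inequality with weight \<alpha>: doubling the first
    leaves one copy of the energy of z on the left.\<close>
  have "\<alpha> * sqnorm ?M Gz \<le> (\<integral>x. F x \<bullet> Gz x \<partial>?M)"
    using weighted_energy_coercive[OF sGz ahm ahC \<alpha>] unfolding energy .
  moreover have "2 * \<bar>\<integral>x. F x \<bullet> Gz x \<partial>?M\<bar> \<le> sqnorm ?M F / \<alpha> + \<alpha> * sqnorm ?M Gz"
    by (rule integral_inner_le_sqnorm[OF sF sGz \<alpha>])
  ultimately have "\<alpha> * sqnorm ?M Gz \<le> sqnorm ?M F / \<alpha>" by linarith
  then have "sqnorm ?M Gz \<le> sqnorm ?M F / \<alpha>\<^sup>2" using \<alpha> by (simp add: field_simps power2_eq_square)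
  also have "\<dots> \<le> (4 * ((norm u)\<^sup>2 + 4 * C\<^sup>2 + c\<^sup>2 * C\<^sup>2 + \<kappa>\<^sup>2) * \<eta>) / \<alpha>\<^sup>2"
    using nF by (rule divide_right_mono) simp
  finally show "sqnorm ?M (\<lambda>x. Gyh x - Gy x + c *\<^sub>R GS x)
      \<le> 4 * ((norm u)\<^sup>2 + 4 * C\<^sup>2 + c\<^sup>2 * C\<^sup>2 + ((b - a0) * (rot n \<bullet> u))\<^sup>2) / \<alpha>\<^sup>2 * \<eta>"
    by (simp add: Gz_def[symmetric] \<kappa>_def[symmetric])
qed

text \<open>An exact identity, since the tracking term is quadratic. The adjoint is tested with yh -
  y and both states with p, which leaves the perturbed gradient \<open>Gyh\<close> rather than
  \<open>Gy\<close> in the integral; its jump inside the strip produces the term with (b - a0)^2 /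
  b.\<close>

lemma state_difference_objective:
  assumes \<Omega>: "open \<Omega>"
    and y: "is_state \<Omega> a f y Gy" and yh: "is_state \<Omega> ah f yh Gyh" and p: "is_adjoint \<Omega> a y yd p Gp"
    and yd: "square_integrable (lebesgue_on \<Omega>) yd"
    and a: "a \<in> borel_measurable (lebesgue_on \<Omega>)" "AE x in lebesgue_on \<Omega>. \<bar>a x\<bar> \<le> C"
    and ah: "ah \<in> borel_measurable (lebesgue_on \<Omega>)" "AE x in lebesgue_on \<Omega>. \<bar>ah x\<bar> \<le> C"
  shows "(\<integral>x. (yh x - yd x)\<^sup>2 \<partial>lebesgue_on \<Omega>) / 2 - (\<integral>x. (y x - yd x)\<^sup>2 \<partial>lebesgue_on \<Omega>) / 2
     = - (\<integral>x. (ah x - a x) * (Gyh x \<bullet> Gp x) \<partial>lebesgue_on \<Omega>) + sqnorm (lebesgue_on \<Omega>) (\<lambda>x. yh x - y x) / 2"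
proof -
  let ?M = "lebesgue_on \<Omega>"
  define w where "w x = yh x - y x" for x
  define Gw where "Gw x = Gyh x - Gy x" for x
  have Hy: "H10 \<Omega> y Gy" and Hyh: "H10 \<Omega> yh Gyh" and Hp: "H10 \<Omega> p Gp"
    using y yh p by (auto simp: is_state_def is_adjoint_def)
  have Hw: "H10 \<Omega> w Gw"
    using H10_lincomb[OF \<Omega> Hyh Hy, of "-1"] by (simp add: w_def[abs_def] Gw_def[abs_def])
  note sq1 = H10_square_integrable(1)[OF \<Omega>] and sq2 = H10_square_integrable(2)[OF \<Omega>]
  have sd: "square_integrable ?M (\<lambda>x. y x - yd x)" by (rule square_integrable_diff[OF sq1[OF Hy] yd])
  have i: "integrable ?M (\<lambda>x. (y x - yd x)\<^sup>2)" "integrable ?M (\<lambda>x. (w x)\<^sup>2)" "integrable ?M (\<lambda>x. (y x - yd x) * w x)"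
    using square_integrableD(2)[OF sd] square_integrableD(2)[OF sq1[OF Hw]] integrable_mult_square[OF sd sq1[OF Hw]] by simp_all
  have "(\<integral>x. (yh x - yd x)\<^sup>2 \<partial>?M) = (\<integral>x. (y x - yd x)\<^sup>2 + 2 * ((y x - yd x) * w x) + (w x)\<^sup>2 \<partial>?M)"
    by (intro Bochner_Integration.integral_cong) (auto simp: w_def power2_eq_square algebra_simps)
  also have "\<dots> = (\<integral>x. (y x - yd x)\<^sup>2 \<partial>?M) + 2 * (\<integral>x. (y x - yd x) * w x \<partial>?M) + (\<integral>x. (w x)\<^sup>2 \<partial>?M)"
    using i by simp
  finally have quad: "(\<integral>x. (yh x - yd x)\<^sup>2 \<partial>?M) / 2 - (\<integral>x. (y x - yd x)\<^sup>2 \<partial>?M) / 2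
      = (\<integral>x. (y x - yd x) * w x \<partial>?M) + sqnorm ?M w / 2"
    by (simp add: sqnorm_def add_divide_distrib)
  have j: "integrable ?M (\<lambda>x. a x * (Gyh x \<bullet> Gp x))" "integrable ?M (\<lambda>x. a x * (Gy x \<bullet> Gp x))" "integrable ?M (\<lambda>x. ah x * (Gyh x \<bullet> Gp x))"
    by (intro integrable_weighted_inner[OF sq2[OF Hyh] sq2[OF Hp] a] integrable_weighted_inner[OF sq2[OF Hy] sq2[OF Hp] a]
        integrable_weighted_inner[OF sq2[OF Hyh] sq2[OF Hp] ah])+
  have st1: "(\<integral>x. a x * (Gy x \<bullet> Gp x) \<partial>?M) = (\<integral>x. f x * p x \<partial>?M)" using y Hp unfolding is_state_def by auto
  have st2: "(\<integral>x. ah x * (Gyh x \<bullet> Gp x) \<partial>?M) = (\<integral>x. f x * p x \<partial>?M)" using yh Hp unfolding is_state_def by auto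
  have "(\<integral>x. (y x - yd x) * w x \<partial>?M) = (\<integral>x. a x * (Gw x \<bullet> Gp x) \<partial>?M)"
    using p Hw unfolding is_adjoint_def by auto
  also have "\<dots> = (\<integral>x. a x * (Gyh x \<bullet> Gp x) - a x * (Gy x \<bullet> Gp x) \<partial>?M)"
    by (simp add: Gw_def inner_diff_left algebra_simps)
  also have "\<dots> = (\<integral>x. a x * (Gyh x \<bullet> Gp x) \<partial>?M) - (\<integral>x. ah x * (Gyh x \<bullet> Gp x) \<partial>?M)"
    using j st1 st2 by simp
  also have "\<dots> = (\<integral>x. a x * (Gyh x \<bullet> Gp x) - ah x * (Gyh x \<bullet> Gp x) \<partial>?M)" using j by simp
  also have "\<dots> = (\<integral>x. - ((ah x - a x) * (Gyh x \<bullet> Gp x)) \<partial>?M)" by (simp add: algebra_simps)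
  also have "\<dots> = - (\<integral>x. (ah x - a x) * (Gyh x \<bullet> Gp x) \<partial>?M)" by simp
  finally show ?thesis using quad by (simp add: w_def[abs_def])
qed

text \<open>\<open>K\<close> is obtained before E, S and \<mu>, and so depends on none of them; this
  order of quantifiers is what allows \<mu> to tend to 0 afterwards.\<close>

lemma strip_objective_estimate:
  fixes u q n :: "real^2"
  assumes \<Omega>: "open \<Omega>" "bounded \<Omega>" and \<alpha>: "\<alpha> > 0"
    and am: "a \<in> borel_measurable (lebesgue_on \<Omega>)" and aC: "AE x in lebesgue_on \<Omega>. \<alpha> \<le> a x \<and> a x \<le> C"
    and b: "\<alpha> \<le> b" "b \<le> C" and a0: "\<bar>a0\<bar> \<le> C" and n: "norm n = 1"
    and yd: "square_integrable (lebesgue_on \<Omega>) yd"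
    and y: "is_state \<Omega> a f y Gy" and p: "is_adjoint \<Omega> a y yd p Gp"
  obtains K where "\<And>E yh Gyh S GS \<mu>.
    \<lbrakk>E \<in> sets (lebesgue_on \<Omega>); is_state \<Omega> (\<lambda>x. if x \<in> E then b else a x) f yh Gyh; H10 \<Omega> S GS; 0 < \<mu>; \<mu> \<le> 1;
     sqnorm (lebesgue_on \<Omega>) (\<lambda>x. indicat_real E x *\<^sub>R (Gy x - u)) \<le> \<mu>\<^sup>2 * measure (lebesgue_on \<Omega>) E;
     sqnorm (lebesgue_on \<Omega>) (\<lambda>x. indicat_real E x *\<^sub>R (Gp x - q)) \<le> \<mu>\<^sup>2 * measure (lebesgue_on \<Omega>) E;
     sqnorm (lebesgue_on \<Omega>) (\<lambda>x. indicat_real E x *\<^sub>R (a x - a0)) \<le> \<mu>\<^sup>2 * measure (lebesgue_on \<Omega>) E;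
     sqnorm (lebesgue_on \<Omega>) (\<lambda>x. GS x - indicat_real E x *\<^sub>R n) \<le> \<mu>\<^sup>2 * measure (lebesgue_on \<Omega>) E;
     sqnorm (lebesgue_on \<Omega>) S \<le> \<mu>\<^sup>2 * measure (lebesgue_on \<Omega>) E\<rbrakk> \<Longrightarrow>
    (\<integral>x. (yh x - yd x)\<^sup>2 \<partial>lebesgue_on \<Omega>) / 2 - (\<integral>x. (y x - yd x)\<^sup>2 \<partial>lebesgue_on \<Omega>) / 2
     \<le> (- (b - a0) * (u \<bullet> q) + (b - a0)\<^sup>2 / b * ((n \<bullet> u) * (n \<bullet> q))) * measure (lebesgue_on \<Omega>) E
        + K * \<mu> * measure (lebesgue_on \<Omega>) E"
proof -
  let ?M = "lebesgue_on \<Omega>"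
  obtain B where B0: "B > 0" and B: "\<And>x. x \<in> \<Omega> \<Longrightarrow> norm x \<le> B" using \<Omega>(2) bounded_pos by metis
  define P where "P = 4 * B\<^sup>2"
  have P0: "P \<ge> 0" by (simp add: P_def)
  define c where "c = (b - a0) / b * (n \<bullet> u)"
  \<comment> \<open>The approximate gradient of the perturbed state inside the strip.\<close>
  define r where "r = u - c *\<^sub>R n"
  define Kz where "Kz = 4 * ((norm u)\<^sup>2 + 4 * C\<^sup>2 + c\<^sup>2 * C\<^sup>2 + ((b - a0) * (rot n \<bullet> u))\<^sup>2) / \<alpha>\<^sup>2"
  \<comment> \<open>Bounds the deviation of \<open>Gyh\<close> from \<open>r\<close> on E. Its parts
    enter with factors 4, 4 and 2, rounded up to a common 4; likewise \<open>D\<close> below is the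
    square of the bound 2C for |b - a|.\<close>
  define K\<zeta> where "K\<zeta> = 4 * (1 + Kz + c\<^sup>2)"
  define D where "D = 4 * C\<^sup>2"
  \<comment> \<open>One summand for each error integral \<open>b1\<close> to \<open>b4\<close>, and
    the last one for half of the squared distance of the states.\<close>
  define K where "K = (K\<zeta> + D * (norm q)\<^sup>2) / 2 + (K\<zeta> + D) / 2 + (1 + D * (norm r)\<^sup>2) / 2 + (1 + (r \<bullet> q)\<^sup>2) / 2 + (P * Kz + c\<^sup>2)"
  have b0: "b > 0" using b \<alpha> by simp
  have fin: "finite_measure ?M" by (rule finite_measure_lebesgue_on[OF \<Omega>])
  have Kz0: "Kz \<ge> 0" by (simp add: Kz_def)
  have abs_a: "AE x in ?M. \<bar>a x\<bar> \<le> C" using aC by eventually_elim (use \<alpha> in auto)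
  have abs_d: "AE x in ?M. \<bar>b - a x\<bar> \<le> 2 * C" using aC by eventually_elim (use \<alpha> b in auto)
  have dm: "(\<lambda>x. b - a x) \<in> borel_measurable ?M" using am by measurable
  have Hy: "H10 \<Omega> y Gy" and Hp: "H10 \<Omega> p Gp" using y p by (auto simp: is_state_def is_adjoint_def)
  note sq = H10_square_integrable(2)[OF \<Omega>(1)]
  have a_sq: "square_integrable ?M (\<lambda>x. a x - a0)"
    using square_integrable_bounded_scaleR[OF square_integrable_const[OF fin, of "1::real"] am abs_a] 
    by (intro square_integrable_diff square_integrable_const fin) simp
  show thesis
  proof (rule that[of K])
    fix E yh Gyh S GS \<mu>
    let ?\<chi> = "indicat_real E" and ?m = "measure ?M E"
    assume E: "E \<in> sets ?M" and yh: "is_state \<Omega> (\<lambda>x. if x \<in> E then b else a x) f yh Gyh"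
      and S: "H10 \<Omega> S GS" and \<mu>: "0 < \<mu>" "\<mu> \<le> 1"
      and small_y: "sqnorm ?M (\<lambda>x. ?\<chi> x *\<^sub>R (Gy x - u)) \<le> \<mu>\<^sup>2 * ?m"
      and small_p: "sqnorm ?M (\<lambda>x. ?\<chi> x *\<^sub>R (Gp x - q)) \<le> \<mu>\<^sup>2 * ?m"
      and small_a: "sqnorm ?M (\<lambda>x. ?\<chi> x *\<^sub>R (a x - a0)) \<le> \<mu>\<^sup>2 * ?m"
      and small_S: "sqnorm ?M (\<lambda>x. GS x - ?\<chi> x *\<^sub>R n) \<le> \<mu>\<^sup>2 * ?m"
      and small_S0: "sqnorm ?M S \<le> \<mu>\<^sup>2 * ?m"
    let ?\<eta> = "\<mu>\<^sup>2 * ?m"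
    have \<eta>: "0 \<le> ?\<eta>" "?\<eta> \<le> \<mu> * ?m"
      using \<mu> by (simp_all add: power2_eq_square mult_right_mono mult_left_le)
    define ah where "ah x = (if x \<in> E then b else a x)" for x
    have ahm: "ah \<in> borel_measurable ?M"
      unfolding ah_def using E am by (intro measurable_If_set) auto
    have abs_ah: "AE x in ?M. \<bar>ah x\<bar> \<le> C" using aC by eventually_elim (use b \<alpha> in \<open>auto simp: ah_def\<close>)
    have Hyh: "H10 \<Omega> yh Gyh" using yh by (auto simp: is_state_def)
    note z = strip_perturbation_energy[OF \<Omega> \<alpha> am aC b a0 n E y yh S small_y small_a small_S, folded c_def, folded Kz_def]
    define Gz where "Gz x = Gyh x - Gy x + c *\<^sub>R GS x" for x
    have sGz: "square_integrable ?M Gz" using sq[OF z(1)] by (simp add: Gz_def[abs_def])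
    have nGz: "sqnorm ?M Gz \<le> Kz * ?\<eta>" using z(2) by (simp add: Gz_def[abs_def])
    note sGy = sq[OF Hy] and sGyh = sq[OF Hyh] and sGp = sq[OF Hp] and sGS = sq[OF S]
    have n\<chi>: "square_integrable ?M (\<lambda>x. ?\<chi> x *\<^sub>R v)" for v :: "'b::euclidean_space"
      by (rule square_integrable_indicator[OF square_integrable_const[OF fin] E])
    have indicator_le: "sqnorm ?M (\<lambda>x. ?\<chi> x *\<^sub>R G x) \<le> sqnorm ?M G" if "square_integrable ?M G" for G :: "real^2 \<Rightarrow> real^2"
      using sqnorm_bounded_scaleR_le[OF that, of ?\<chi> 1] E by (auto simp: indicator_def)
    have w: "sqnorm ?M (\<lambda>x. yh x - y x) \<le> 2 * (P * Kz + c\<^sup>2) * (\<mu> * ?m)"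
    proof -
      have sS: "square_integrable ?M S" and sz: "square_integrable ?M (\<lambda>x. yh x - y x + c * S x)"
        using H10_square_integrable(1)[OF \<Omega>(1) S] H10_square_integrable(1)[OF \<Omega>(1) z(1)] .
      have "sqnorm ?M (\<lambda>x. (yh x - y x + c * S x) - c * S x) \<le> 2 * sqnorm ?M (\<lambda>x. yh x - y x + c * S x) + 2 * sqnorm ?M (\<lambda>x. c * S x)"
        by (rule sqnorm_diff_le[OF sz square_integrable_mult[OF sS]])
      then have "sqnorm ?M (\<lambda>x. yh x - y x) \<le> 2 * sqnorm ?M (\<lambda>x. yh x - y x + c * S x) + 2 * (c\<^sup>2 * sqnorm ?M S)"
        by (simp add: sqnorm_mult)
      also have "\<dots> \<le> 2 * (P * (Kz * ?\<eta>)) + 2 * (c\<^sup>2 * ?\<eta>)"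
      proof (intro add_mono mult_left_mono)
        have "sqnorm ?M (\<lambda>x. yh x - y x + c * S x) \<le> P * sqnorm ?M Gz"
          unfolding P_def using H10_Poincare[OF \<Omega>(1) B z(1)] by (simp add: Gz_def[abs_def])
        also have "\<dots> \<le> P * (Kz * ?\<eta>)" using nGz P0 by (rule mult_left_mono)
        finally show "sqnorm ?M (\<lambda>x. yh x - y x + c * S x) \<le> P * (Kz * ?\<eta>)" .
      qed (use small_S0 in auto)
      also have "\<dots> = 2 * (P * Kz + c\<^sup>2) * ?\<eta>" by (simp add: algebra_simps)
      also have "\<dots> \<le> 2 * (P * Kz + c\<^sup>2) * (\<mu> * ?m)" using \<eta> P0 Kz0 by (intro mult_left_mono) auto
      finally show ?thesis .
    qed
    \<comment> \<open>On E, \<zeta> is \<open>Gyh - r\<close> and X is \<open>Gp - q\<close>. The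
      three parts of \<zeta> are the oscillation of \<open>Gy\<close>, the remainder z of the
      ansatz, and the inexactness of the strip gradient.\<close>
    define \<zeta>1 where "\<zeta>1 x = ?\<chi> x *\<^sub>R (Gy x - u)" for x
    define \<zeta>2 where "\<zeta>2 x = ?\<chi> x *\<^sub>R Gz x" for x
    define \<zeta>3 where "\<zeta>3 x = c *\<^sub>R (?\<chi> x *\<^sub>R (GS x - ?\<chi> x *\<^sub>R n))" for x
    define \<zeta> where "\<zeta> x = (\<zeta>1 x + \<zeta>2 x) - \<zeta>3 x" for x
    define X where "X x = ?\<chi> x *\<^sub>R (Gp x - q)" for x
    have s\<zeta>1: "square_integrable ?M \<zeta>1" unfolding \<zeta>1_def
      by (intro square_integrable_indicator[OF _ E] square_integrable_diff square_integrable_const fin sGy)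
    have s\<zeta>2: "square_integrable ?M \<zeta>2" unfolding \<zeta>2_def by (intro square_integrable_indicator[OF _ E] sGz)
    have sGSe: "square_integrable ?M (\<lambda>x. GS x - ?\<chi> x *\<^sub>R n)" by (intro square_integrable_diff sGS n\<chi>)
    have s\<zeta>3: "square_integrable ?M \<zeta>3" unfolding \<zeta>3_def
      by (intro square_integrable_scaleR square_integrable_indicator[OF _ E] sGSe)
    have s\<zeta>: "square_integrable ?M \<zeta>" unfolding \<zeta>_def by (intro square_integrable_diff square_integrable_add s\<zeta>1 s\<zeta>2 s\<zeta>3)
    have sX: "square_integrable ?M X" unfolding X_def
      by (intro square_integrable_indicator[OF _ E] square_integrable_diff square_integrable_const fin sGp)
    have n\<zeta>: "sqnorm ?M \<zeta> \<le> K\<zeta> * ?\<eta>"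
    proof -
      have "sqnorm ?M \<zeta> \<le> 2 * sqnorm ?M (\<lambda>x. \<zeta>1 x + \<zeta>2 x) + 2 * sqnorm ?M \<zeta>3"
        unfolding \<zeta>_def by (rule sqnorm_diff_le[OF square_integrable_add[OF s\<zeta>1 s\<zeta>2] s\<zeta>3])
      moreover have "sqnorm ?M (\<lambda>x. \<zeta>1 x + \<zeta>2 x) \<le> 2 * sqnorm ?M \<zeta>1 + 2 * sqnorm ?M \<zeta>2" by (rule sqnorm_add_le[OF s\<zeta>1 s\<zeta>2])
      moreover have "sqnorm ?M \<zeta>1 \<le> ?\<eta>" using small_y by (simp add: \<zeta>1_def[abs_def])
      moreover have "sqnorm ?M \<zeta>2 \<le> Kz * ?\<eta>" using indicator_le[OF sGz] nGz by (simp add: \<zeta>2_def[abs_def])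
      moreover have "sqnorm ?M \<zeta>3 \<le> c\<^sup>2 * ?\<eta>"
        unfolding \<zeta>3_def sqnorm_scaleR using order_trans[OF indicator_le[OF sGSe] small_S] by (intro mult_left_mono) auto
      ultimately have "sqnorm ?M \<zeta> \<le> 4 * ?\<eta> + 4 * (Kz * ?\<eta>) + 2 * (c\<^sup>2 * ?\<eta>)" by linarith
      moreover have "0 \<le> c\<^sup>2 * ?\<eta>" using \<eta> by simp
      moreover have "K\<zeta> * ?\<eta> = 4 * ?\<eta> + 4 * (Kz * ?\<eta>) + 4 * (c\<^sup>2 * ?\<eta>)"
        unfolding K\<zeta>_def by (simp add: algebra_simps)
      ultimately show ?thesis by linarith
    qed
    have s\<delta>: "square_integrable ?M (\<lambda>x. (b - a x) *\<^sub>R H x)" "sqnorm ?M (\<lambda>x. (b - a x) *\<^sub>R H x) \<le> D * sqnorm ?M H"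
      if "square_integrable ?M H" for H :: "real^2 \<Rightarrow> real^2"
      using square_integrable_bounded_scaleR[OF that dm abs_d] sqnorm_bounded_scaleR_le[OF that dm abs_d]
      by (simp_all add: D_def power_mult_distrib)
    define Y1 where "Y1 x = (b - a x) *\<^sub>R (?\<chi> x *\<^sub>R q)" for x
    define Y2 where "Y2 x = (b - a x) *\<^sub>R X x" for x
    define Y3 where "Y3 x = (b - a x) *\<^sub>R (?\<chi> x *\<^sub>R r)" for x
    define A where "A x = ?\<chi> x *\<^sub>R (a x - a0)" for x
    define Y4 where "Y4 x = ?\<chi> x *\<^sub>R (r \<bullet> q)" for x
    have sY: "square_integrable ?M Y1" "square_integrable ?M Y2" "square_integrable ?M Y3" "square_integrable ?M Y4" "square_integrable ?M A"
      unfolding Y1_def Y2_def Y3_def Y4_def A_def by (intro s\<delta>(1) n\<chi> sX square_integrable_indicator[OF a_sq E])+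
    have nY1: "sqnorm ?M Y1 \<le> D * (norm q)\<^sup>2 * ?m" and nY3: "sqnorm ?M Y3 \<le> D * (norm r)\<^sup>2 * ?m"
      using s\<delta>(2)[OF n\<chi>[of q]] s\<delta>(2)[OF n\<chi>[of r]] unfolding Y1_def Y3_def sqnorm_indicator_const[OF E] by simp_all
    have nY2: "sqnorm ?M Y2 \<le> D * ?\<eta>"
      using s\<delta>(2)[OF sX] mult_left_mono[OF small_p, of D] unfolding Y2_def X_def[abs_def] by (simp add: D_def)
    have nY4: "sqnorm ?M Y4 = (r \<bullet> q)\<^sup>2 * ?m"
      unfolding Y4_def sqnorm_indicator_const[OF E] by simp
    \<comment> \<open>A factor of squared size \<mu>^2 |E| meets one that is only O(|E|); the weight
      \<mu> balances them and leaves \<mu> |E|.\<close>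
    have young: "\<bar>\<integral>x. F x \<bullet> G x \<partial>?M\<bar> \<le> (k + l) / 2 * (\<mu> * ?m)"
      if "square_integrable ?M F" "square_integrable ?M G" "sqnorm ?M F \<le> k * ?\<eta>" "sqnorm ?M G \<le> l * ?m"
      for F G :: "real^2 \<Rightarrow> 'b::euclidean_space" and k l
    proof -
      have "2 * \<bar>\<integral>x. F x \<bullet> G x \<partial>?M\<bar> \<le> sqnorm ?M F / \<mu> + \<mu> * sqnorm ?M G"
        by (rule integral_inner_le_sqnorm[OF that(1,2) \<mu>(1)])
      also have "\<dots> \<le> (k * ?\<eta>) / \<mu> + \<mu> * (l * ?m)"
        using that(3,4) \<mu> by (intro add_mono divide_right_mono mult_left_mono) auto
      also have "\<dots> = (k + l) * (\<mu> * ?m)" using \<mu> by (simp add: power2_eq_square field_simps)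
      finally show ?thesis by simp
    qed
    have b1: "\<bar>\<integral>x. \<zeta> x \<bullet> Y1 x \<partial>?M\<bar> \<le> (K\<zeta> + D * (norm q)\<^sup>2) / 2 * (\<mu> * ?m)"
      by (rule young[OF s\<zeta> sY(1) n\<zeta> nY1])
    have "D * ?\<eta> \<le> D * ?m"
      using \<mu> by (intro mult_left_mono) (auto simp: D_def power_le_one mult_left_le_one_le)
    with nY2 have nY2': "sqnorm ?M Y2 \<le> D * ?m" by linarith
    have b2: "\<bar>\<integral>x. \<zeta> x \<bullet> Y2 x \<partial>?M\<bar> \<le> (K\<zeta> + D) / 2 * (\<mu> * ?m)"
      by (rule young[OF s\<zeta> sY(2) n\<zeta> nY2'])
    have b3: "\<bar>\<integral>x. X x \<bullet> Y3 x \<partial>?M\<bar> \<le> (1 + D * (norm r)\<^sup>2) / 2 * (\<mu> * ?m)"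
      by (rule young[OF sX sY(3) _ nY3]) (use small_p in \<open>simp add: X_def[abs_def]\<close>)
    have b4: "\<bar>\<integral>x. A x \<bullet> Y4 x \<partial>?M\<bar> \<le> (1 + (r \<bullet> q)\<^sup>2) / 2 * (\<mu> * ?m)"
      by (rule young[OF sY(5,4)]) (use small_a nY4 in \<open>simp_all add: A_def[abs_def]\<close>)
    \<comment> \<open>Expands (b - a)(r + \<zeta>) . (q + X) on E. The leading term takes
      \<open>a0\<close> for \<open>a\<close>, and the product of A and Y4 corrects for that.\<close>
    have pointwise: "(ah x - a x) * (Gyh x \<bullet> Gp x) =
        ((b - a0) * (r \<bullet> q)) * ?\<chi> x + (\<zeta> x \<bullet> Y1 x + \<zeta> x \<bullet> Y2 x + X x \<bullet> Y3 x - A x \<bullet> Y4 x)" for x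
    proof (cases "x \<in> E")
      case True
      have Gyh: "Gyh x = r + \<zeta> x" using True
        by (simp add: r_def \<zeta>_def \<zeta>1_def \<zeta>2_def \<zeta>3_def Gz_def algebra_simps)
      have Gp: "Gp x = q + X x" using True by (simp add: X_def)
      show ?thesis using True unfolding Gyh Gp
        by (simp add: ah_def Y1_def Y2_def Y3_def Y4_def A_def inner_add_left inner_add_right inner_commute algebra_simps)
    next
      case False
      then show ?thesis by (simp add: ah_def Y1_def Y2_def Y3_def Y4_def A_def \<zeta>_def \<zeta>1_def \<zeta>2_def \<zeta>3_def X_def)
    qed
    have int: "integrable ?M (\<lambda>x. \<zeta> x \<bullet> Y1 x)" "integrable ?M (\<lambda>x. \<zeta> x \<bullet> Y2 x)" "integrable ?M (\<lambda>x. X x \<bullet> Y3 x)" "integrable ?M (\<lambda>x. A x \<bullet> Y4 x)"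
      by (intro integrable_inner s\<zeta> sX sY)+
    have int\<chi>: "integrable ?M (\<lambda>x. ((b - a0) * (r \<bullet> q)) * ?\<chi> x)" "(\<integral>x. ((b - a0) * (r \<bullet> q)) * ?\<chi> x \<partial>?M) = ((b - a0) * (r \<bullet> q)) * ?m"
      using E sets.sets_into_space[OF E] finite_measure.emeasure_finite[OF fin, of E] by (simp_all add: Int_absorb2 less_top[symmetric])
    have I: "(\<integral>x. (ah x - a x) * (Gyh x \<bullet> Gp x) \<partial>?M) = ((b - a0) * (r \<bullet> q)) * ?m +
       ((\<integral>x. \<zeta> x \<bullet> Y1 x \<partial>?M) + (\<integral>x. \<zeta> x \<bullet> Y2 x \<partial>?M) + (\<integral>x. X x \<bullet> Y3 x \<partial>?M) - (\<integral>x. A x \<bullet> Y4 x \<partial>?M))"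
      unfolding pointwise using int int\<chi> by simp
    have J: "(\<integral>x. (yh x - yd x)\<^sup>2 \<partial>?M) / 2 - (\<integral>x. (y x - yd x)\<^sup>2 \<partial>?M) / 2
       = - (\<integral>x. (ah x - a x) * (Gyh x \<bullet> Gp x) \<partial>?M) + sqnorm ?M (\<lambda>x. yh x - y x) / 2"
      by (rule state_difference_objective[OF \<Omega>(1) y _ p yd am abs_a ahm abs_ah]) (use yh in \<open>simp add: ah_def[abs_def]\<close>)
    have combine: "J \<le> - V + (k1 + k2 + k3 + k4) + k5"
      if "J = - I + W / 2" "I = V + (i1 + i2 + i3 - i4)" "\<bar>i1\<bar> \<le> k1" "\<bar>i2\<bar> \<le> k2" "\<bar>i3\<bar> \<le> k3" "\<bar>i4\<bar> \<le> k4" "W \<le> 2 * k5"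
      for J I W V i1 i2 i3 i4 k1 k2 k3 k4 k5 :: real
      using that by linarith
    have "(\<integral>x. (yh x - yd x)\<^sup>2 \<partial>?M) / 2 - (\<integral>x. (y x - yd x)\<^sup>2 \<partial>?M) / 2 \<le> - (((b - a0) * (r \<bullet> q)) * ?m) +
        ((K\<zeta> + D * (norm q)\<^sup>2) / 2 * (\<mu> * ?m) + (K\<zeta> + D) / 2 * (\<mu> * ?m) + (1 + D * (norm r)\<^sup>2) / 2 * (\<mu> * ?m)
         + (1 + (r \<bullet> q)\<^sup>2) / 2 * (\<mu> * ?m)) + (P * Kz + c\<^sup>2) * (\<mu> * ?m)"
      by (rule combine[OF J I b1 b2 b3 b4]) (use w in \<open>simp only: mult.assoc\<close>)
    also have "\<dots> = - ((b - a0) * (r \<bullet> q)) * ?m + K * \<mu> * ?m"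
      unfolding K_def by (simp only: distrib_right mult.assoc minus_mult_left)
    \<comment> \<open>Substituting \<open>r\<close> turns the single product into the first-order
      term and the strip term of the expansion.\<close>
    also have "- ((b - a0) * (r \<bullet> q)) = - (b - a0) * (u \<bullet> q) + (b - a0)\<^sup>2 / b * ((n \<bullet> u) * (n \<bullet> q))"
      using b0 by (simp add: r_def c_def inner_diff_left power2_eq_square field_simps)
    finally show "(\<integral>x. (yh x - yd x)\<^sup>2 \<partial>?M) / 2 - (\<integral>x. (y x - yd x)\<^sup>2 \<partial>?M) / 2
     \<le> (- (b - a0) * (u \<bullet> q) + (b - a0)\<^sup>2 / b * ((n \<bullet> u) * (n \<bullet> q))) * ?m + K * \<mu> * ?m" .
  qed
qed

section \<open>The optimality condition\<close>

lemma lsc_borel_measurable: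
  assumes "lsc g" shows "g \<in> borel_measurable borel"
proof (rule borel_measurableI_greater)
  fix c
  have "open {t. c < g t}" using assms by (auto simp: lsc_def)
  then show "{x \<in> space borel. c < g x} \<in> sets borel" by simp
qed

text \<open>Once g(a) has an integrable real representative, the difference of extended integrals is
  an ordinary integral. This gives feasibility of the competitor and lets the two objectives be
  compared in the reals.\<close>

lemma gint_eq_integral:
  assumes \<Omega>: "open \<Omega>" and \<gamma>: "integrable (lebesgue_on \<Omega>) \<gamma>" and eq: "AE x in lebesgue_on \<Omega>. g (a x) = ereal (\<gamma> x)"
  shows "gneg \<Omega> g a < \<infinity>" "gint \<Omega> g a = ereal (\<integral>x. \<gamma> x \<partial>lebesgue_on \<Omega>)"
proof -
  let ?M = "lebesgue_on \<Omega>"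
  have p: "gpos \<Omega> g a = (\<integral>\<^sup>+x. ennreal (\<gamma> x) \<partial>?M)"
  proof -
    have "gpos \<Omega> g a = (\<integral>\<^sup>+x. e2ennreal (g (a x)) \<partial>?M)"
      unfolding gpos_def using \<Omega> by (subst nn_integral_restrict_space) auto
    also have "\<dots> = (\<integral>\<^sup>+x. ennreal (\<gamma> x) \<partial>?M)"
      by (rule nn_integral_cong_AE) (use eq in eventually_elim, simp)
    finally show ?thesis .
  qed
  have n: "gneg \<Omega> g a = (\<integral>\<^sup>+x. ennreal (- \<gamma> x) \<partial>?M)"
  proof -
    have "gneg \<Omega> g a = (\<integral>\<^sup>+x. e2ennreal (- g (a x)) \<partial>?M)"
      unfolding gneg_def using \<Omega> by (subst nn_integral_restrict_space) auto
    also have "\<dots> = (\<integral>\<^sup>+x. ennreal (- \<gamma> x) \<partial>?M)"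
      by (rule nn_integral_cong_AE) (use eq in eventually_elim, simp)
    finally show ?thesis .
  qed
  have fin: "(\<integral>\<^sup>+x. ennreal (\<gamma> x) \<partial>?M) \<noteq> \<infinity>" "(\<integral>\<^sup>+x. ennreal (- \<gamma> x) \<partial>?M) \<noteq> \<infinity>"
    using \<gamma> by (simp_all add: real_integrable_def)
  then show "gneg \<Omega> g a < \<infinity>" unfolding n by (simp add: less_top)
  obtain r where r: "(\<integral>\<^sup>+x. ennreal (\<gamma> x) \<partial>?M) = ennreal r" "r \<ge> 0" using fin(1) by (cases rule: ennreal_cases) auto
  obtain s where s: "(\<integral>\<^sup>+x. ennreal (- \<gamma> x) \<partial>?M) = ennreal s" "s \<ge> 0" using fin(2) by (cases rule: ennreal_cases) auto
  show "gint \<Omega> g a = ereal (\<integral>x. \<gamma> x \<partial>?M)"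
    unfolding gint_def p n real_lebesgue_integral_def[OF \<gamma>] r(1) s(1) using r(2) s(2)
    by (simp add: enn2ereal_ennreal enn2real_ennreal)
qed

text \<open>With a finite negative part, an infinite positive part would make the whole integral
  infinite. Hence both parts are finite, and g(a) is finite almost everywhere.\<close>

lemma finite_gint_integrable:
  assumes \<Omega>: "open \<Omega>" and g: "g \<in> borel_measurable borel" "\<forall>t. g t \<noteq> -\<infinity>"
    and a: "a \<in> borel_measurable (lebesgue_on \<Omega>)" and neg: "gneg \<Omega> g a < \<infinity>" and fin: "gint \<Omega> g a < \<infinity>"
  shows "integrable (lebesgue_on \<Omega>) (\<lambda>x. real_of_ereal (g (a x)))"
    "AE x in lebesgue_on \<Omega>. g (a x) = ereal (real_of_ereal (g (a x)))"
proof -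
  let ?M = "lebesgue_on \<Omega>"
  have ga: "(\<lambda>x. g (a x)) \<in> borel_measurable ?M" using measurable_compose[OF a g(1)] .
  have pos: "gpos \<Omega> g a < \<infinity>"
  proof (rule ccontr)
    assume "\<not> gpos \<Omega> g a < \<infinity>"
    then have "gpos \<Omega> g a = \<infinity>" by (simp add: less_top[symmetric])
    moreover obtain s where "gneg \<Omega> g a = ennreal s" "s \<ge> 0" using neg by (cases "gneg \<Omega> g a" rule: ennreal_cases) auto
    ultimately show False using fin by (simp add: gint_def enn2ereal_ennreal)
  qed
  have p: "gpos \<Omega> g a = (\<integral>\<^sup>+x. e2ennreal (g (a x)) \<partial>?M)"
    unfolding gpos_def using \<Omega> by (subst nn_integral_restrict_space) auto
  have n: "gneg \<Omega> g a = (\<integral>\<^sup>+x. e2ennreal (- g (a x)) \<partial>?M)"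
    unfolding gneg_def using \<Omega> by (subst nn_integral_restrict_space) auto
  have m: "(\<lambda>x. e2ennreal (g (a x))) \<in> borel_measurable ?M" using ga by measurable
  have "AE x in ?M. e2ennreal (g (a x)) \<noteq> \<infinity>"
    using pos m unfolding p by (intro nn_integral_noteq_infinite) auto
  then show eq: "AE x in ?M. g (a x) = ereal (real_of_ereal (g (a x)))"
  proof eventually_elim
    fix x assume "e2ennreal (g (a x)) \<noteq> \<infinity>"
    then have "g (a x) \<noteq> \<infinity>" by auto
    then show "g (a x) = ereal (real_of_ereal (g (a x)))" using g(2) by (cases "g (a x)") auto
  qed
  have "(\<integral>\<^sup>+x. ennreal (real_of_ereal (g (a x))) \<partial>?M) = gpos \<Omega> g a"
    unfolding p by (rule nn_integral_cong_AE) (use eq in eventually_elim, metis e2ennreal_ereal)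
  moreover have "(\<integral>\<^sup>+x. ennreal (- real_of_ereal (g (a x))) \<partial>?M) = gneg \<Omega> g a"
    unfolding n by (rule nn_integral_cong_AE) (use eq in eventually_elim, metis e2ennreal_ereal uminus_ereal.simps(1))
  ultimately show "integrable ?M (\<lambda>x. real_of_ereal (g (a x)))"
    unfolding real_integrable_def using pos neg ga by auto
qed

text \<open>The value is the smaller eigenvalue of the symmetric part of u q^T, and |q| u - |u| q is
  an eigenvector for it. The identity is proved in the form homogeneous in v, and v is normalized at
  the end.\<close>

lemma optimal_direction:
  fixes u q :: "real^2"
  obtains n where "norm n = 1" "(n \<bullet> u) * (n \<bullet> q) = 1/2 * (u \<bullet> q - norm u * norm q)"
proof -
  have "\<exists>v. v \<noteq> 0 \<and> (v \<bullet> u) * (v \<bullet> q) = 1/2 * (u \<bullet> q - norm u * norm q) * (v \<bullet> v)"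
  proof (cases "norm q *\<^sub>R u = norm u *\<^sub>R q")
    case True
    \<comment> \<open>Equality in Cauchy-Schwarz: the eigenvector formula degenerates to 0, but the
      required value is 0 as well and any vector orthogonal to u attains it.\<close>
    have uq: "u \<bullet> q = norm u * norm q" using norm_cauchy_schwarz_eq[of u q] True by simp
    show ?thesis
    proof (cases "u = 0")
      case True
      then show ?thesis by (intro exI[of _ "axis 1 1"]) (simp add: axis_eq_0_iff)
    next
      case False
      have "rot u \<noteq> 0" using False norm_rot[of u] by auto
      moreover have "rot u \<bullet> u = 0" by (simp add: rot_inner)
      ultimately show ?thesis using uq by (intro exI[of _ "rot u"]) simp
    qed
  next
    case False
    define v where "v = norm q *\<^sub>R u - norm u *\<^sub>R q"
    have v: "v \<noteq> 0" using False by (simp add: v_def)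
    let ?a = "norm u" and ?b = "norm q" and ?s = "u \<bullet> q"
    have uu: "u \<bullet> u = ?a * ?a" "q \<bullet> q = ?b * ?b" by (simp_all add: dot_square_norm power2_eq_square)
    have vals: "v \<bullet> u = ?a * (?a * ?b - ?s)" "v \<bullet> q = ?b * (?s - ?a * ?b)" "v \<bullet> v = 2 * ?a * ?b * (?a * ?b - ?s)"
      unfolding v_def inner_diff_left inner_diff_right inner_scaleR_left inner_scaleR_right inner_commute[of q u] uu
      by (simp_all add: algebra_simps)
    have "(v \<bullet> u) * (v \<bullet> q) = 1/2 * (?s - ?a * ?b) * (v \<bullet> v)" unfolding vals by (simp add: algebra_simps)
    then show ?thesis using v by blast
  qed
  then obtain v where v: "v \<noteq> 0" "(v \<bullet> u) * (v \<bullet> q) = 1/2 * (u \<bullet> q - norm u * norm q) * (v \<bullet> v)" by blast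
  show thesis
  proof
    show "norm (v /\<^sub>R norm v) = 1" using v(1) by simp
    have "v \<bullet> v = norm v * norm v" by (simp add: dot_square_norm power2_eq_square)
    then have "(v \<bullet> u) * (v \<bullet> q) / (norm v * norm v) = 1/2 * (u \<bullet> q - norm u * norm q)"
      using v by simp
    then show "((v /\<^sub>R norm v) \<bullet> u) * ((v /\<^sub>R norm v) \<bullet> q) = 1/2 * (u \<bullet> q - norm u * norm q)"
      unfolding inner_scaleR_left by (simp add: field_simps)
  qed
qed

lemma sqnorm_indicator_mono:
  assumes sets: "E \<in> sets M" "Q \<in> sets M" and sub: "E \<subseteq> Q" and f: "square_integrable M f"
    and le: "(\<integral>x. indicat_real Q x * norm (f x) ^ 2 \<partial>M) \<le> \<eta>"
  shows "sqnorm M (\<lambda>x. indicat_real E x *\<^sub>R f x) \<le> \<eta>"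
proof -
  have "sqnorm M (\<lambda>x. indicat_real E x *\<^sub>R f x) \<le> (\<integral>x. indicat_real Q x * norm (f x) ^ 2 \<partial>M)"
    unfolding sqnorm_def
  proof (rule integral_mono')
    show "integrable M (\<lambda>x. indicat_real Q x * norm (f x) ^ 2)"
      using integrable_mult_indicator[OF sets(2) square_integrableD(2)[OF f]] by simp
  qed (use sub in \<open>auto simp: indicator_def\<close>)
  with le show ?thesis by linarith
qed

theorem mainTheorem18:
  fixes \<Omega> :: "(real^2) set" and \<alpha> :: real and yd f :: "real^2 \<Rightarrow> real"
    and g :: "real \<Rightarrow> ereal" and a y p :: "real^2 \<Rightarrow> real" and Gy Gp :: "real^2 \<Rightarrow> real^2"
  assumes dom: "open \<Omega>" "connected \<Omega>" "bounded \<Omega>" "\<Omega> \<noteq> {}"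
    and alpha: "\<alpha> > 0"
    and data: "L2 \<Omega> yd" "L2 \<Omega> f"
    and g_lsc: "lsc g" and g_nonneginf: "\<forall>t. g t \<noteq> -\<infinity>"
    and a_feas: "feasible \<alpha> \<Omega> g a"
    and state: "is_state \<Omega> a f y Gy"
    and adjoint: "is_adjoint \<Omega> a y yd p Gp"
    and finite_obj: "Jt \<Omega> yd g y a < \<infinity>"
    and local_sol: "\<exists>\<epsilon>>0. \<forall>ah yh Gyh. feasible \<alpha> \<Omega> g ah \<and> L1dist \<Omega> ah a < ennreal \<epsilon>
                      \<and> is_state \<Omega> ah f yh Gyh \<longrightarrow> Jt \<Omega> yd g y a \<le> Jt \<Omega> yd g yh ah"
  shows "AE x0 in lebesgue_on \<Omega>. \<forall>b\<ge>\<alpha>.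
           ereal (- (b - a x0) * (Gy x0 \<bullet> Gp x0)
                  + 1/2 * (b - a x0)\<^sup>2 / b * (Gy x0 \<bullet> Gp x0 - norm (Gy x0) * norm (Gp x0)))
           + g b - g (a x0) \<ge> 0"
proof -
  let ?M = "lebesgue_on \<Omega>"
  note \<Omega> = dom(1,3)
  have fin: "finite_measure ?M" by (rule finite_measure_lebesgue_on[OF \<Omega>])
  have sqd: "square_integrable ?M yd" "square_integrable ?M f"
    using data by (simp_all add: L2_def square_integrable_def)
  obtain C0 where am: "a \<in> borel_measurable ?M" and aC0: "AE x in ?M. \<alpha> \<le> a x \<and> a x \<le> C0"
    using a_feas unfolding feasible_def admissible_def by blast
  have abs_a: "AE x in ?M. \<bar>a x\<bar> \<le> C0" using aC0 by eventually_elim (use alpha in auto)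
  define \<gamma> where "\<gamma> x = real_of_ereal (g (a x))" for x
  have gint_fin: "gint \<Omega> g a < \<infinity>" using finite_obj unfolding Jt_def by auto
  have gneg_fin: "gneg \<Omega> g a < \<infinity>" using a_feas unfolding feasible_def by blast
  have \<gamma>: "integrable ?M \<gamma>" and \<gamma>_eq: "AE x in ?M. g (a x) = ereal (\<gamma> x)"
    using finite_gint_integrable[OF dom(1) lsc_borel_measurable[OF g_lsc] g_nonneginf am gneg_fin gint_fin]
    unfolding \<gamma>_def by auto
  obtain \<epsilon> where \<epsilon>: "\<epsilon> > 0" and opt: "\<And>ah yh Gyh. feasible \<alpha> \<Omega> g ah \<Longrightarrow> L1dist \<Omega> ah a < ennreal \<epsilon> \<Longrightarrow>
      is_state \<Omega> ah f yh Gyh \<Longrightarrow> Jt \<Omega> yd g y a \<le> Jt \<Omega> yd g yh ah" using local_sol by blast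
  have sGy: "square_integrable ?M Gy" and sGp: "square_integrable ?M Gp"
    using state adjoint H10_square_integrable(2)[OF dom(1)] unfolding is_state_def is_adjoint_def by blast+
  have sa: "square_integrable ?M a"
    using square_integrable_bounded_scaleR[OF square_integrable_const[OF fin, of "1::real"] am abs_a] by simp
  have leb2: "AE x in ?M. \<forall>e>0. \<exists>d>0. \<forall>h. 0 < h \<and> h < d \<longrightarrow> cbox x (x + h *\<^sub>R One) \<subseteq> \<Omega> \<and>
      (\<integral>y. indicat_real (cbox x (x + h *\<^sub>R One)) y * norm (F y - F x) ^ 2 \<partial>?M) \<le> e * h\<^sup>2"
    if "square_integrable ?M F" for F :: "real^2 \<Rightarrow> 'b::euclidean_space"
    using that by (intro strong_lebesgue_point[OF dom(1)] square_integrableD square_integrable_diff square_integrable_const fin) auto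
  have leb1: "AE x in ?M. \<forall>e>0. \<exists>d>0. \<forall>h. 0 < h \<and> h < d \<longrightarrow> cbox x (x + h *\<^sub>R One) \<subseteq> \<Omega> \<and>
      (\<integral>y. indicat_real (cbox x (x + h *\<^sub>R One)) y * norm (\<gamma> y - \<gamma> x) ^ 1 \<partial>?M) \<le> e * h\<^sup>2"
    using \<gamma> by (intro strong_lebesgue_point[OF dom(1)])
      (auto intro!: Bochner_Integration.integrable_diff finite_measure.integrable_const[OF fin])
  \<comment> \<open>None of these six almost-everywhere conditions mentions b, so the quantifier
    over b can stay inside.\<close>
  from leb2[OF sGy] leb2[OF sGp] leb2[OF sa] leb1 aC0 \<gamma>_eq show ?thesis
  proof eventually_elim
    fix x0
    assume leb_y: "\<forall>e>0. \<exists>d>0. \<forall>h. 0 < h \<and> h < d \<longrightarrow> cbox x0 (x0 + h *\<^sub>R One) \<subseteq> \<Omega> \<and>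
        (\<integral>y. indicat_real (cbox x0 (x0 + h *\<^sub>R One)) y * norm (Gy y - Gy x0) ^ 2 \<partial>?M) \<le> e * h\<^sup>2"
      and leb_p: "\<forall>e>0. \<exists>d>0. \<forall>h. 0 < h \<and> h < d \<longrightarrow> cbox x0 (x0 + h *\<^sub>R One) \<subseteq> \<Omega> \<and>
        (\<integral>y. indicat_real (cbox x0 (x0 + h *\<^sub>R One)) y * norm (Gp y - Gp x0) ^ 2 \<partial>?M) \<le> e * h\<^sup>2"
      and leb_a: "\<forall>e>0. \<exists>d>0. \<forall>h. 0 < h \<and> h < d \<longrightarrow> cbox x0 (x0 + h *\<^sub>R One) \<subseteq> \<Omega> \<and>
        (\<integral>y. indicat_real (cbox x0 (x0 + h *\<^sub>R One)) y * norm (a y - a x0) ^ 2 \<partial>?M) \<le> e * h\<^sup>2"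
      and leb_\<gamma>: "\<forall>e>0. \<exists>d>0. \<forall>h. 0 < h \<and> h < d \<longrightarrow> cbox x0 (x0 + h *\<^sub>R One) \<subseteq> \<Omega> \<and>
        (\<integral>y. indicat_real (cbox x0 (x0 + h *\<^sub>R One)) y * norm (\<gamma> y - \<gamma> x0) ^ 1 \<partial>?M) \<le> e * h\<^sup>2"
      and a0: "\<alpha> \<le> a x0 \<and> a x0 \<le> C0" and g0: "g (a x0) = ereal (\<gamma> x0)"
    show "\<forall>b\<ge>\<alpha>. ereal (- (b - a x0) * (Gy x0 \<bullet> Gp x0)
                  + 1/2 * (b - a x0)\<^sup>2 / b * (Gy x0 \<bullet> Gp x0 - norm (Gy x0) * norm (Gp x0)))
           + g b - g (a x0) \<ge> 0"
    proof (intro allI impI)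
      fix b assume b: "\<alpha> \<le> b"
      define V where "V = - (b - a x0) * (Gy x0 \<bullet> Gp x0)
                  + 1/2 * (b - a x0)\<^sup>2 / b * (Gy x0 \<bullet> Gp x0 - norm (Gy x0) * norm (Gp x0))"
      show "ereal (- (b - a x0) * (Gy x0 \<bullet> Gp x0)
                  + 1/2 * (b - a x0)\<^sup>2 / b * (Gy x0 \<bullet> Gp x0 - norm (Gy x0) * norm (Gp x0)))
           + g b - g (a x0) \<ge> 0"
        unfolding V_def[symmetric] g0
      \<comment> \<open>If g b is infinite the inequality is trivial because g(a x0) is finite; only
        a finite value calls for a perturbation.\<close>
      proof (cases "g b")
        case (real gb)
        obtain n where n: "norm n = 1" and nn: "(n \<bullet> Gy x0) * (n \<bullet> Gp x0) = 1/2 * (Gy x0 \<bullet> Gp x0 - norm (Gy x0) * norm (Gp x0))"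
          by (rule optimal_direction)
        have V_n: "V = - (b - a x0) * (Gy x0 \<bullet> Gp x0) + (b - a x0)\<^sup>2 / b * ((n \<bullet> Gy x0) * (n \<bullet> Gp x0))"
          unfolding V_def nn by simp
        \<comment> \<open>One bound for the old and the perturbed coefficient, as the estimates
          require.\<close>
        define C where "C = max C0 b"
        have C: "b \<le> C" "C0 \<le> C" "C > 0" "\<bar>a x0\<bar> \<le> C" using a0 b alpha by (auto simp: C_def)
        have aC: "AE x in ?M. \<alpha> \<le> a x \<and> a x \<le> C" using aC0 by eventually_elim (use C in auto)
        obtain K where K: "\<And>E yh Gyh S GS \<mu>.
          \<lbrakk>E \<in> sets ?M; is_state \<Omega> (\<lambda>x. if x \<in> E then b else a x) f yh Gyh; H10 \<Omega> S GS; 0 < \<mu>; \<mu> \<le> 1;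
           sqnorm ?M (\<lambda>x. indicat_real E x *\<^sub>R (Gy x - Gy x0)) \<le> \<mu>\<^sup>2 * measure ?M E;
           sqnorm ?M (\<lambda>x. indicat_real E x *\<^sub>R (Gp x - Gp x0)) \<le> \<mu>\<^sup>2 * measure ?M E;
           sqnorm ?M (\<lambda>x. indicat_real E x *\<^sub>R (a x - a x0)) \<le> \<mu>\<^sup>2 * measure ?M E;
           sqnorm ?M (\<lambda>x. GS x - indicat_real E x *\<^sub>R n) \<le> \<mu>\<^sup>2 * measure ?M E;
           sqnorm ?M S \<le> \<mu>\<^sup>2 * measure ?M E\<rbrakk> \<Longrightarrow>
          (\<integral>x. (yh x - yd x)\<^sup>2 \<partial>?M) / 2 - (\<integral>x. (y x - yd x)\<^sup>2 \<partial>?M) / 2 \<le> V * measure ?M E + K * \<mu> * measure ?M E"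
          by (rule strip_objective_estimate[OF \<Omega> alpha am aC b C(1,4) n sqd(1) state adjoint, of "Gy x0" "Gp x0", folded V_n])
             (erule that)
        \<comment> \<open>Order of choices: \<mu> fixes the profile and thereby \<theta>, and only
          then is R taken small depending on both. K precedes all of them.\<close>
        have main: "0 \<le> V + gb - \<gamma> x0 + (K + 1) * \<mu>" if \<mu>: "0 < \<mu>" "\<mu> \<le> 1" for \<mu>
        proof -
          have "\<mu>\<^sup>2 > 0" using \<mu> by simp
          obtain \<theta> where \<theta>: "\<theta> > 0" and profile: "\<And>\<Omega> x0 R. open \<Omega> \<Longrightarrow> R > 0 \<Longrightarrow> cbox x0 (x0 + R *\<^sub>R One) \<subseteq> \<Omega> \<Longrightarrow>
            \<exists>S E. Cc_inf \<Omega> S \<and> E \<in> sets lebesgue \<and> E \<subseteq> cbox x0 (x0 + R *\<^sub>R One) \<and> measure lebesgue E = \<theta> * R\<^sup>2 \<and>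
              sqnorm (lebesgue_on \<Omega>) (\<lambda>x. grad S x - indicat_real E x *\<^sub>R n) \<le> \<mu>\<^sup>2 * measure lebesgue E \<and>
              sqnorm (lebesgue_on \<Omega>) S \<le> 16 * R ^ 4"
            by (rule thin_strip_profile[OF n \<open>\<mu>\<^sup>2 > 0\<close>]) (erule that[rotated])
          \<comment> \<open>The tolerances carry \<theta> so that errors over the whole square, of
            area R^2, become small relative to the strip area \<theta> R^2.\<close>
          have \<mu>\<theta>: "\<mu>\<^sup>2 * \<theta> > 0" "\<mu> * \<theta> > 0" using \<mu> \<theta> by simp_all
          from leb_y[rule_format, OF \<mu>\<theta>(1)] obtain d1 where d1: "d1 > 0" "\<forall>h. 0 < h \<and> h < d1 \<longrightarrow> cbox x0 (x0 + h *\<^sub>R One) \<subseteq> \<Omega> \<and>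
              (\<integral>y. indicat_real (cbox x0 (x0 + h *\<^sub>R One)) y * norm (Gy y - Gy x0) ^ 2 \<partial>?M) \<le> \<mu>\<^sup>2 * \<theta> * h\<^sup>2"
            by (elim exE conjE) (rule that)
          from leb_p[rule_format, OF \<mu>\<theta>(1)] obtain d2 where d2: "d2 > 0" "\<forall>h. 0 < h \<and> h < d2 \<longrightarrow> cbox x0 (x0 + h *\<^sub>R One) \<subseteq> \<Omega> \<and>
              (\<integral>y. indicat_real (cbox x0 (x0 + h *\<^sub>R One)) y * norm (Gp y - Gp x0) ^ 2 \<partial>?M) \<le> \<mu>\<^sup>2 * \<theta> * h\<^sup>2"
            by (elim exE conjE) (rule that)
          from leb_a[rule_format, OF \<mu>\<theta>(1)] obtain d3 where d3: "d3 > 0" "\<forall>h. 0 < h \<and> h < d3 \<longrightarrow> cbox x0 (x0 + h *\<^sub>R One) \<subseteq> \<Omega> \<and>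
              (\<integral>y. indicat_real (cbox x0 (x0 + h *\<^sub>R One)) y * norm (a y - a x0) ^ 2 \<partial>?M) \<le> \<mu>\<^sup>2 * \<theta> * h\<^sup>2"
            by (elim exE conjE) (rule that)
          from leb_\<gamma>[rule_format, OF \<mu>\<theta>(2)] obtain d4 where d4: "d4 > 0" "\<forall>h. 0 < h \<and> h < d4 \<longrightarrow> cbox x0 (x0 + h *\<^sub>R One) \<subseteq> \<Omega> \<and>
              (\<integral>y. indicat_real (cbox x0 (x0 + h *\<^sub>R One)) y * norm (\<gamma> y - \<gamma> x0) ^ 1 \<partial>?M) \<le> \<mu> * \<theta> * h\<^sup>2"
            by (elim exE conjE) (rule that)
          \<comment> \<open>R below d1 to d4 serves the Lebesgue points; the next condition makes
            the L^2 norm of S small relative to |E|; the last keeps the competitor in the L^1 ball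
            of optimality, since the coefficients differ by at most 2C and only on E.\<close>
          obtain R where R: "0 < R" "R < d1" "R < d2" "R < d3" "R < d4" "16 * R\<^sup>2 < \<mu>\<^sup>2 * \<theta>" "2 * C * (\<theta> * R\<^sup>2) < \<epsilon>"
          proof -
            have "((\<lambda>R. R) \<longlongrightarrow> 0) (at_right (0::real))" by (rule tendsto_ident_at)
            note lt = order_tendstoD(2)[OF this]
            have "((\<lambda>R. 16 * R\<^sup>2) \<longlongrightarrow> 16 * 0\<^sup>2) (at_right (0::real))" by (intro tendsto_intros)
            then have l1: "((\<lambda>R. 16 * R\<^sup>2) \<longlongrightarrow> 0) (at_right (0::real))" by simp
            have "((\<lambda>R. 2 * C * (\<theta> * R\<^sup>2)) \<longlongrightarrow> 2 * C * (\<theta> * 0\<^sup>2)) (at_right (0::real))" by (intro tendsto_intros)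
            then have l2: "((\<lambda>R. 2 * C * (\<theta> * R\<^sup>2)) \<longlongrightarrow> 0) (at_right (0::real))" by simp
            have "eventually (\<lambda>R. 0 < R \<and> R < d1 \<and> R < d2 \<and> R < d3 \<and> R < d4 \<and> 16 * R\<^sup>2 < \<mu>\<^sup>2 * \<theta> \<and> 2 * C * (\<theta> * R\<^sup>2) < \<epsilon>) (at_right (0::real))"
              by (intro eventually_conj lt d1(1) d2(1) d3(1) d4(1) eventually_at_right_less
                  order_tendstoD(2)[OF l1 \<mu>\<theta>(1)] order_tendstoD(2)[OF l2 \<epsilon>])
            then have "\<exists>R. 0 < R \<and> R < d1 \<and> R < d2 \<and> R < d3 \<and> R < d4 \<and> 16 * R\<^sup>2 < \<mu>\<^sup>2 * \<theta> \<and> 2 * C * (\<theta> * R\<^sup>2) < \<epsilon>"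
              by (rule eventually_happens'[rotated]) simp
            then show thesis using that by blast
          qed
          let ?Q = "cbox x0 (x0 + R *\<^sub>R One)"
          have Q\<Omega>: "?Q \<subseteq> \<Omega>" using d1(2) R(1,2) by blast
          note Q = measure_small_cbox[OF dom(1) R(1) Q\<Omega>]
          obtain S E where S: "Cc_inf \<Omega> S" and E: "E \<in> sets lebesgue" "E \<subseteq> ?Q" "measure lebesgue E = \<theta> * R\<^sup>2"
            and errS: "sqnorm ?M (\<lambda>x. grad S x - indicat_real E x *\<^sub>R n) \<le> \<mu>\<^sup>2 * measure lebesgue E"
            and nS: "sqnorm ?M S \<le> 16 * R ^ 4"
            using profile[OF dom(1) R(1) Q\<Omega>] by blast
          have E\<Omega>: "E \<subseteq> \<Omega>" using E(2) Q\<Omega> by (rule subset_trans)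
          have EM: "E \<in> sets ?M" using dom(1) E(1) E\<Omega> by (simp add: sets_restrict_space_iff)
          define m where "m = measure ?M E"
          have m_eq: "measure lebesgue E = m" unfolding m_def using dom(1) E\<Omega> by (simp add: measure_restrict_space)
          have m: "m = \<theta> * R\<^sup>2" using E(3) m_eq by simp
          have m0: "m > 0" using m \<theta> R(1) by simp
          have iE: "integrable ?M (indicat_real E)" "(\<integral>x. indicat_real E x \<partial>?M) = m"
            using EM finite_measure.emeasure_finite[OF fin, of E] sets.sets_into_space[OF EM]
            by (simp_all add: m_def Int_absorb2 less_top[symmetric])
          define ah where "ah x = (if x \<in> E then b else a x)" for x
          have ahm: "ah \<in> borel_measurable ?M" unfolding ah_def using EM am by (intro measurable_If_set) auto
          have ahC: "AE x in ?M. \<alpha> \<le> ah x \<and> ah x \<le> C" using aC by eventually_elim (use b C in \<open>auto simp: ah_def\<close>)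
          have adm: "admissible \<alpha> \<Omega> ah" unfolding admissible_def using ahm ahC by blast
          obtain yh Gyh where yh: "is_state \<Omega> ah f yh Gyh"
            by (rule state_exists[OF \<Omega> sqd(2) alpha adm])
          define \<gamma>h where "\<gamma>h x = \<gamma> x + indicat_real E x * (gb - \<gamma> x)" for x
          have i\<gamma>E: "integrable ?M (\<lambda>x. indicat_real E x * (gb - \<gamma> x))"
            using integrable_mult_indicator[OF EM, of "\<lambda>x. gb - \<gamma> x"] \<gamma> finite_measure.integrable_const[OF fin, of gb] by simp
          have i\<gamma>h: "integrable ?M \<gamma>h" unfolding \<gamma>h_def using \<gamma> i\<gamma>E by simp
          have \<gamma>h_eq: "AE x in ?M. g (ah x) = ereal (\<gamma>h x)"
            using \<gamma>_eq by eventually_elim (use real in \<open>auto simp: ah_def \<gamma>h_def\<close>)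
          note gh = gint_eq_integral[OF dom(1) i\<gamma>h \<gamma>h_eq]
          have feas: "feasible \<alpha> \<Omega> g ah" unfolding feasible_def using adm gh(1) by blast
          have dist: "L1dist \<Omega> ah a < ennreal \<epsilon>"
          proof -
            have "L1dist \<Omega> ah a = (\<integral>\<^sup>+x. ennreal \<bar>ah x - a x\<bar> \<partial>?M)"
              unfolding L1dist_def using dom(1) by (subst nn_integral_restrict_space) auto
            also have "\<dots> \<le> (\<integral>\<^sup>+x. ennreal (2 * C * indicat_real E x) \<partial>?M)"
              by (rule nn_integral_mono_AE, use aC in eventually_elim) (use b alpha C in \<open>auto simp: ah_def intro!: ennreal_leI\<close>)
            also have "\<dots> = ennreal (\<integral>x. 2 * C * indicat_real E x \<partial>?M)"
              using iE(1) C(3) by (intro nn_integral_eq_integral) auto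
            also have "(\<integral>x. 2 * C * indicat_real E x \<partial>?M) = 2 * C * m" using iE by simp
            also have "ennreal (2 * C * m) < ennreal \<epsilon>" using R(7) C(3) m0 \<epsilon> unfolding m[symmetric] by (intro ennreal_lessI) auto
            finally show ?thesis .
          qed
          have "Jt \<Omega> yd g y a \<le> Jt \<Omega> yd g yh ah" by (rule opt[OF feas dist yh])
          then have J: "(\<integral>x. (y x - yd x)\<^sup>2 \<partial>?M) / 2 + (\<integral>x. \<gamma> x \<partial>?M) \<le> (\<integral>x. (yh x - yd x)\<^sup>2 \<partial>?M) / 2 + (\<integral>x. \<gamma>h x \<partial>?M)"
            unfolding Jt_def gh(2) gint_eq_integral(2)[OF dom(1) \<gamma> \<gamma>_eq] by simp
          \<comment> \<open>On E the value at x is replaced by the value at \<open>x0\<close>; the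
            oscillation is then integrated over the larger square, which the tolerance \<mu>
            \<theta> R^2 = \<mu> |E| permits.\<close>
          have \<gamma>diff: "(\<integral>x. \<gamma>h x \<partial>?M) - (\<integral>x. \<gamma> x \<partial>?M) \<le> (gb - \<gamma> x0) * m + \<mu> * m"
          proof -
            have iQ: "integrable ?M (\<lambda>x. indicat_real ?Q x * norm (\<gamma> x - \<gamma> x0) ^ 1)"
              using integrable_mult_indicator[OF Q(1), of "\<lambda>x. norm (\<gamma> x - \<gamma> x0)"] \<gamma> finite_measure.integrable_const[OF fin, of "\<gamma> x0"] by simp
            have "(\<integral>x. \<gamma>h x \<partial>?M) - (\<integral>x. \<gamma> x \<partial>?M) = (\<integral>x. indicat_real E x * (gb - \<gamma> x) \<partial>?M)"
              unfolding \<gamma>h_def using \<gamma> i\<gamma>E by simp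
            also have "\<dots> \<le> (\<integral>x. (gb - \<gamma> x0) * indicat_real E x + indicat_real ?Q x * norm (\<gamma> x - \<gamma> x0) ^ 1 \<partial>?M)"
            proof (rule integral_mono[OF i\<gamma>E])
              show "integrable ?M (\<lambda>x. (gb - \<gamma> x0) * indicat_real E x + indicat_real ?Q x * norm (\<gamma> x - \<gamma> x0) ^ 1)"
                using iE(1) iQ by simp
              fix x
              show "indicat_real E x * (gb - \<gamma> x) \<le> (gb - \<gamma> x0) * indicat_real E x + indicat_real ?Q x * norm (\<gamma> x - \<gamma> x0) ^ 1"
              proof (cases "x \<in> E")
                case True
                then have "x \<in> ?Q" using E(2) by blast
                then show ?thesis using True by simp
              qed (simp add: indicator_def)
            qed
            also have "\<dots> = (gb - \<gamma> x0) * m + (\<integral>x. indicat_real ?Q x * norm (\<gamma> x - \<gamma> x0) ^ 1 \<partial>?M)"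
              using iE iQ by simp
            also have "\<dots> \<le> (gb - \<gamma> x0) * m + \<mu> * m"
              using d4(2)[rule_format, OF conjI[OF R(1,5)]] m by (simp add: mult.assoc)
            finally show ?thesis .
          qed
          have "(\<integral>x. (yh x - yd x)\<^sup>2 \<partial>?M) / 2 - (\<integral>x. (y x - yd x)\<^sup>2 \<partial>?M) / 2 \<le> V * m + K * \<mu> * m"
          proof (rule K[OF EM _ Cc_inf_H10[OF dom(1) S] \<mu>, folded m_def])
            show "is_state \<Omega> (\<lambda>x. if x \<in> E then b else a x) f yh Gyh" using yh unfolding ah_def[abs_def] .
            have sc: "square_integrable ?M (\<lambda>x. F x - v)" if "square_integrable ?M F" for F :: "real^2 \<Rightarrow> 'b::euclidean_space" and v
              by (intro square_integrable_diff that square_integrable_const fin)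
            show "sqnorm ?M (\<lambda>x. indicat_real E x *\<^sub>R (Gy x - Gy x0)) \<le> \<mu>\<^sup>2 * m"
              by (rule sqnorm_indicator_mono[OF EM Q(1) E(2) sc[OF sGy]])
                 (use d1(2)[rule_format, OF conjI[OF R(1,2)]] m in \<open>simp add: mult.assoc\<close>)
            show "sqnorm ?M (\<lambda>x. indicat_real E x *\<^sub>R (Gp x - Gp x0)) \<le> \<mu>\<^sup>2 * m"
              by (rule sqnorm_indicator_mono[OF EM Q(1) E(2) sc[OF sGp]])
                 (use d2(2)[rule_format, OF conjI[OF R(1,3)]] m in \<open>simp add: mult.assoc\<close>)
            show "sqnorm ?M (\<lambda>x. indicat_real E x *\<^sub>R (a x - a x0)) \<le> \<mu>\<^sup>2 * m"
              by (rule sqnorm_indicator_mono[OF EM Q(1) E(2) sc[OF sa]])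
                 (use d3(2)[rule_format, OF conjI[OF R(1,4)]] m in \<open>simp add: mult.assoc\<close>)
            show "sqnorm ?M (\<lambda>x. grad S x - indicat_real E x *\<^sub>R n) \<le> \<mu>\<^sup>2 * m" using errS m_eq by simp
            have "16 * R ^ 4 = (16 * R\<^sup>2) * R\<^sup>2" by (simp add: power2_eq_square power4_eq_xxxx)
            also have "\<dots> \<le> (\<mu>\<^sup>2 * \<theta>) * R\<^sup>2" using R(6) by (intro mult_right_mono) auto
            finally show "sqnorm ?M S \<le> \<mu>\<^sup>2 * m" using nS m by (simp add: mult.assoc)
          qed
          \<comment> \<open>Everything is now a multiple of the positive area \<open>m\<close>,
            which can be divided out.\<close>
          with J \<gamma>diff have "0 \<le> V * m + K * \<mu> * m + ((gb - \<gamma> x0) * m + \<mu> * m)" by linarith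
          also have "\<dots> = (V + gb - \<gamma> x0 + (K + 1) * \<mu>) * m" by (simp add: algebra_simps)
          finally show ?thesis using m0 by (simp add: zero_le_mult_iff)
        qed
        have "0 \<le> V + gb - \<gamma> x0"
        proof (rule tendsto_lowerbound)
          have "((\<lambda>\<mu>. V + gb - \<gamma> x0 + (K + 1) * \<mu>) \<longlongrightarrow> V + gb - \<gamma> x0 + (K + 1) * 0) (at_right (0::real))"
            by (intro tendsto_intros)
          then show "((\<lambda>\<mu>. V + gb - \<gamma> x0 + (K + 1) * \<mu>) \<longlongrightarrow> V + gb - \<gamma> x0) (at_right (0::real))" by simp
          show "\<forall>\<^sub>F \<mu> in at_right (0::real). 0 \<le> V + gb - \<gamma> x0 + (K + 1) * \<mu>"
            using eventually_at_right_real[of 0 1] by (rule eventually_mono) (auto intro!: main)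
        qed simp
        then show "0 \<le> ereal V + g b - ereal (\<gamma> x0)" unfolding real by simp
      next
        case PInf
        then show "0 \<le> ereal V + g b - ereal (\<gamma> x0)" by simp
      next
        case MInf
        then show "0 \<le> ereal V + g b - ereal (\<gamma> x0)" using g_nonneginf by blast
      qed
    qed
  qed
qed

end
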